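(* Let $V$ be a valuation domain with quotient field $K$, maximal ideal $M$, valuation $v$ and value group $\Gamma_v$. Let $E=\{s_\nu\}_{\nu\in\Lambda}\subset K$ be a pseudo-monotone sequence. If $\mathcal P_E$ is nonempty, let $\Delta_E=v_E(p)$ for some $p\in\mathcal P_E$ of minimal degree. (a) If $E$ is either pseudo-convergent of algebraic type or pseudo-divergent, then $\Gamma_{v_E}=\Delta_E\mathbb Z\oplus\Gamma_v$ (as groups) and $V_E/M_E\cong V/M$. (b) If $E$ is pseudo-convergent of transcendental type, then $V\subset V_E$ is immediate. (c) If $E$ is pseudo-stationary, then $\Gamma_{v_E}=\Gamma_v$ and $V_E/M_E$ is a purely transcendental extension of $V/M$: more precisely, $V_E/M_E=(V/M)(t)$, where $t$ is the residue of $\frac{X-\alpha}{c}$ modulo $M_E$, with $c\in K$ satisfying $v(c)=\delta_E$ and $\alpha\in\mathcal L_E$. (d) If $E$ is not pseudo-convergent of transcendental type, then $\Gamma_{v_E}=\langle\Gamma_v,\Delta_E\rangle$. Furthermore, $\Delta_E$ does not depend on $p$ and, if $E$ is a pseudo-stationary sequence, $\Delta_E=\delta_E$. (e) If $E$ has a pseudo-limit $\beta\in K$, then $v_E=v_{\beta,\Delta_E}$.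
   Context: $\overline K$ is a fixed algebraic closure of $K$. Sequences $E=\{s_\nu\}_{\nu\in\Lambda}\subset K$ are indexed by well-ordered sets $\Lambda$ without maximum. $E$ is pseudo-convergent if $v(s_\rho-s_\nu)<v(s_\sigma-s_\rho)$ for all $\nu<\rho<\sigma$; pseudo-divergent if $v(s_\rho-s_\nu)>v(s_\sigma-s_\rho)$ for all $\nu<\rho<\sigma$; pseudo-stationary if $v(s_\nu-s_\mu)=v(s_{\nu'}-s_{\mu'})$ for all $\nu\ne\mu$, $\nu'\neq\mu'$; pseudo-monotone if it is one of these three. The gauge $\{\delta_\nu\}$ of $E$ is: $\delta_\nu=v(s_\rho-s_\nu)$ for any $\rho>\nu$ if $E$ is pseudo-convergent; $\delta_\nu=v(s_\rho-s_\nu)$ for any $\rho<\nu$ ($\nu$ not the minimum of $\Lambda$) if $E$ is pseudo-divergent; the constant $\delta_\nu=\delta_E:=v(s_\rho-s_\mu)$, $\rho\neq\mu$, if $E$ is pseudo-stationary. An element $\alpha\in K$ is a pseudo-limit of $E$ if $v(\alpha-s_\nu)=\delta_\nu$ for all sufficiently large $\nu$; $\mathcal L_E$ is the set of pseudo-limits in $K$. If $u$ is an extension of $v$ to $\overline K$, $E$ is also pseudo-monotone with respect to $u$, and pseudo-limits of $E$ in $\overline K$ with respect to $u$ are defined in the same way. A pseudo-convergent sequence $E$ is of transcendental type if for every $f\in K[X]$ the values $v(f(s_\nu))$ are eventually constant, and of algebraic type if $v(f(s_\nu))$ is eventually strictly increasing for some $f\in K[X]$; exactly one of these occurs, and $E$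 is of algebraic type if and only if it has a pseudo-limit in $\overline K$ with respect to some extension of $v$. $V_E=\{\phi\in K(X)\mid \phi(s_\nu)\in V\text{ for all sufficiently large }\nu\}$ is a valuation domain of $K(X)$ extending $V$; $M_E$ is its maximal ideal, $v_E$ its valuation (normalized to extend $v$) and $\Gamma_{v_E}\supseteq\Gamma_v$ its value group. $\mathcal P_E$ is the set of irreducible monic polynomials $p\in K[X]$ having at least one root in $\overline K$ which is a pseudo-limit of $E$ with respect to some extension of $v$ to $\overline K$; it is empty exactly when $E$ is pseudo-convergent of transcendental type. An extension of valuation domains is immediate if value groups and residue fields coincide. For a totally ordered group $\Gamma\supseteq\Gamma_v$, $\alpha\in K$ and $\delta\in\Gamma$, the monomial valuation $v_{\alpha,\delta}$ on $K(X)$ is given on polynomials by $v_{\alpha,\delta}\left(\sum_i a_i(X-\alpha)^i\right)=\min_i\{v(a_i)+i\delta\}$ and extended to $K(X)$ by $v_{\alpha,\delta}(f/g)=v_{\alpha,\delta}(f)-v_{\alpha,\delta}(g)$. *)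

theory Defs
  imports "HOL-Algebra.Algebraic_Closure_Type" "HOL-Algebra.Generated_Fields"
    "HOL-Algebra.Finite_Extensions" "HOL-Computational_Algebra.Computational_Algebra"
begin

section \<open>Valuations\<close>

datatype 'g vext = Val 'g | Infty

instantiation vext :: (linorder) linorder
begin

fun less_eq_vext :: "'a vext \<Rightarrow> 'a vext \<Rightarrow> bool" where
  "less_eq_vext _ Infty = True"
| "less_eq_vext (Val a) (Val b) = (a \<le> b)"
| "less_eq_vext Infty (Val _) = False"

definition less_vext :: "'a vext \<Rightarrow> 'a vext \<Rightarrow> bool" where
  "less_vext x y = (x \<le> y \<and> \<not> y \<le> x)"

instance
proof
  fix x y z :: "'a vext"
  show "(x < y) = (x \<le> y \<and> \<not> y \<le> x)" by (rule less_vext_def)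
  show "x \<le> x" by (cases x) auto
  show "x \<le> y \<Longrightarrow> y \<le> z \<Longrightarrow> x \<le> z" by (cases x; cases y; cases z) auto
  show "x \<le> y \<Longrightarrow> y \<le> x \<Longrightarrow> x = y" by (cases x; cases y) auto
  show "x \<le> y \<or> y \<le> x" by (cases x; cases y) auto
qed

end

instantiation vext :: (ab_group_add) comm_monoid_add
begin

definition zero_vext :: "'a vext" where "zero_vext = Val 0"

fun plus_vext :: "'a vext \<Rightarrow> 'a vext \<Rightarrow> 'a vext" where
  "plus_vext (Val a) (Val b) = Val (a + b)"
| "plus_vext Infty _ = Infty"
| "plus_vext _ Infty = Infty"

instance
proof
  fix x y z :: "'a vext"
  show "x + y + z = x + (y + z)" by (cases x; cases y; cases z) (auto simp: add.assoc)
  show "x + y = y + x" by (cases x; cases y) (auto simp: add.commute)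
  show "0 + x = x" by (cases x) (auto simp: zero_vext_def)
qed

end

text \<open>Only subtraction of a finite value is meaningful; subtracting \<open>Infty\<close> gives a junk value.\<close>

instantiation vext :: (minus) minus
begin

fun minus_vext :: "'a vext \<Rightarrow> 'a vext \<Rightarrow> 'a vext" where
  "minus_vext (Val a) (Val b) = Val (a - b)"
| "minus_vext Infty _ = Infty"
| "minus_vext (Val _) Infty = Infty"

instance ..

end

text \<open>
  The type \<open>'g\<close> is an ambient totally ordered group: a valuation need not be onto it, and its
  value group is \<open>value_group v\<close>. Thus two valuations with the same \<open>'g\<close> have
  value groups inside one ordered group.
\<close>

definition valuation :: "('f::field \<Rightarrow> 'g::linordered_ab_group_add vext) \<Rightarrow> bool" where
  "valuation v \<longleftrightarrow>
     (\<forall>x. v x = Infty \<longleftrightarrow> x = 0) \<and>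
     (\<forall>x y. v (x * y) = v x + v y) \<and>
     (\<forall>x y. min (v x) (v y) \<le> v (x + y))"

definition value_group :: "('f::field \<Rightarrow> 'g vext) \<Rightarrow> 'g set" where
  "value_group v = {\<gamma>. \<exists>x. v x = Val \<gamma>}"

definition val_ring :: "('f::field \<Rightarrow> 'g::linordered_ab_group_add vext) \<Rightarrow> 'f set" where
  "val_ring v = {x. 0 \<le> v x}"

definition max_ideal :: "('f::field \<Rightarrow> 'g::linordered_ab_group_add vext) \<Rightarrow> 'f set" where
  "max_ideal v = {x. 0 < v x}"

definition val_ring_str :: "('f::field \<Rightarrow> 'g::linordered_ab_group_add vext) \<Rightarrow> 'f ring" where
  "val_ring_str v = ring_of_type_algebra \<lparr> carrier := val_ring v \<rparr>"

definition residue_field :: "('f::field \<Rightarrow> 'g::linordered_ab_group_add vext) \<Rightarrow> 'f set ring" where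
  "residue_field v = val_ring_str v Quot max_ideal v"

definition residue :: "('f::field \<Rightarrow> 'g::linordered_ab_group_add vext) \<Rightarrow> 'f \<Rightarrow> 'f set" where
  "residue v x = max_ideal v +>\<^bsub>val_ring_str v\<^esub> x"

section \<open>Extensions to the field of rational functions\<close>

abbreviation rat_const :: "'a::field \<Rightarrow> 'a poly fract" where
  "rat_const c \<equiv> Fract [:c:] 1"

definition extends_to_rat ::
    "('a::field \<Rightarrow> 'g::linordered_ab_group_add vext) \<Rightarrow> ('a poly fract \<Rightarrow> 'g vext) \<Rightarrow> bool" where
  "extends_to_rat v w \<longleftrightarrow> valuation w \<and> (\<forall>c. w (rat_const c) = v c)"

text \<open>The canonical embedding of residue fields is an isomorphism.\<close>

definition same_residue_field ::
    "('a::field \<Rightarrow> 'g::linordered_ab_group_add vext) \<Rightarrow> ('a poly fract \<Rightarrow> 'g vext) \<Rightarrow> bool" where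
  "same_residue_field v w \<longleftrightarrow>
     (\<exists>h \<in> ring_iso (residue_field v) (residue_field w).
        \<forall>a \<in> val_ring v. h (residue v a) = residue w (rat_const a))"

definition immediate ::
    "('a::field \<Rightarrow> 'g::linordered_ab_group_add vext) \<Rightarrow> ('a poly fract \<Rightarrow> 'g vext) \<Rightarrow> bool" where
  "immediate v w \<longleftrightarrow> value_group w = value_group v \<and> same_residue_field v w"

definition base_residue_field ::
    "('a::field \<Rightarrow> 'g::linordered_ab_group_add vext) \<Rightarrow> ('a poly fract \<Rightarrow> 'g vext)
      \<Rightarrow> 'a poly fract set set" where
  "base_residue_field v w = (\<lambda>a. residue w (rat_const a)) ` val_ring v"

text \<open>The residue field of \<open>w\<close> is \<open>k(t)\<close> with \<open>t\<close> transcendental over the (embedded)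
  residue field \<open>k\<close> of \<open>v\<close>.\<close>

definition residue_field_purely_transcendental_by ::
    "('a::field \<Rightarrow> 'g::linordered_ab_group_add vext) \<Rightarrow> ('a poly fract \<Rightarrow> 'g vext)
      \<Rightarrow> 'a poly fract set \<Rightarrow> bool" where
  "residue_field_purely_transcendental_by v w t \<longleftrightarrow>
     t \<in> carrier (residue_field w) \<and>
     ring.transcendental (residue_field w) (base_residue_field v w) t \<and>
     generate_field (residue_field w) (insert t (base_residue_field v w))
       = carrier (residue_field w)"

definition int_mult :: "int \<Rightarrow> 'g::ab_group_add \<Rightarrow> 'g" where
  "int_mult n \<delta> = (if 0 \<le> n then (\<Sum>j<nat n. \<delta>) else - (\<Sum>j<nat (- n). \<delta>))"

text \<open>\<open>f \<circ>\<^sub>p [:\<alpha>, 1:]\<close> is \<open>f (X + \<alpha>)\<close>, whose \<open>i\<close>-th coefficient is the coefficient of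
  \<open>(X - \<alpha>) ^ i\<close> in the expansion of \<open>f\<close> around \<open>\<alpha>\<close>.\<close>

definition monomial_val_poly ::
    "('a::field \<Rightarrow> 'g::linordered_ab_group_add vext) \<Rightarrow> 'a \<Rightarrow> 'g \<Rightarrow> 'a poly \<Rightarrow> 'g vext" where
  "monomial_val_poly v \<alpha> \<delta> f =
     Min ((\<lambda>i. v (Polynomial.coeff (f \<circ>\<^sub>p [:\<alpha>, 1:]) i) + Val (int_mult (int i) \<delta>))
       ` {..Polynomial.degree f})"

definition monomial_val ::
    "('a::field \<Rightarrow> 'g::linordered_ab_group_add vext) \<Rightarrow> 'a \<Rightarrow> 'g \<Rightarrow> 'a poly fract \<Rightarrow> 'g vext" where
  "monomial_val v \<alpha> \<delta> \<phi> =
     (THE \<gamma>. \<exists>f g. g \<noteq> 0 \<and> \<phi> = Fract f g \<and>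
        \<gamma> = monomial_val_poly v \<alpha> \<delta> f - monomial_val_poly v \<alpha> \<delta> g)"

section \<open>Pseudo-monotone sequences\<close>

definition pseudo_convergent ::
    "('a::field \<Rightarrow> 'g::linordered_ab_group_add vext) \<Rightarrow> ('i::{wellorder,no_top} \<Rightarrow> 'a) \<Rightarrow> bool" where
  "pseudo_convergent v s \<longleftrightarrow>
     (\<forall>\<nu> \<rho> \<sigma>. \<nu> < \<rho> \<and> \<rho> < \<sigma> \<longrightarrow> v (s \<rho> - s \<nu>) < v (s \<sigma> - s \<rho>))"

definition pseudo_divergent ::
    "('a::field \<Rightarrow> 'g::linordered_ab_group_add vext) \<Rightarrow> ('i::{wellorder,no_top} \<Rightarrow> 'a) \<Rightarrow> bool" where
  "pseudo_divergent v s \<longleftrightarrow>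
     (\<forall>\<nu> \<rho> \<sigma>. \<nu> < \<rho> \<and> \<rho> < \<sigma> \<longrightarrow> v (s \<sigma> - s \<rho>) < v (s \<rho> - s \<nu>))"

text \<open>The gauge has values in the value group, so the common value must be finite: constant
  sequences, for which all the differences have value \<open>Infty\<close>, are excluded.\<close>

definition pseudo_stationary ::
    "('a::field \<Rightarrow> 'g::linordered_ab_group_add vext) \<Rightarrow> ('i::{wellorder,no_top} \<Rightarrow> 'a) \<Rightarrow> bool" where
  "pseudo_stationary v s \<longleftrightarrow>
     (\<forall>\<nu> \<mu> \<nu>' \<mu>'. \<nu> \<noteq> \<mu> \<and> \<nu>' \<noteq> \<mu>' \<longrightarrow> v (s \<nu> - s \<mu>) = v (s \<nu>' - s \<mu>')) \<and>
     (\<forall>\<nu> \<mu>. \<nu> \<noteq> \<mu> \<longrightarrow> v (s \<nu> - s \<mu>) \<noteq> Infty)"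

definition pseudo_monotone ::
    "('a::field \<Rightarrow> 'g::linordered_ab_group_add vext) \<Rightarrow> ('i::{wellorder,no_top} \<Rightarrow> 'a) \<Rightarrow> bool" where
  "pseudo_monotone v s \<longleftrightarrow>
     pseudo_convergent v s \<or> pseudo_divergent v s \<or> pseudo_stationary v s"

definition stationary_value ::
    "('a::field \<Rightarrow> 'g::linordered_ab_group_add vext) \<Rightarrow> ('i::{wellorder,no_top} \<Rightarrow> 'a) \<Rightarrow> 'g vext" where
  "stationary_value v s = (THE \<delta>. \<forall>\<rho> \<mu>. \<rho> \<noteq> \<mu> \<longrightarrow> v (s \<rho> - s \<mu>) = \<delta>)"

text \<open>For a pseudo-convergent or pseudo-divergent sequence the value does not depend on the index
  chosen. For a pseudo-divergent sequence the gauge is unspecified at the least index.\<close>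

definition gauge ::
    "('a::field \<Rightarrow> 'g::linordered_ab_group_add vext) \<Rightarrow> ('i::{wellorder,no_top} \<Rightarrow> 'a) \<Rightarrow> 'i \<Rightarrow> 'g vext" where
  "gauge v s \<nu> =
     (if pseudo_convergent v s then v (s (SOME \<rho>. \<nu> < \<rho>) - s \<nu>)
      else if pseudo_divergent v s then v (s (SOME \<rho>. \<rho> < \<nu>) - s \<nu>)
      else stationary_value v s)"

definition pseudo_limits ::
    "('a::field \<Rightarrow> 'g::linordered_ab_group_add vext) \<Rightarrow> ('i::{wellorder,no_top} \<Rightarrow> 'a) \<Rightarrow> 'a set" where
  "pseudo_limits v s = {\<alpha>. \<forall>\<^sub>F \<nu> in at_top. v (\<alpha> - s \<nu>) = gauge v s \<nu>}"

definition pc_transcendental ::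
    "('a::field \<Rightarrow> 'g::linordered_ab_group_add vext) \<Rightarrow> ('i::{wellorder,no_top} \<Rightarrow> 'a) \<Rightarrow> bool" where
  "pc_transcendental v s \<longleftrightarrow> pseudo_convergent v s \<and>
     (\<forall>f. \<exists>c. \<forall>\<^sub>F \<nu> in at_top. v (poly f (s \<nu>)) = c)"

definition pc_algebraic ::
    "('a::field \<Rightarrow> 'g::linordered_ab_group_add vext) \<Rightarrow> ('i::{wellorder,no_top} \<Rightarrow> 'a) \<Rightarrow> bool" where
  "pc_algebraic v s \<longleftrightarrow> pseudo_convergent v s \<and>
     (\<exists>f N. strict_mono_on {N..} (\<lambda>\<nu>. v (poly f (s \<nu>))))"

section \<open>Pseudo-limits in the algebraic closure\<close>

text \<open>
  An extension \<open>u\<close> of \<open>v\<close> to the algebraic closure may need a larger value group than \<open>v\<close>, so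
  it is given by its valuation domain \<open>U\<close>, lying over that of \<open>v\<close>, and is taken in its canonical
  form, where the value of \<open>x \<noteq> 0\<close> is its class modulo the group of units of \<open>U\<close> (and the value
  of \<open>0\<close>, playing the role of infinity, is the set consisting of \<open>0\<close> only).
\<close>

definition valuation_domain :: "'f::field set \<Rightarrow> bool" where
  "valuation_domain U \<longleftrightarrow>
     1 \<in> U \<and> (\<forall>x\<in>U. \<forall>y\<in>U. x - y \<in> U \<and> x * y \<in> U) \<and> (\<forall>x. x \<in> U \<or> inverse x \<in> U)"

definition canonical_val :: "'f::field set \<Rightarrow> 'f \<Rightarrow> 'f set" where
  "canonical_val U x = {x * e | e. e \<noteq> 0 \<and> e \<in> U \<and> inverse e \<in> U}"

definition extends_to_closure ::
    "('a::field \<Rightarrow> 'g::linordered_ab_group_add vext) \<Rightarrow> 'a alg_closure set \<Rightarrow> bool" where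
  "extends_to_closure v U \<longleftrightarrow> valuation_domain U \<and> {x. to_ac x \<in> U} = val_ring v"

text \<open>The equation \<open>u (\<alpha> - s \<nu>) = \<delta> \<nu>\<close> is read in the value group of \<open>u\<close>, in which the
  value \<open>\<delta> \<nu> = v d\<close> of \<open>v\<close> is the value of \<open>u\<close> at the image of \<open>d\<close>.\<close>

definition closure_pseudo_limit ::
    "('a::field \<Rightarrow> 'g::linordered_ab_group_add vext) \<Rightarrow> 'a alg_closure set
      \<Rightarrow> ('i::{wellorder,no_top} \<Rightarrow> 'a) \<Rightarrow> 'a alg_closure \<Rightarrow> bool" where
  "closure_pseudo_limit v U s \<alpha> \<longleftrightarrow>
     (\<forall>\<^sub>F \<nu> in at_top. \<exists>d. v d = gauge v s \<nu> \<and>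
        canonical_val U (\<alpha> - to_ac (s \<nu>)) = canonical_val U (to_ac d))"

definition P_E ::
    "('a::field \<Rightarrow> 'g::linordered_ab_group_add vext) \<Rightarrow> ('i::{wellorder,no_top} \<Rightarrow> 'a) \<Rightarrow> 'a poly set" where
  "P_E v s = {p. Factorial_Ring.irreducible p \<and> Polynomial.lead_coeff p = 1 \<and>
     (\<exists>U \<alpha>. extends_to_closure v U \<and> poly (map_poly to_ac p) \<alpha> = 0 \<and>
        closure_pseudo_limit v U s \<alpha>)}"

definition P_E_min ::
    "('a::field \<Rightarrow> 'g::linordered_ab_group_add vext) \<Rightarrow> ('i::{wellorder,no_top} \<Rightarrow> 'a) \<Rightarrow> 'a poly set" where
  "P_E_min v s = {p \<in> P_E v s. \<forall>q \<in> P_E v s. Polynomial.degree p \<le> Polynomial.degree q}"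

section \<open>The valuation domain of a sequence\<close>

text \<open>\<open>\<phi> (x) \<in> V\<close> for a rational function \<open>\<phi>\<close>: some representation of \<open>\<phi>\<close> has a denominator not
  vanishing at \<open>x\<close>, and the resulting value lies in \<open>V\<close>.\<close>

definition V_E ::
    "('a::field \<Rightarrow> 'g::linordered_ab_group_add vext) \<Rightarrow> ('i::{wellorder,no_top} \<Rightarrow> 'a)
      \<Rightarrow> 'a poly fract set" where
  "V_E v s = {\<phi>. \<forall>\<^sub>F \<nu> in at_top. \<exists>f g. \<phi> = Fract f g \<and> poly g (s \<nu>) \<noteq> 0 \<and>
     poly f (s \<nu>) / poly g (s \<nu>) \<in> val_ring v}"

text \<open>A valuation is determined by its valuation domain only up to an isomorphism of value
  groups; the condition that it extends \<open>v\<close> is the normalization.\<close>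

definition is_valuation_of_seq ::
    "('a::field \<Rightarrow> 'g::linordered_ab_group_add vext) \<Rightarrow> ('i::{wellorder,no_top} \<Rightarrow> 'a)
      \<Rightarrow> ('a poly fract \<Rightarrow> 'g vext) \<Rightarrow> bool" where
  "is_valuation_of_seq v s w \<longleftrightarrow> extends_to_rat v w \<and> val_ring w = V_E v s"

end

(*
  Write w for v_E. A nonzero polynomial f has no zero on a tail of s, so w(g) <= w(f) iff v(g(s_nu)) <= v(f(s_nu))
  eventually. Write x ~ y if v(y) < v(x - y).
  If s is pseudo-convergent, each root of f in the algebraic closure, for a fixed extension of v (which
  exists by Chevalley's theorem), either is a pseudo-limit, and then its contribution to v(f(s_nu)) is
  strictly increasing, or contributes a factor that is eventually constant up to ~. Hence f ~ constant
  unless f has a pseudo-limit among its roots. If p is of minimal degree in P_E (or p = X - b with a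
  pseudo-limit b in the pseudo-divergent case), polynomials of smaller degree are ~ constants while
  no positive multiple of w(p) is a value of v. The terms of a p-adic expansion then have distinct
  values, so every rational function is ~ c p^n, and this gives value group and residue field.
  If s is pseudo-stationary with value delta, a polynomial f of degree d satisfies
  v(f(s_nu)) > v(f(b)) for at most d indices nu, whenever b is a pseudo-limit; this makes w the
  monomial valuation at b with delta, that is, a Gauss valuation in (X - b)/c.
*)
theory Submission
  imports Defs
begin

section \<open>Values and valuations\<close>

text \<open>The obstacle is that an extension of \<open>v\<close> to the algebraic closure need not
  take values in the group of \<open>v\<close>, so the contributions of single roots have no sum
  there. Only quotients are used: the product over the roots \<alpha> of (s \<nu> - \<alpha>) / (s
  \<mu> - \<alpha>) is f(s \<nu>) / f(s \<mu>), which lies in K, where the extension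
  \<open>U\<close> and its maximal ideal restrict to those of \<open>v\<close>. Minimality of the
  degree of p works for every extension alike: whichever \<open>U\<close> makes a root of f a
  pseudo-limit, the minimal polynomial of that root lies in \<open>P_E\<close>, so f cannot have
  smaller degree than p. Multiples of w(p) avoid the values of \<open>v\<close> because the values
  of p along a tail are pairwise distinct, while w(p^n) = v(c) would make v(p(s \<nu>)^n) eventually
  constant. In the stationary case v(s \<nu> - b) is itself eventually constant, so this fails; the
  substitute is a count of exceptional indices, that is, root counting over the residue
  field.\<close>

lemma vext_simps [simp]:
  fixes x y :: "'g::linordered_ab_group_add vext"
  shows "Val a < Val b \<longleftrightarrow> a < b" "Val a < Infty" "\<not> Infty < x" "Infty \<le> x \<longleftrightarrow> x = Infty"
    "x < Infty \<longleftrightarrow> x \<noteq> Infty" "Infty \<noteq> (0 :: 'g vext)"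
    "(0 :: 'g vext) \<noteq> Infty" "x + Infty = Infty" "x + y = Infty \<longleftrightarrow> x = Infty \<or> y = Infty"
  by (cases x; cases y; auto simp: less_vext_def zero_vext_def)+

instance vext :: (linordered_ab_group_add) ordered_comm_monoid_add
proof
  fix x y z :: "'a vext"
  assume "x \<le> y" then show "z + x \<le> z + y"
    by (cases x; cases y; cases z) auto
qed

lemma vext_add_cancel:
  fixes x y z :: "'g::linordered_ab_group_add vext"
  assumes "z \<noteq> Infty"
  shows "z + x = z + y \<longleftrightarrow> x = y" "z + x \<le> z + y \<longleftrightarrow> x \<le> y" "z + x < z + y \<longleftrightarrow> x < y"
    "x + z = y + z \<longleftrightarrow> x = y" "x + z \<le> y + z \<longleftrightarrow> x \<le> y" "x + z < y + z \<longleftrightarrow> x < y"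
  using assms by (cases x; cases y; cases z; auto)+

lemma vext_add_strict_mono:
  fixes x y z t :: "'g::linordered_ab_group_add vext"
  assumes "x < y" "z \<le> t" "z \<noteq> Infty"
  shows "x + z < y + t" "z + x < t + y"
proof -
  have "x + z < y + z" using assms by (simp add: vext_add_cancel)
  also have "\<dots> \<le> y + t" using assms by (simp add: add_left_mono)
  finally show "x + z < y + t" .
  then show "z + x < t + y" by (simp add: add.commute)
qed

lemma vext_add_diff [simp]:
  fixes x y :: "'g::linordered_ab_group_add vext"
  assumes "y \<noteq> Infty"
  shows "(x + y) - y = x"
  using assms by (cases x; cases y) auto

locale valued_field =
  fixes v :: "'f::field \<Rightarrow> 'g::linordered_ab_group_add vext"
  assumes valuation: "valuation v"
begin

lemma v_Infty [simp]: "v x = Infty \<longleftrightarrow> x = 0"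
  and v_mult [simp]: "v (x * y) = v x + v y"
  and v_add: "min (v x) (v y) \<le> v (x + y)"
  using valuation unfolding valuation_def by auto

lemma v_0 [simp]: "v 0 = Infty"
  by simp

lemma v_1 [simp]: "v 1 = 0"
  using v_mult[of 1 1] by (cases "v 1") (auto simp: zero_vext_def)

lemma v_uminus [simp]: "v (- x) = v x"
proof -
  have "v (- 1) = 0"
    using v_mult[of "- 1" "- 1"] by (cases "v (- 1)") (auto simp: zero_vext_def)
  then show ?thesis using v_mult[of "- 1" x] by simp
qed

lemma v_minus_commute: "v (x - y) = v (y - x)"
  using v_uminus[of "x - y"] by simp

lemma v_add_ge: "\<gamma> \<le> v x \<Longrightarrow> \<gamma> \<le> v y \<Longrightarrow> \<gamma> \<le> v (x + y)"
  using v_add[of x y] by (meson min.boundedI order_trans)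

lemma v_diff_ge: "\<gamma> \<le> v x \<Longrightarrow> \<gamma> \<le> v y \<Longrightarrow> \<gamma> \<le> v (x - y)"
  using v_add_ge[of \<gamma> x "- y"] by simp

lemma v_add_gt: "\<gamma> < v x \<Longrightarrow> \<gamma> < v y \<Longrightarrow> \<gamma> < v (x + y)"
  using v_add[of x y] by (metis min_less_iff_conj order_less_le_trans)

lemma v_diff_gt: "\<gamma> < v x \<Longrightarrow> \<gamma> < v y \<Longrightarrow> \<gamma> < v (x - y)"
  using v_add_gt[of \<gamma> x "- y"] by simp

lemma v_add_eq: 
  assumes "v x < v y" 
  shows "v (x + y) = v x" "v (y + x) = v x" "v (x - y) = v x" "v (y - x) = v x"
proof -
  have *: "v (x + y) = v x" if "v x < v y" for x y
  proof (rule antisym)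
    show "v (x + y) \<le> v x"
    proof (rule ccontr)
      assume "\<not> ?thesis"
      then have "v x < v ((x + y) - y)" by (intro v_diff_gt that) simp
      then show False by simp
    qed
  qed (use that in \<open>auto intro!: v_add_ge\<close>)
  show "v (x + y) = v x" by (rule *[OF assms])
  then show "v (y + x) = v x" by (simp add: add.commute)
  show "v (x - y) = v x" using *[of x "- y"] assms by simp
  then show "v (y - x) = v x" by (simp add: v_minus_commute)
qed

lemma v_inverse: "x \<noteq> 0 \<Longrightarrow> v (inverse x) + v x = 0"
  using v_mult[of "inverse x" x] by simp

lemma v_divide: "y \<noteq> 0 \<Longrightarrow> v (x / y) + v y = v x"
  by (metis nonzero_eq_divide_eq v_mult)

lemma v_divide_eq: "y \<noteq> 0 \<Longrightarrow> v (x / y) = v x - v y"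
  using v_divide[of y x] vext_add_diff[of "v y" "v (x / y)"] by (simp add: v_divide)

lemma v_divide_iff:
  assumes "y \<noteq> 0"
  shows "0 \<le> v (x / y) \<longleftrightarrow> v y \<le> v x" "0 < v (x / y) \<longleftrightarrow> v y < v x" "v (x / y) = 0 \<longleftrightarrow> v x = v y"
proof -
  have "v y \<noteq> Infty" using assms by simp
  note c = vext_add_cancel(4-6)[OF this, of 0 "v (x / y)"]
  show "0 \<le> v (x / y) \<longleftrightarrow> v y \<le> v x" "0 < v (x / y) \<longleftrightarrow> v y < v x" "v (x / y) = 0 \<longleftrightarrow> v x = v y"
    using c v_divide[OF assms, of x] by auto
qed

lemma v_power_less: "n > 0 \<Longrightarrow> v x < v y \<Longrightarrow> v (x ^ n) < v (y ^ n)"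
proof (induction n rule: nat_induct_non_zero)
  case (Suc n)
  then have "x \<noteq> 0" by auto
  with Suc show ?case by (auto intro!: vext_add_strict_mono)
qed simp

lemma v_power_eq_imp: "n > 0 \<Longrightarrow> v (x ^ n) = v (y ^ n) \<Longrightarrow> v x = v y"
  by (metis v_power_less less_irrefl linorder_neqE)

text \<open>For \<open>y \<noteq> 0\<close> this says that \<open>x / y \<in> 1 + M\<close>; the class of \<open>x\<close> determines both its value
  and, if it is a unit, its residue.\<close>

definition asymp :: "'f \<Rightarrow> 'f \<Rightarrow> bool" (infix \<open>\<approx>\<close> 50) where
  "x \<approx> y \<longleftrightarrow> v y < v (x - y)"

lemma asymp_nz: "x \<approx> y \<Longrightarrow> y \<noteq> 0"
  by (auto simp: asymp_def)

lemma asymp_v: 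
  assumes "x \<approx> y" 
  shows "v x = v y"
  using v_add_eq(1)[of y "x - y"] assms by (simp add: asymp_def)

lemma asymp_nz': "x \<approx> y \<Longrightarrow> x \<noteq> 0"
  using asymp_v[of x y] asymp_nz[of x y] v_Infty by metis

lemma asymp_refl: "x \<noteq> 0 \<Longrightarrow> x \<approx> x"
  by (simp add: asymp_def)

lemma asymp_sym: "x \<approx> y \<Longrightarrow> y \<approx> x"
  using asymp_v[of x y] by (simp add: asymp_def v_minus_commute)

lemma asymp_trans: 
  assumes "x \<approx> y" "y \<approx> z" 
  shows "x \<approx> z"
  using v_add_gt[of "v z" "x - y" "y - z"] asymp_v[OF assms(2)] assms by (simp add: asymp_def)

lemma asymp_mult:
  assumes "x \<approx> y" "z \<approx> t"
  shows "x * z \<approx> y * t"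
proof -
  have nz: "y \<noteq> 0" "t \<noteq> 0" using assms asymp_nz by auto
  have "x * z - y * t = (x - y) * z + (z - t) * y" by (simp add: algebra_simps)
  moreover have "v (y * t) < v ((x - y) * z)"
    using assms asymp_v[OF assms(2)] nz by (auto simp: asymp_def vext_add_cancel)
  moreover have "v (y * t) < v ((z - t) * y)"
    using assms nz by (auto simp: asymp_def vext_add_cancel add.commute[of "v y"])
  ultimately show ?thesis by (metis asymp_def v_add_gt)
qed

lemma asymp_inverse:
  assumes "x \<approx> y"
  shows "inverse x \<approx> inverse y"
proof -
  have nz: "x \<noteq> 0" "y \<noteq> 0" using assms asymp_nz asymp_nz' by auto
  then have "inverse y * inverse x \<noteq> 0" by simp
  from asymp_mult[OF asymp_sym[OF assms] asymp_refl[OF this]]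
  show ?thesis using nz by (simp add: field_simps)
qed

lemma asymp_divide: "x \<approx> y \<Longrightarrow> z \<approx> t \<Longrightarrow> x / z \<approx> y / t"
  by (simp add: divide_inverse asymp_mult asymp_inverse)

lemma asymp_add_left: "v x < v y \<Longrightarrow> x + y \<approx> x" "v x < v y \<Longrightarrow> y + x \<approx> x"
  by (auto simp: asymp_def)

end

section \<open>Integer multiples in an abelian group\<close>

lemma sum_const_add:
  fixes \<delta> :: "'g::ab_group_add" and m n :: nat
  shows "(\<Sum>j<m + n. \<delta>) = (\<Sum>j<m. \<delta>) + (\<Sum>j<n. \<delta>)"
  by (induction n) (auto simp: add.assoc)

text \<open>Writing an integer as a difference of two naturals removes the sign distinction of
  \<open>int_mult\<close>; additivity over the integers then reduces to additivity over the
  naturals.\<close>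

lemma int_mult_diff:
  "int_mult (int m - int n) \<delta> = (\<Sum>j<m. \<delta>) - (\<Sum>j<n. \<delta>)" for \<delta> :: "'g::ab_group_add"
proof -
  note * = sum_const_add[of \<delta>]
  show ?thesis
  proof (cases "n \<le> m")
    case True
    then obtain k where "m = n + k" using le_Suc_ex by blast
    then show ?thesis by (simp add: int_mult_def *)
  next
    case False
    then obtain k where "n = m + k" "k > 0" by (metis less_imp_add_positive not_le)
    then show ?thesis by (auto simp: int_mult_def *)
  qed
qed

lemma int_mult_add: "int_mult (a + b) \<delta> = int_mult a \<delta> + int_mult b \<delta>"
proof -
  obtain m n k l where "a = int m - int n" "b = int k - int l"
    by (metis int_diff_cases)
  moreover from this have "a + b = int (m + k) - int (n + l)" by simp
  ultimately show ?thesis by (simp only: int_mult_diff) (simp add: sum_const_add)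
qed

lemma int_mult_simps [simp]: "int_mult 0 \<delta> = 0" "int_mult 1 \<delta> = \<delta>"
  by (auto simp: int_mult_def)

lemma int_mult_uminus: "int_mult (- a) \<delta> = - int_mult a \<delta>"
  using int_mult_add[of a "- a" \<delta>] by (simp add: eq_neg_iff_add_eq_0 add.commute)

lemma int_mult_minus: "int_mult (a - b) \<delta> = int_mult a \<delta> - int_mult b \<delta>"
  using int_mult_add[of a "- b" \<delta>] by (simp add: int_mult_uminus)

lemma int_mult_in_group_closure: "\<delta> \<in> group_closure S \<Longrightarrow> int_mult n \<delta> \<in> group_closure S"
proof (induction n rule: int_induct[of _ 0])
  case (step1 i)
  then show ?case by (simp add: int_mult_add group_closure_add)
next
  case (step2 i)
  then show ?case by (simp add: int_mult_minus group_closure.diff)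
qed simp

lemma (in valued_field) v_power: "v x = Val \<delta> \<Longrightarrow> v (x ^ n) = Val (int_mult (int n) \<delta>)"
  by (induction n) (auto simp: int_mult_add zero_vext_def)

section \<open>Extending a valuation domain\<close>

definition polys_over :: "'a::comm_ring_1 set \<Rightarrow> 'a poly set" where
  "polys_over A = {p. \<forall>i. Polynomial.coeff p i \<in> A}"

text \<open>A subring with one of its ideals; closure under subtraction covers sums and negatives.
  Properness of \<open>J\<close> is a separate condition because adjoining an element can destroy
  it, and this failure is what yields relations.\<close>

definition subring_ideal :: "'a::comm_ring_1 set \<Rightarrow> 'a set \<Rightarrow> bool" where
  "subring_ideal R J \<longleftrightarrow> 1 \<in> R \<and> (\<forall>x\<in>R. \<forall>y\<in>R. x - y \<in> R \<and> x * y \<in> R) \<and>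
     J \<subseteq> R \<and> 0 \<in> J \<and> (\<forall>x\<in>J. \<forall>y\<in>J. x - y \<in> J) \<and> (\<forall>x\<in>R. \<forall>y\<in>J. x * y \<in> J)"

lemma diff_closed_sum:
  fixes A :: "'a::ab_group_add set"
  assumes "0 \<in> A" "\<And>x y. x \<in> A \<Longrightarrow> y \<in> A \<Longrightarrow> x - y \<in> A" "\<And>i. i \<in> I \<Longrightarrow> f i \<in> A"
  shows "sum f I \<in> A"
proof (cases "finite I")
  case True
  then show ?thesis using assms(3)
  proof (induction I)
    case (insert i I)
    have "0 - sum f I \<in> A" using insert assms(1) by (intro assms(2)) auto
    then have "f i - (0 - sum f I) \<in> A" using insert by (intro assms(2)[of "f i"]) auto
    then show ?case by (simp add: insert.hyps)
  qed (simp add: assms)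
qed (simp add: assms)

locale subring_ideal_pair =
  fixes R J :: "'a::field set"
  assumes subring_ideal: "subring_ideal R J"
begin

lemma R_1: "1 \<in> R" and R_diff: "x \<in> R \<Longrightarrow> y \<in> R \<Longrightarrow> x - y \<in> R"
  and R_mult: "x \<in> R \<Longrightarrow> y \<in> R \<Longrightarrow> x * y \<in> R"
  and J_sub: "J \<subseteq> R" and J_0: "0 \<in> J" and J_diff: "x \<in> J \<Longrightarrow> y \<in> J \<Longrightarrow> x - y \<in> J"
  and J_mult: "x \<in> R \<Longrightarrow> y \<in> J \<Longrightarrow> x * y \<in> J"
  using subring_ideal by (auto simp: subring_ideal_def)

lemma J_mult': "y \<in> J \<Longrightarrow> x \<in> R \<Longrightarrow> y * x \<in> J"
  using J_mult by (simp add: mult.commute)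

lemma J_add: "x \<in> J \<Longrightarrow> y \<in> J \<Longrightarrow> x + y \<in> J"
  using J_diff[of x "0 - y"] J_diff[OF J_0] by simp

lemma R_power: "x \<in> R \<Longrightarrow> x ^ n \<in> R"
  by (induction n) (auto intro: R_1 R_mult)

lemma R_0: "0 \<in> R"
  using J_0 J_sub by auto

text \<open>The new pair is R[y] with the ideal generated by \<open>J\<close>. If \<open>R\<close>
  is maximal and y lies outside it, this ideal must be improper, which produces a polynomial over
  \<open>J\<close> with value 1 at y.\<close>

lemma adjoin: "subring_ideal ((\<lambda>p. poly p y) ` polys_over R) ((\<lambda>p. poly p y) ` polys_over J)"
proof -
  have 1: "p - q \<in> polys_over R" "p * q \<in> polys_over R" if "p \<in> polys_over R" "q \<in> polys_over R" for p q
    using that by (auto simp: polys_over_def coeff_mult intro!: diff_closed_sum R_0 R_diff R_mult)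
  have 2: "p - q \<in> polys_over J" if "p \<in> polys_over J" "q \<in> polys_over J" for p q
    using that by (auto simp: polys_over_def intro!: J_diff)
  have 3: "p * q \<in> polys_over J" if "p \<in> polys_over R" "q \<in> polys_over J" for p q
    using that by (auto simp: polys_over_def coeff_mult intro!: diff_closed_sum J_0 J_diff J_mult)
  have 4: "1 \<in> polys_over R" "0 \<in> polys_over J" "polys_over J \<subseteq> polys_over R"
    using J_sub R_0 R_1 J_0 by (auto simp: polys_over_def coeff_1)
  show ?thesis
    unfolding subring_ideal_def
  proof (intro conjI ballI)
    show "1 \<in> (\<lambda>p. poly p y) ` polys_over R" by (rule image_eqI[where x = 1]) (auto simp: 4)
    show "0 \<in> (\<lambda>p. poly p y) ` polys_over J" by (rule image_eqI[where x = 0]) (auto simp: 4)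
    show "(\<lambda>p. poly p y) ` polys_over J \<subseteq> (\<lambda>p. poly p y) ` polys_over R" using 4 by auto
  qed (auto simp flip: poly_diff poly_mult intro!: imageI 1 2 3)
qed

end

text \<open>A maximal element of the pairs \<open>(R, J)\<close> with \<open>1 \<notin> J\<close>, ordered by componentwise inclusion, is
  a valuation domain with its maximal ideal.\<close>

locale maximal_pair = subring_ideal_pair +
  assumes proper: "1 \<notin> J"
    and maximal: "\<And>R' J'. subring_ideal R' J' \<Longrightarrow> 1 \<notin> J' \<Longrightarrow> R \<subseteq> R' \<Longrightarrow> J \<subseteq> J' \<Longrightarrow> R' = R"
begin

lemma not_in_R:
  assumes "y \<notin> R"
  obtains p where "p \<in> polys_over J" "poly p y = 1"
proof -
  let ?R = "(\<lambda>p. poly p y) ` polys_over R" and ?J = "(\<lambda>p. poly p y) ` polys_over J"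
  have sub: "A \<subseteq> (\<lambda>p. poly p y) ` polys_over A" if "0 \<in> A" for A
  proof
    fix a assume "a \<in> A"
    then show "a \<in> (\<lambda>p. poly p y) ` polys_over A"
      using that by (intro image_eqI[where x = "[:a:]"]) (auto simp: polys_over_def coeff_pCons split: nat.split)
  qed
  have "y \<in> ?R"
    using R_0 R_1 by (intro image_eqI[where x = "[:0, 1:]"]) (auto simp: polys_over_def coeff_pCons split: nat.split)
  then have "?R \<noteq> R" using assms by auto
  then have "1 \<in> ?J"
    using maximal[OF adjoin _ sub[OF R_0] sub[OF J_0]] by blast
  then show thesis using that by (metis imageE)
qed

text \<open>Clearing denominators: with z = 1/y, a polynomial in y becomes the polynomial in z with
  reversed coefficients.\<close>

lemma scaled_eval:
  assumes "p \<in> polys_over A" "Polynomial.degree p \<le> n" "z * y = (1::'a)"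
  shows "z ^ n * poly p y = (\<Sum>i\<le>n. Polynomial.coeff p i * z ^ (n - i))"
proof -
  have "z ^ n * y ^ i = z ^ (n - i)" if "i \<le> n" for i
  proof -
    have "z ^ n = z ^ (n - i) * z ^ i" using that by (simp flip: power_add)
    then show ?thesis using assms(3) by (simp add: mult.assoc flip: power_mult_distrib)
  qed
  then show ?thesis
    by (subst poly_as_sum_of_monoms'[OF assms(2), symmetric])
      (auto simp: poly_sum poly_monom sum_distrib_left algebra_simps intro!: sum.cong)
qed

text \<open>This makes \<open>R\<close> local with maximal ideal \<open>J\<close>. Otherwise the
  inverse of 1 - j satisfies a relation over \<open>J\<close>; clearing denominators puts a power of
  1 - j into \<open>J\<close>, but such a power is also congruent to 1 modulo
  \<open>J\<close>.\<close>

lemma one_minus_unit: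
  assumes "j \<in> J"
  shows "1 - j \<noteq> 0" "inverse (1 - j) \<in> R"
proof -
  show nz: "1 - j \<noteq> 0" using assms proper by auto
  show "inverse (1 - j) \<in> R"
  proof (rule ccontr)
    assume "inverse (1 - j) \<notin> R"
    then obtain p where p: "p \<in> polys_over J" "poly p (inverse (1 - j)) = 1" by (rule not_in_R)
    define n where "n = Polynomial.degree p"
    have z: "1 - j \<in> R" using assms J_sub R_1 R_diff by auto
    have "(1 - j) ^ n = (\<Sum>i\<le>n. Polynomial.coeff p i * (1 - j) ^ (n - i))"
      using scaled_eval[OF p(1), of n "1 - j" "inverse (1 - j)"] nz p(2) by (simp add: n_def)
    also have "\<dots> \<in> J"
      using p(1) z by (auto simp: polys_over_def intro!: diff_closed_sum J_0 J_diff J_mult' R_power)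
    finally have *: "(1 - j) ^ n \<in> J" .
    have "1 - (1 - j) ^ n \<in> J" for n
    proof (induction n)
      case (Suc n)
      have "1 - (1 - j) ^ Suc n = (1 - (1 - j) ^ n) + j * (1 - j) ^ n" by (simp add: algebra_simps)
      also have "\<dots> \<in> J" using Suc assms z by (intro J_add J_mult' R_power) auto
      finally show ?case .
    qed (simp add: J_0)
    from J_add[OF this[of n] *] show False using proper by simp
  qed
qed

text \<open>Descent on the degrees of the two relations. As 1 minus the constant coefficient of
  \<open>q\<close> is a unit of \<open>R\<close>, the relation for 1/x turns into x^m = r(x) with
  deg r < m and coefficients in \<open>J\<close>. This rewrites the leading term of \<open>p\<close>
  and lowers its degree.\<close>

lemma no_two_relations:
  assumes "p \<in> polys_over J" "q \<in> polys_over J" "poly p x = 1" "poly q (inverse x) = 1" "x \<noteq> 0"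
  shows False
  using assms
proof (induction "Polynomial.degree p + Polynomial.degree q" arbitrary: p q x rule: less_induct)
  case less
  \<comment> \<open>The reduction for the case that \<open>q\<close> has the smaller degree. It
    takes the induction hypothesis as a premise, so that it also applies with the roles of x and its
    inverse exchanged.\<close>
  have *: False
    if pq: "p \<in> polys_over J" "q \<in> polys_over J" "poly p x = 1" "poly q (inverse x) = 1" "x \<noteq> 0"
      and le: "Polynomial.degree q \<le> Polynomial.degree p"
      and IH: "\<And>p'. p' \<in> polys_over J \<Longrightarrow> poly p' x = 1 \<Longrightarrow> Polynomial.degree p' < Polynomial.degree p \<Longrightarrow> False"
    for p q x
  proof -
    define n m where "n = Polynomial.degree p" "m = Polynomial.degree q"
    define u where "u = inverse (1 - Polynomial.coeff q 0)"
    have cJ: "Polynomial.coeff p i \<in> J" "Polynomial.coeff q i \<in> J" for i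
      using pq by (auto simp: polys_over_def)
    have u: "u \<in> R" "u * (1 - Polynomial.coeff q 0) = 1"
      using one_minus_unit[OF cJ(2)[of 0]] by (auto simp: u_def)
    obtain q' where q': "q = pCons (Polynomial.coeff q 0) q'" by (metis coeff_pCons_0 pCons_cases)
    have n: "n > 0"
    proof (rule ccontr)
      assume "\<not> n > 0"
      then obtain a where "p = [:a:]" by (auto simp: n_m_def elim: degree_eq_zeroE)
      then show False using pq(3) cJ(1)[of 0] proper by simp
    qed
    have q'0: "q' \<noteq> 0"
    proof
      assume "q' = 0"
      with q' have "q = [:Polynomial.coeff q 0:]" by simp
      then have "poly q (inverse x) = Polynomial.coeff q 0" by (metis poly_const_conv)
      then show False using pq(4) cJ(2)[of 0] proper by simp
    qed
    define d where "d = Polynomial.degree q'"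
    have d: "m = Suc d" using q'0 by (subst n_m_def, subst q') (simp add: d_def)
    define r where "r = (\<Sum>i\<le>d. Polynomial.monom (u * Polynomial.coeff q (Suc i)) (d - i))"
    have qc: "Polynomial.coeff q' i = Polynomial.coeff q (Suc i)" for i by (subst q') simp
    \<comment> \<open>\<open>r\<close> has degree less than \<open>m\<close> and \<open>x ^ m = r(x)\<close>.\<close>
    have "u * (x ^ m * (1 - Polynomial.coeff q 0)) = u * (x ^ d * poly q' (inverse x))"
    proof -
      have "poly q (inverse x) = Polynomial.coeff q 0 + inverse x * poly q' (inverse x)"
        by (subst q') simp
      then have "1 - Polynomial.coeff q 0 = inverse x * poly q' (inverse x)" using pq(4) by (metis add_diff_cancel_left')
      then show ?thesis using d pq(5) by simp
    qed
    also have "x ^ d * poly q' (inverse x) = (\<Sum>i\<le>d. Polynomial.coeff q (Suc i) * x ^ (d - i))"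
      using scaled_eval[of q' UNIV d x "inverse x"] pq(5) by (simp add: polys_over_def d_def qc)
    also have "u * \<dots> = poly r x"
      by (simp add: r_def poly_sum poly_monom sum_distrib_left mult.assoc)
    finally have "u * (x ^ m * (1 - Polynomial.coeff q 0)) = poly r x" .
    then have xm: "x ^ m = poly r x" using u(2) by (metis mult.left_commute mult_1_right)
    \<comment> \<open>The leading term a x^n is split as a x^(n - m) x^m and x^m is replaced by
      r(x); the value at x stays 1.\<close>
    define p' where "p' = p - Polynomial.monom (Polynomial.lead_coeff p) n
                          + Polynomial.monom (Polynomial.lead_coeff p) (n - m) * r"
    have "poly p' x = poly p x - Polynomial.lead_coeff p * x ^ n + Polynomial.lead_coeff p * (x ^ (n - m) * x ^ m)"
      by (simp add: p'_def poly_monom xm)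
    also have "x ^ (n - m) * x ^ m = x ^ n" using le by (simp add: n_m_def flip: power_add)
    finally have 1: "poly p' x = 1" using pq(3) by simp
    have rJ: "Polynomial.coeff r i \<in> J" for i
      by (auto simp: r_def coeff_sum intro!: diff_closed_sum J_0 J_diff J_mult u cJ)
    have 2: "p' \<in> polys_over J"
      unfolding polys_over_def p'_def
      using cJ rJ J_sub by (auto simp: coeff_monom_mult intro!: J_add J_diff J_0 J_mult)
    have "Polynomial.degree r \<le> d"
      unfolding r_def by (intro degree_sum_le) (auto intro: order_trans[OF degree_monom_le])
    have "Polynomial.coeff p' i = 0" if "i \<ge> n" for i
    proof -
      have "Polynomial.coeff p i - Polynomial.coeff (Polynomial.monom (Polynomial.lead_coeff p) n) i = 0"
        using that by (cases "i = n") (auto simp: n_m_def coeff_eq_0)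
      moreover have "Polynomial.coeff r (i - (n - m)) = 0"
        using that n d le \<open>Polynomial.degree r \<le> d\<close> n_m_def by (intro coeff_eq_0) linarith
      ultimately show ?thesis by (simp add: p'_def coeff_monom_mult)
    qed
    then have 3: "Polynomial.degree p' < n"
      using n by (metis degree_0 leading_coeff_0_iff not_less)
    show False using IH[OF 2 1] 3 by (simp add: n_m_def)
  qed
  show False
  proof (cases "Polynomial.degree q \<le> Polynomial.degree p")
    case True
    show False
      by (rule *[OF less.prems True]) (rule less.hyps[OF _ _ less.prems(2) _ less.prems(4,5)], auto)
  next
    case False
    have eq: "poly p (inverse (inverse x)) = 1" "inverse x \<noteq> 0" using less.prems by auto
    show False
      by (rule *[OF less.prems(2,1,4) eq])
        (use False in auto, rule less.hyps[OF _ less.prems(1) _ less.prems(3) _ less.prems(5)], auto)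
  qed
qed

lemma R_or_inverse: "x \<in> R \<or> inverse x \<in> R"
proof (rule ccontr)
  assume a: "\<not> ?thesis"
  then have "x \<noteq> 0" using R_0 by auto
  obtain p q where "p \<in> polys_over J" "poly p x = 1" "q \<in> polys_over J" "poly q (inverse x) = 1"
    using a not_in_R by metis
  with \<open>x \<noteq> 0\<close> show False using no_two_relations by blast
qed

end

theorem valuation_domain_dominating:
  fixes A I :: "'a::field set"
  assumes "subring_ideal A I" "1 \<notin> I"
  obtains U J where "valuation_domain U" "subring_ideal U J" "A \<subseteq> U" "I \<subseteq> J" "1 \<notin> J"
proof -
  \<comment> \<open>A pair is coded as one set of tagged elements, so that componentwise inclusion
    becomes set inclusion and the union of a chain is formed componentwise, as Zorn's lemma for sets
    requires.\<close>
  define enc :: "'a set \<Rightarrow> 'a set \<Rightarrow> ('a \<times> bool) set" where "enc R J = R \<times> {True} \<union> J \<times> {False}" for R J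
  define dec where "dec b Z = {x. (x, b) \<in> Z}" for b and Z :: "('a \<times> bool) set"
  have dec_enc [simp]: "dec True (enc R J) = R" "dec False (enc R J) = J" for R J
    by (auto simp: dec_def enc_def)
  have dec_Un: "dec b (\<Union>C) = \<Union>(dec b ` C)" for b C by (auto simp: dec_def)
  define good where "good Z \<longleftrightarrow> subring_ideal (dec True Z) (dec False Z) \<and> 1 \<notin> dec False Z \<and>
      A \<subseteq> dec True Z \<and> I \<subseteq> dec False Z" for Z
  have "\<exists>M\<in>Collect good. \<forall>Y\<in>Collect good. M \<subseteq> Y \<longrightarrow> Y = M"
  proof (rule subset_Zorn_nonempty)
    have "good (enc A I)" using assms by (auto simp: good_def)
    then show "Collect good \<noteq> {}" by auto
  next
    fix C assume C: "C \<noteq> {}" "subset.chain (Collect good) C"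
    have g: "good Z" if "Z \<in> C" for Z using that C by (auto simp: subset.chain_def)
    obtain Z0 where Z0: "Z0 \<in> C" using C by auto
    \<comment> \<open>Two elements of the union lie in a common member of the chain, so each closure
      property of the union is inherited from a single member.\<close>
    have two: "\<exists>Z\<in>C. x \<in> dec a Z \<and> y \<in> dec b Z"
      if xy: "x \<in> dec a (\<Union>C)" "y \<in> dec b (\<Union>C)" for x y a b
    proof -
      obtain S T where "S \<in> C" "x \<in> dec a S" "T \<in> C" "y \<in> dec b T" using xy unfolding dec_Un by blast
      moreover have "S \<subseteq> T \<or> T \<subseteq> S" using C calculation by (auto simp: subset.chain_def)
      ultimately show ?thesis by (auto simp: dec_def)
    qed
    have up: "x \<in> dec a (\<Union>C)" if "Z \<in> C" "x \<in> dec a Z" for x a Z using that by (auto simp: dec_Un)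
    note s = g[unfolded good_def subring_ideal_def]
    have "good (\<Union>C)"
      unfolding good_def subring_ideal_def
    proof (intro conjI ballI subsetI)
      show "1 \<notin> dec False (\<Union>C)" using s by (auto simp: dec_Un)
    next
      fix x y assume "x \<in> dec True (\<Union>C)" "y \<in> dec True (\<Union>C)"
      then obtain Z where "Z \<in> C" "x \<in> dec True Z" "y \<in> dec True Z" using two by meson
      then show "x - y \<in> dec True (\<Union>C)" "x * y \<in> dec True (\<Union>C)" using s[of Z] up by auto
    next
      fix x y assume "x \<in> dec False (\<Union>C)" "y \<in> dec False (\<Union>C)"
      then obtain Z where "Z \<in> C" "x \<in> dec False Z" "y \<in> dec False Z" using two by meson
      then show "x - y \<in> dec False (\<Union>C)" using s[of Z] up by auto
    next
      fix x y assume "x \<in> dec True (\<Union>C)" "y \<in> dec False (\<Union>C)"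
      then obtain Z where "Z \<in> C" "x \<in> dec True Z" "y \<in> dec False Z" using two by meson
      then show "x * y \<in> dec False (\<Union>C)" using s[of Z] up by auto
    next
      fix x assume "x \<in> dec False (\<Union>C)"
      then obtain Z where "Z \<in> C" "x \<in> dec False Z" using two by meson
      then show "x \<in> dec True (\<Union>C)" using s[of Z] up by auto
    qed (use s[OF Z0] up[OF Z0] in blast)+
    then show "\<Union>C \<in> Collect good" by simp
  qed
  then obtain Z where Z: "good Z" "\<And>Y. good Y \<Longrightarrow> Z \<subseteq> Y \<Longrightarrow> Y = Z" by auto
  interpret maximal_pair "dec True Z" "dec False Z"
  proof
    fix R' J' assume "subring_ideal R' J'" "1 \<notin> J'" and sub: "dec True Z \<subseteq> R'" "dec False Z \<subseteq> J'"
    then have "good (enc R' J')" using Z(1) unfolding good_def by auto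
    moreover have "Z \<subseteq> enc R' J'"
    proof
      fix z assume "z \<in> Z"
      then show "z \<in> enc R' J'" using sub by (cases z; cases "snd z") (auto simp: dec_def enc_def)
    qed
    ultimately have "enc R' J' = Z" by (rule Z(2))
    then show "R' = dec True Z" by (metis dec_enc(1))
  qed (use Z(1) in \<open>auto simp: good_def\<close>)
  have "valuation_domain (dec True Z)"
    unfolding valuation_domain_def using R_1 R_diff R_mult R_or_inverse by blast
  then show thesis using that Z(1) unfolding good_def by blast
qed

text \<open>Tracking the ideal along with the ring is what gives U \<inter> K = V: if a is in
  \<open>U\<close> but not in V, then the inverse of a lies in the maximal ideal of V, hence in
  \<open>J\<close>, and so would 1.\<close>

lemma (in valued_field) exists_extends_to_closure: "\<exists>U. extends_to_closure v U"
proof -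
  define A where "A = to_ac ` val_ring v"
  define I where "I = to_ac ` max_ideal v"
  have "subring_ideal A I"
    unfolding subring_ideal_def
  proof (intro conjI ballI)
    show "1 \<in> A" unfolding A_def by (rule image_eqI[of _ _ 1]) (auto simp: val_ring_def)
    show "0 \<in> I" unfolding I_def by (rule image_eqI[of _ _ 0]) (auto simp: max_ideal_def zero_vext_def)
    show "I \<subseteq> A" by (auto simp: I_def A_def max_ideal_def val_ring_def)
  next
    fix x y assume "x \<in> A" "y \<in> A"
    then obtain a b where "0 \<le> v a" "0 \<le> v b" "x = to_ac a" "y = to_ac b" by (auto simp: A_def val_ring_def)
    moreover from this have "0 \<le> v (a - b)" "0 \<le> v (a * b)" by (auto intro: v_diff_ge add_nonneg_nonneg)
    ultimately show "x - y \<in> A" "x * y \<in> A"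
      by (auto simp: A_def val_ring_def simp flip: to_ac_diff to_ac_mult)
  next
    fix x y assume "x \<in> I" "y \<in> I"
    then obtain a b where "0 < v a" "0 < v b" "x = to_ac a" "y = to_ac b" by (auto simp: I_def max_ideal_def)
    moreover from this have "0 < v (a - b)" by (auto intro: v_diff_gt)
    ultimately show "x - y \<in> I" by (auto simp: I_def max_ideal_def simp flip: to_ac_diff)
  next
    fix x y assume "x \<in> A" "y \<in> I"
    then obtain a b where "0 \<le> v a" "0 < v b" "x = to_ac a" "y = to_ac b"
      by (auto simp: A_def I_def val_ring_def max_ideal_def)
    moreover from this have "0 < v (a * b)" by (auto intro: add_nonneg_pos)
    ultimately show "x * y \<in> I" by (auto simp: I_def max_ideal_def simp flip: to_ac_mult)
  qed
  moreover have "1 \<notin> I" by (auto simp: I_def max_ideal_def)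
  ultimately obtain U J where U: "valuation_domain U" "subring_ideal U J" "A \<subseteq> U" "I \<subseteq> J" "1 \<notin> J"
    by (rule valuation_domain_dominating)
  have "a \<in> val_ring v" if "to_ac a \<in> U" for a
  proof (rule ccontr)
    assume "a \<notin> val_ring v"
    then have "v a < 0" "a \<noteq> 0" by (auto simp: val_ring_def)
    then have "0 < v (inverse a)" using v_divide_iff(2)[of a 1] by (simp add: inverse_eq_divide)
    then have "to_ac (inverse a) \<in> J" using U(4) by (auto simp: I_def max_ideal_def)
    then have "to_ac a * to_ac (inverse a) \<in> J" using that U(2) unfolding subring_ideal_def by blast
    then show False using U(5) \<open>a \<noteq> 0\<close> by simp
  qed
  then have "extends_to_closure v U"
    using U(1,3) by (auto simp: extends_to_closure_def A_def)
  then show ?thesis by blast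
qed

section \<open>Roots of polynomials as pseudo-limits\<close>

lemma poly_map_to_ac: "poly (map_poly to_ac f) (to_ac x) = to_ac (poly f x)"
  by (induction f) (auto simp: map_poly_pCons)

lemma map_poly_to_ac_mult: "map_poly to_ac (f * g) = map_poly to_ac f * map_poly to_ac g"
  by (rule poly_eqI) (auto simp: coeff_map_poly coeff_mult to_ac_sum)

section \<open>Calculus in a valuation domain of the algebraic closure lying over V\<close>

locale closure_extension = valued_field v
  for v :: "'a::field \<Rightarrow> 'g::linordered_ab_group_add vext" +
  fixes U :: "'a alg_closure set"
  assumes extends: "extends_to_closure v U"
begin

lemma U_1: "1 \<in> U" and U_diff: "x \<in> U \<Longrightarrow> y \<in> U \<Longrightarrow> x - y \<in> U"
  and U_mult: "x \<in> U \<Longrightarrow> y \<in> U \<Longrightarrow> x * y \<in> U" and U_inverse: "x \<in> U \<or> inverse x \<in> U"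
  using extends by (auto simp: extends_to_closure_def valuation_domain_def)

lemma U_0: "0 \<in> U"
  using U_diff[OF U_1 U_1] by simp

lemma U_add: "x \<in> U \<Longrightarrow> y \<in> U \<Longrightarrow> x + y \<in> U"
  using U_diff[of x "0 - y"] U_diff[OF U_0] by simp

lemma to_ac_in_U: "to_ac a \<in> U \<longleftrightarrow> 0 \<le> v a"
  using extends by (auto simp: extends_to_closure_def val_ring_def)

text \<open>The maximal ideal of \<open>U\<close>, described through inverses; membership replaces
  the statement that a value is positive.\<close>

definition M where "M = {x. x = 0 \<or> inverse x \<notin> U}"

lemma M_U: "x \<in> M \<Longrightarrow> x \<in> U"
  using U_inverse U_0 by (auto simp: M_def)

lemma M_mult: "x \<in> M \<Longrightarrow> y \<in> U \<Longrightarrow> x * y \<in> M"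
proof (rule ccontr)
  assume a: "x \<in> M" "y \<in> U" "x * y \<notin> M"
  then have nz: "x \<noteq> 0" "y \<noteq> 0" "inverse (x * y) \<in> U" by (auto simp: M_def)
  then have "y * inverse (x * y) \<in> U" using U_mult a by blast
  then show False using a nz by (simp add: M_def field_simps)
qed

lemma M_add:
  assumes "x \<in> M" "y \<in> M"
  shows "x + y \<in> M"
proof (cases "x = 0 \<or> y = 0")
  case False
  have *: "x + y \<in> M" if "x / y \<in> U" "x \<in> M" "y \<in> M" "y \<noteq> 0" for x y
    using M_mult[OF that(3) U_add[OF that(1) U_1]] that by (simp add: field_simps)
  have "x / y \<in> U \<or> y / x \<in> U" using U_inverse[of "x / y"] by simp
  then show ?thesis using *[of x y] *[of y x] False assms by (auto simp: add.commute)
qed (use assms in auto)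

lemma to_ac_in_M: "to_ac a \<in> M \<longleftrightarrow> 0 < v a"
proof (cases "a = 0")
  case False
  have "inverse (to_ac a) \<in> U \<longleftrightarrow> 0 \<le> v (1 / a)"
    using to_ac_in_U[of "1 / a"] by (simp add: inverse_eq_divide)
  then show ?thesis using False v_divide_iff(1)[of a 1] by (auto simp: M_def)
qed (auto simp: M_def)

lemma one_M: "1 \<notin> M"
  by (auto simp: M_def U_1)

lemma inverse_one_minus: "m \<in> M \<Longrightarrow> 1 - m \<noteq> 0 \<and> inverse (1 - m) \<in> U"
  using M_add[of "1 - m" m] one_M by (auto simp: M_def)

lemma canonical_val_eqD:
  assumes "canonical_val U x = canonical_val U y"
  obtains e where "e \<noteq> 0" "e \<in> U" "inverse e \<in> U" "x = y * e"
proof -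
  have "x \<in> canonical_val U x" using U_1 unfolding canonical_val_def by (intro CollectI exI[of _ 1]) simp
  then have "x \<in> canonical_val U y" using assms by simp
  then show thesis using that unfolding canonical_val_def by blast
qed

lemma canonical_val_eqI:
  assumes "e \<noteq> 0" "e \<in> U" "inverse e \<in> U"
  shows "canonical_val U (y * e) = canonical_val U y"
proof -
  have sub: "canonical_val U (y * e) \<subseteq> canonical_val U y" if "e \<noteq> 0" "e \<in> U" "inverse e \<in> U" for y e
  proof
    fix z assume "z \<in> canonical_val U (y * e)"
    then obtain e' where "e' \<noteq> 0" "e' \<in> U" "inverse e' \<in> U" "z = y * (e * e')"
      unfolding canonical_val_def by (auto simp: mult.assoc)
    moreover from this that have "e * e' \<in> U" "inverse (e * e') \<in> U"
      using U_mult[of "inverse e'" "inverse e"] by (auto simp: U_mult simp del: inverse_eq_divide)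
    ultimately show "z \<in> canonical_val U y"
      using that unfolding canonical_val_def by auto
  qed
  from sub[OF assms, of y] sub[of "inverse e" "y * e"] assms show ?thesis
    by (auto simp: mult.assoc)
qed

lemma canonical_val_to_ac: "canonical_val U (to_ac x) = canonical_val U (to_ac y) \<longleftrightarrow> v x = v y"
proof
  assume "canonical_val U (to_ac x) = canonical_val U (to_ac y)"
  then obtain e where e: "e \<noteq> 0" "e \<in> U" "inverse e \<in> U" "to_ac x = to_ac y * e" by (rule canonical_val_eqD)
  show "v x = v y"
  proof (cases "y = 0")
    case False
    then have "to_ac (x / y) = e" "x \<noteq> 0" "to_ac (y / x) = inverse e" using e by (auto simp: field_simps)
    then have "0 \<le> v (x / y)" "0 \<le> v (y / x)" using e to_ac_in_U by metis+
    then show ?thesis using v_divide_iff(1) False \<open>x \<noteq> 0\<close> by (metis order_antisym)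
  qed (use e in auto)
next
  assume eq: "v x = v y"
  show "canonical_val U (to_ac x) = canonical_val U (to_ac y)"
  proof (cases "y = 0")
    case False
    then have "x \<noteq> 0" using eq v_Infty by metis
    have "0 \<le> v (x / y)" "0 \<le> v (y / x)" using v_divide_iff(1) False \<open>x \<noteq> 0\<close> eq by auto
    then have "to_ac (x / y) \<in> U" "to_ac (y / x) \<in> U" by (simp_all only: to_ac_in_U)
    then have "to_ac (x / y) \<in> U" "inverse (to_ac (x / y)) \<in> U" by simp_all
    from canonical_val_eqI[OF _ this, of "to_ac y"] show ?thesis using False \<open>x \<noteq> 0\<close> by simp
  qed (use eq in auto)
qed

lemma closure_pseudo_limit_to_ac:
  "closure_pseudo_limit v U s (to_ac \<beta>) \<longleftrightarrow> \<beta> \<in> pseudo_limits v s"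
proof -
  have "(\<exists>d. v d = gauge v s \<nu> \<and> canonical_val U (to_ac \<beta> - to_ac (s \<nu>)) = canonical_val U (to_ac d)) \<longleftrightarrow>
      v (\<beta> - s \<nu>) = gauge v s \<nu>" for \<nu>
    unfolding to_ac_diff[symmetric] canonical_val_to_ac by auto
  then show ?thesis by (simp add: closure_pseudo_limit_def pseudo_limits_def)
qed

lemma prod_mset_in_U: "(\<And>a. a \<in># A \<Longrightarrow> f a \<in> U) \<Longrightarrow> (\<Prod>a\<in>#A. f a) \<in> U"
  by (induction A) (auto intro: U_1 U_mult)

lemma prod_mset_one_plus_M:
  "(\<And>a. a \<in># A \<Longrightarrow> f a - 1 \<in> M) \<Longrightarrow> (\<Prod>a\<in>#A. f a) - 1 \<in> M"
proof (induction A)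
  case (add a A)
  have "f a \<in> U" using U_add[OF M_U U_1, of "f a - 1"] add by auto
  then have "((\<Prod>a\<in>#A. f a) - 1) * f a + (f a - 1) \<in> M" using add by (intro M_add M_mult) auto
  then show ?case by (simp add: algebra_simps)
qed (simp add: M_def)

text \<open>\<open>A\<close> is the multiset of roots. In a quotient of two values the leading
  coefficient cancels, so knowledge of the ratios of linear factors in the closure transfers to an
  element of K.\<close>

lemma poly_ratio:
  fixes f :: "'a poly"
  assumes "f \<noteq> 0"
  obtains A where "\<And>\<alpha>. \<alpha> \<in># A \<longleftrightarrow> poly (map_poly to_ac f) \<alpha> = 0"
    "\<And>x y. poly f y \<noteq> 0 \<Longrightarrow> to_ac (poly f x / poly f y) = (\<Prod>\<alpha>\<in>#A. (to_ac x - \<alpha>) / (to_ac y - \<alpha>))"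
    "\<And>y. poly f y \<noteq> 0 \<longleftrightarrow> to_ac y \<notin># A"
proof -
  let ?f = "map_poly to_ac f"
  have nz: "?f \<noteq> 0" using assms by (metis coeff_map_poly leading_coeff_0_iff to_ac_0 to_ac_eq_0_iff coeff_0)
  obtain A where A: "?f = Polynomial.smult (Polynomial.lead_coeff ?f) (\<Prod>x\<in>#A. [:-x, 1:])"
    using alg_closed_imp_factorization[OF nz] by blast
  define c where "c = Polynomial.lead_coeff ?f"
  have "c \<noteq> 0" using nz by (simp add: c_def)
  have ev: "poly ?f y = c * (\<Prod>\<alpha>\<in>#A. y - \<alpha>)" for y
    by (subst A) (auto simp: poly_prod_mset c_def image_mset.compositionality o_def intro!: arg_cong[where f = prod_mset] image_mset_cong)
  have root: "poly ?f y = 0 \<longleftrightarrow> y \<in># A" for y using \<open>c \<noteq> 0\<close> by (auto simp: ev prod_mset_zero_iff)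
  have quot: "(\<Prod>\<alpha>\<in>#B. g \<alpha>) / (\<Prod>\<alpha>\<in>#B. h \<alpha>) = (\<Prod>\<alpha>\<in>#B. g \<alpha> / h \<alpha>)" for B and g h :: "'a alg_closure \<Rightarrow> 'a alg_closure"
    by (induction B) (auto simp only: image_mset_add_mset prod_mset.add_mset times_divide_times_eq[symmetric]
      image_mset_empty prod_mset_empty div_by_1)
  show thesis
  proof (rule that)
    fix x y assume "poly f y \<noteq> 0"
    show "to_ac (poly f x / poly f y) = (\<Prod>\<alpha>\<in>#A. (to_ac x - \<alpha>) / (to_ac y - \<alpha>))"
      using \<open>c \<noteq> 0\<close> by (simp add: ev flip: poly_map_to_ac)
        (simp add: quot[where B = A and g = "\<lambda>\<alpha>. to_ac x - \<alpha>" and h = "\<lambda>\<alpha>. to_ac y - \<alpha>"])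
  qed (simp_all add: root[symmetric] poly_map_to_ac)
qed

end

section \<open>Pseudo-convergent sequences\<close>

context valued_field
begin

lemma pseudo_convergent_finite:
  assumes "pseudo_convergent v s" "\<nu> < \<rho>"
  shows "v (s \<rho> - s \<nu>) \<noteq> Infty" "s \<rho> \<noteq> s \<nu>"
proof -
  obtain \<sigma> where "\<rho> < \<sigma>" using gt_ex by blast
  then have "v (s \<rho> - s \<nu>) < v (s \<sigma> - s \<rho>)" using assms by (auto simp: pseudo_convergent_def)
  then show "v (s \<rho> - s \<nu>) \<noteq> Infty" by auto
  then show "s \<rho> \<noteq> s \<nu>" by auto
qed

lemma pseudo_convergent_const:
  assumes "pseudo_convergent v s" "\<nu> < \<rho>" "\<nu> < \<rho>'"
  shows "v (s \<rho>' - s \<nu>) = v (s \<rho> - s \<nu>)"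
proof -
  have *: "v (s \<rho>' - s \<nu>) = v (s \<rho> - s \<nu>)" if "\<nu> < \<rho>" "\<rho> < \<rho>'" for \<rho> \<rho>'
  proof -
    have "v (s \<rho> - s \<nu>) < v (s \<rho>' - s \<rho>)" using assms that by (auto simp: pseudo_convergent_def)
    from v_add_eq(2)[OF this] show ?thesis by simp
  qed
  show ?thesis using *[of \<rho> \<rho>'] *[of \<rho>' \<rho>] assms by (metis linorder_neqE)
qed

lemma gauge_convergent:
  assumes "pseudo_convergent v s" "\<nu> < \<rho>"
  shows "gauge v s \<nu> = v (s \<rho> - s \<nu>)"
proof -
  have "\<nu> < (SOME \<rho>. \<nu> < \<rho>)" using assms by (metis someI)
  then show ?thesis using assms pseudo_convergent_const by (auto simp: gauge_def)
qed

end

context closure_extension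
begin

text \<open>Beyond one index at which the value of \<open>\<alpha> - s \<nu>\<close> is not the gauge, the values of \<open>\<alpha> - s \<nu>\<close>
  stay below the gauge.\<close>

lemma nonlimit_ratio:
  assumes "pseudo_convergent v s" "\<not> closure_pseudo_limit v U s \<alpha>"
  shows "\<forall>\<^sub>F \<mu> in at_top. to_ac (s \<mu>) \<noteq> \<alpha> \<and>
    (\<forall>\<nu>>\<mu>. (to_ac (s \<nu>) - \<alpha>) / (to_ac (s \<mu>) - \<alpha>) - 1 \<in> M)"
proof -
  let ?P = "\<lambda>\<nu>. \<exists>d. v d = gauge v s \<nu> \<and> canonical_val U (\<alpha> - to_ac (s \<nu>)) = canonical_val U (to_ac d)"
  have "\<not> (\<forall>\<nu>. ?P \<nu>)"
    using assms(2) unfolding closure_pseudo_limit_def by (rule contrapos_nn) (rule always_eventually)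
  then obtain \<kappa> where "\<not> ?P \<kappa>" by (simp only: not_all) (elim exE, rule that)
  then have \<kappa>: "canonical_val U (\<alpha> - to_ac (s \<kappa>)) \<noteq> canonical_val U (to_ac d)" if "v d = gauge v s \<kappa>" for d
    using that by blast
  define a where "a = \<alpha> - to_ac (s \<kappa>)"
  show ?thesis
  proof (rule eventually_mono[OF eventually_gt_at_top[of \<kappa>]])
    fix \<mu> assume \<mu>: "\<kappa> < \<mu>"
    define b where "b = to_ac (s \<mu> - s \<kappa>)"
    have b: "b \<noteq> 0" using pseudo_convergent_finite[OF assms(1) \<mu>] by (simp add: b_def)
    have eqs: "to_ac (s \<mu>) - \<alpha> = b - a" by (simp add: a_def b_def)
    \<comment> \<open>The value of b is the gauge at \<kappa>; if a/b were a unit, then a = \<alpha>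
      - s \<kappa> would have the gauge as its value as well, against the choice of
      \<kappa>.\<close>
    have nunit: "a / b = 0 \<or> a / b \<notin> U \<or> inverse (a / b) \<notin> U"
    proof (rule ccontr)
      assume "\<not> ?thesis"
      then have "canonical_val U (b * (a / b)) = canonical_val U b" by (intro canonical_val_eqI) auto
      then show False using \<kappa>[of "s \<mu> - s \<kappa>"] gauge_convergent[OF assms(1) \<mu>] b by (simp add: a_def b_def)
    qed
    \<comment> \<open>Since a and b have different values, the value of b - a is the smaller of the
      two, hence at most that of b.\<close>
    have "b \<noteq> a \<and> b / (b - a) \<in> U"
    proof (cases "a / b \<in> U")
      case True
      then have "a / b \<in> M" using nunit by (auto simp: M_def)
      moreover have "1 - a / b = (b - a) / b" using b by (simp add: diff_divide_distrib)
      ultimately show ?thesis using inverse_one_minus[of "a / b"] by auto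
    next
      case False
      then have m: "b / a \<in> M" by (auto simp: M_def)
      have "a \<noteq> 0" using False U_0 by auto
      have "0 - (b / a) * inverse (1 - b / a) \<in> U"
        using M_U[OF m] inverse_one_minus[OF m] by (intro U_diff U_0 U_mult) auto
      moreover have "b \<noteq> a" using inverse_one_minus[OF m] b by auto
      moreover have "0 - (b / a) * inverse (1 - b / a) = b / (b - a)"
      proof -
        have "1 - b / a = (a - b) / a" using \<open>a \<noteq> 0\<close> by (simp add: diff_divide_distrib)
        then have "0 - (b / a) * inverse (1 - b / a) = - (b / (a - b))" using \<open>a \<noteq> 0\<close> by simp
        then show ?thesis by (metis minus_diff_eq minus_divide_right)
      qed
      ultimately show ?thesis by metis
    qed
    \<comment> \<open>The difference is (s \<nu> - s \<mu>) / (b - a). Factoring it through b leaves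
      the quotient (s \<nu> - s \<mu>) / (s \<mu> - s \<kappa>), which is in the maximal ideal by
      pseudo-convergence, times b / (b - a) in \<open>U\<close>.\<close>
    moreover have "(to_ac (s \<nu>) - \<alpha>) / (b - a) - 1 \<in> M" if \<nu>: "\<mu> < \<nu>" and ba: "b \<noteq> a" "b / (b - a) \<in> U" for \<nu>
    proof -
      have "v (s \<mu> - s \<kappa>) < v (s \<nu> - s \<mu>)" using assms(1) \<mu> \<nu> by (auto simp: pseudo_convergent_def)
      then have "to_ac ((s \<nu> - s \<mu>) / (s \<mu> - s \<kappa>)) \<in> M"
        using b by (subst to_ac_in_M, subst v_divide_iff) (auto simp: b_def)
      then have "to_ac ((s \<nu> - s \<mu>) / (s \<mu> - s \<kappa>)) * (b / (b - a)) \<in> M" using M_mult ba(2) by blast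
      also have "to_ac ((s \<nu> - s \<mu>) / (s \<mu> - s \<kappa>)) * (b / (b - a)) = to_ac (s \<nu> - s \<mu>) / (b - a)"
        using b by (simp add: b_def)
      also have "to_ac (s \<nu> - s \<mu>) = (to_ac (s \<nu>) - \<alpha>) - (b - a)"
        by (simp add: a_def b_def)
      also have "\<dots> / (b - a) = (to_ac (s \<nu>) - \<alpha>) / (b - a) - 1"
        using ba(1) by (simp only: diff_divide_distrib[of _ "b - a"]) simp
      finally show ?thesis .
    qed
    ultimately show "to_ac (s \<mu>) \<noteq> \<alpha> \<and> (\<forall>\<nu>>\<mu>. (to_ac (s \<nu>) - \<alpha>) / (to_ac (s \<mu>) - \<alpha>) - 1 \<in> M)"
      using eqs by auto
  qed
qed

text \<open>Up to units of \<open>U\<close> the two differences are elements of K whose values are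
  the gauges at \<nu> and \<mu>, and the gauge is strictly increasing.\<close>

lemma limit_ratio:
  assumes "pseudo_convergent v s" "closure_pseudo_limit v U s \<alpha>"
  shows "\<forall>\<^sub>F \<mu> in at_top. to_ac (s \<mu>) \<noteq> \<alpha> \<and>
    (\<forall>\<nu>>\<mu>. (to_ac (s \<nu>) - \<alpha>) / (to_ac (s \<mu>) - \<alpha>) \<in> M)"
proof -
  let ?P = "\<lambda>\<nu>. \<exists>d. v d = gauge v s \<nu> \<and> canonical_val U (\<alpha> - to_ac (s \<nu>)) = canonical_val U (to_ac d)"
  obtain N where N: "\<And>\<nu>. N \<le> \<nu> \<Longrightarrow> ?P \<nu>"
    using assms(2) unfolding closure_pseudo_limit_def eventually_at_top_linorder by blast
  have ex: "\<exists>d e. v d = gauge v s \<nu> \<and> e \<noteq> 0 \<and> e \<in> U \<and> inverse e \<in> U \<and> \<alpha> - to_ac (s \<nu>) = to_ac d * e"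
    if le: "N \<le> \<nu>" for \<nu>
  proof -
    obtain d where d: "v d = gauge v s \<nu>" "canonical_val U (\<alpha> - to_ac (s \<nu>)) = canonical_val U (to_ac d)"
      using N[OF le] by blast
    from canonical_val_eqD[OF d(2)] d(1) show ?thesis by metis
  qed
  show ?thesis
    unfolding eventually_at_top_linorder
  proof (intro exI[of _ N] allI impI conjI)
    fix \<mu> assume \<mu>: "N \<le> \<mu>"
    obtain d e where d: "v d = gauge v s \<mu>" "e \<noteq> 0" "e \<in> U" "inverse e \<in> U" "\<alpha> - to_ac (s \<mu>) = to_ac d * e"
      using ex[OF \<mu>] by blast
    obtain \<sigma> where "\<mu> < \<sigma>" using gt_ex by blast
    then have "v d \<noteq> Infty" using d(1) gauge_convergent[OF assms(1)] pseudo_convergent_finite[OF assms(1)] by metis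
    then have nz: "d \<noteq> 0" by simp
    then show "to_ac (s \<mu>) \<noteq> \<alpha>" using d by auto
    fix \<nu> assume \<nu>: "\<mu> < \<nu>"
    obtain d' e' where d': "v d' = gauge v s \<nu>" "e' \<noteq> 0" "e' \<in> U" "inverse e' \<in> U" "\<alpha> - to_ac (s \<nu>) = to_ac d' * e'"
      using ex[OF order_trans[OF \<mu> less_imp_le[OF \<nu>]]] by blast
    obtain \<tau> where \<tau>: "\<nu> < \<tau>" using gt_ex by blast
    have "v d < v d'"
      using gauge_convergent[OF assms(1) \<nu>] gauge_convergent[OF assms(1) \<tau>] d(1) d'(1) assms(1) \<nu> \<tau>
      by (auto simp: pseudo_convergent_def)
    then have "to_ac (d' / d) \<in> M" using nz by (subst to_ac_in_M, subst v_divide_iff) auto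
    then have "to_ac (d' / d) * (e' * inverse e) \<in> M" using d d' by (intro M_mult U_mult) auto
    also have "to_ac (d' / d) * (e' * inverse e) = (\<alpha> - to_ac (s \<nu>)) / (\<alpha> - to_ac (s \<mu>))"
      unfolding d d' by (simp add: divide_inverse)
    also have "\<dots> = (to_ac (s \<nu>) - \<alpha>) / (to_ac (s \<mu>) - \<alpha>)"
      using minus_divide_divide[of "\<alpha> - to_ac (s \<nu>)" "\<alpha> - to_ac (s \<mu>)"] by simp
    finally show "(to_ac (s \<nu>) - \<alpha>) / (to_ac (s \<mu>) - \<alpha>) \<in> M" .
  qed
qed

definition limit_root :: "('i::{wellorder,no_top} \<Rightarrow> 'a) \<Rightarrow> 'a poly \<Rightarrow> bool" where
  "limit_root s f \<longleftrightarrow> (\<exists>\<alpha>. poly (map_poly to_ac f) \<alpha> = 0 \<and> closure_pseudo_limit v U s \<alpha>)"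

text \<open>The roots are finitely many, so from one index on all factors of the quotient lie in 1 +
  M, and so does their product. Keeping \<mu> fixed while \<nu> varies provides f(s \<mu>) as the
  constant to which f will be asymptotic.\<close>

lemma no_limit_root_asymp:
  assumes "pseudo_convergent v s" "f \<noteq> 0" "\<not> limit_root s f"
  shows "\<forall>\<^sub>F \<mu> in at_top. \<forall>\<nu>>\<mu>. poly f (s \<nu>) \<approx> poly f (s \<mu>)"
proof -
  obtain A where A: "\<And>\<alpha>. \<alpha> \<in># A \<longleftrightarrow> poly (map_poly to_ac f) \<alpha> = 0"
    "\<And>x y. poly f y \<noteq> 0 \<Longrightarrow> to_ac (poly f x / poly f y) = (\<Prod>\<alpha>\<in>#A. (to_ac x - \<alpha>) / (to_ac y - \<alpha>))"
    "\<And>y. poly f y \<noteq> 0 \<longleftrightarrow> to_ac y \<notin># A"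
    by (rule poly_ratio[OF assms(2)]) (rule that; blast)
  have "\<forall>\<^sub>F \<mu> in at_top. \<forall>\<alpha>\<in>set_mset A. to_ac (s \<mu>) \<noteq> \<alpha> \<and>
      (\<forall>\<nu>>\<mu>. (to_ac (s \<nu>) - \<alpha>) / (to_ac (s \<mu>) - \<alpha>) - 1 \<in> M)"
    using assms(3) A(1) by (intro eventually_ball_finite ballI nonlimit_ratio[OF assms(1)]) (auto simp: limit_root_def)
  then show ?thesis
  proof eventually_elim
    case (elim \<mu>)
    then have nz: "poly f (s \<mu>) \<noteq> 0" using A(3) by auto
    show ?case
    proof (intro allI impI)
      fix \<nu> assume "\<mu> < \<nu>"
      then have "to_ac (poly f (s \<nu>) / poly f (s \<mu>)) - 1 \<in> M"
        unfolding A(2)[OF nz] using elim by (intro prod_mset_one_plus_M) auto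
      also have "to_ac (poly f (s \<nu>) / poly f (s \<mu>)) - 1 = to_ac ((poly f (s \<nu>) - poly f (s \<mu>)) / poly f (s \<mu>))"
        using nz by (simp add: field_simps)
      finally show "poly f (s \<nu>) \<approx> poly f (s \<mu>)"
        unfolding to_ac_in_M using nz by (simp add: v_divide_iff asymp_def)
    qed
  qed
qed

text \<open>Roots that are not pseudo-limits contribute factors in 1 + M, pseudo-limits contribute
  factors in \<open>M\<close>. All factors are thus in \<open>U\<close>, and one factor in
  \<open>M\<close> puts the whole product there.\<close>

lemma limit_root_increasing:
  assumes "pseudo_convergent v s" "f \<noteq> 0" "limit_root s f"
  shows "\<forall>\<^sub>F \<mu> in at_top. \<forall>\<nu>>\<mu>. v (poly f (s \<mu>)) < v (poly f (s \<nu>))"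
proof -
  obtain A where A: "\<And>\<alpha>. \<alpha> \<in># A \<longleftrightarrow> poly (map_poly to_ac f) \<alpha> = 0"
    "\<And>x y. poly f y \<noteq> 0 \<Longrightarrow> to_ac (poly f x / poly f y) = (\<Prod>\<alpha>\<in>#A. (to_ac x - \<alpha>) / (to_ac y - \<alpha>))"
    "\<And>y. poly f y \<noteq> 0 \<longleftrightarrow> to_ac y \<notin># A"
    by (rule poly_ratio[OF assms(2)]) (rule that; blast)
  obtain \<beta> where \<beta>: "\<beta> \<in># A" "closure_pseudo_limit v U s \<beta>" using assms(3) A(1) by (auto simp: limit_root_def)
  have "\<forall>\<^sub>F \<mu> in at_top. \<forall>\<alpha>\<in>set_mset A. to_ac (s \<mu>) \<noteq> \<alpha> \<and>
      (\<forall>\<nu>>\<mu>. (to_ac (s \<nu>) - \<alpha>) / (to_ac (s \<mu>) - \<alpha>) \<in> U)"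
  proof (intro eventually_ball_finite ballI)
    fix \<alpha>
    show "\<forall>\<^sub>F \<mu> in at_top. to_ac (s \<mu>) \<noteq> \<alpha> \<and> (\<forall>\<nu>>\<mu>. (to_ac (s \<nu>) - \<alpha>) / (to_ac (s \<mu>) - \<alpha>) \<in> U)"
    proof (cases "closure_pseudo_limit v U s \<alpha>")
      case True
      from limit_ratio[OF assms(1) this] show ?thesis by eventually_elim (auto intro: M_U)
    next
      case False
      have *: "x \<in> U" if "x - 1 \<in> M" for x using U_add[OF M_U[OF that] U_1] by simp
      from nonlimit_ratio[OF assms(1) False] show ?thesis by eventually_elim (auto intro: *)
    qed
  qed simp
  with limit_ratio[OF assms(1) \<beta>(2)] show ?thesis
  proof eventually_elim
    case (elim \<mu>)
    then have nz: "poly f (s \<mu>) \<noteq> 0" using A(3) by auto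
    obtain B where B: "A = add_mset \<beta> B" using \<beta>(1) by (metis mset_add)
    show ?case
    proof (intro allI impI)
      fix \<nu> assume "\<mu> < \<nu>"
      then have "to_ac (poly f (s \<nu>) / poly f (s \<mu>)) \<in> M"
        unfolding A(2)[OF nz] B image_mset_add_mset prod_mset.add_mset
        using elim by (intro M_mult prod_mset_in_U) (auto simp: B)
      then show "v (poly f (s \<mu>)) < v (poly f (s \<nu>))"
        unfolding to_ac_in_M using nz by (simp add: v_divide_iff)
    qed
  qed
qed

text \<open>The witness is the monic minimal polynomial over K of a root that is a pseudo-limit,
  found here as a polynomial of least degree vanishing at it.\<close>

lemma limit_root_P_E:
  assumes "f \<noteq> 0" "limit_root s f"
  obtains q where "q \<in> P_E v s" "Polynomial.degree q \<le> Polynomial.degree f"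
proof -
  obtain \<alpha> where \<alpha>: "poly (map_poly to_ac f) \<alpha> = 0" "closure_pseudo_limit v U s \<alpha>"
    using assms by (auto simp: limit_root_def)
  let ?R = "\<lambda>q. q \<noteq> 0 \<and> poly (map_poly to_ac q) \<alpha> = 0"
  obtain q0 where q0: "?R q0" "\<And>r. ?R r \<Longrightarrow> Polynomial.degree q0 \<le> Polynomial.degree r"
    using ex_has_least_nat[of ?R f Polynomial.degree] assms(1) \<alpha>(1) by blast
  define q where "q = Polynomial.smult (inverse (Polynomial.lead_coeff q0)) q0"
  have [simp]: "Polynomial.degree q = Polynomial.degree q0" using q0 by (simp add: q_def)
  have lc: "Polynomial.lead_coeff q = 1" using q0 by (simp add: q_def)
  have "map_poly to_ac q = Polynomial.smult (to_ac (inverse (Polynomial.lead_coeff q0))) (map_poly to_ac q0)"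
    by (rule poly_eqI) (simp add: q_def coeff_map_poly)
  then have R: "?R q" using q0 by (auto simp: q_def)
  have "Factorial_Ring.irreducible q"
    unfolding Factorial_Ring.irreducible_def
  proof (intro conjI allI impI)
    show "q \<noteq> 0" using R by simp
    show "\<not> q dvd 1"
    proof
      assume "q dvd 1"
      then have "Polynomial.degree q = 0" using R is_unit_iff_degree by blast
      then obtain a where "q = [:a:]" using degree_eq_zeroE by blast
      then show False using R by (auto simp: map_poly_pCons)
    qed
    fix a b assume ab: "q = a * b"
    then have nz: "a \<noteq> 0" "b \<noteq> 0" using R by auto
    have deg: "Polynomial.degree q0 = Polynomial.degree a + Polynomial.degree b"
      using degree_mult_eq[OF nz] unfolding ab[symmetric] by simp
    have "?R a \<or> ?R b" using R nz unfolding ab map_poly_to_ac_mult by auto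
    then have "Polynomial.degree b = 0 \<or> Polynomial.degree a = 0" using q0(2) deg by force
    then show "a dvd 1 \<or> b dvd 1" using nz by (auto simp: is_unit_iff_degree)
  qed
  then have "q \<in> P_E v s" using lc R \<alpha>(2) extends by (auto simp: P_E_def)
  moreover have "Polynomial.degree q \<le> Polynomial.degree f" using q0(2) assms(1) \<alpha>(1) by auto
  ultimately show thesis by (rule that)
qed

lemma P_E_min_no_limit_root:
  assumes "p \<in> P_E_min v s" "f \<noteq> 0" "Polynomial.degree f < Polynomial.degree p"
  shows "\<not> limit_root s f"
proof
  assume "limit_root s f"
  then obtain q where "q \<in> P_E v s" "Polynomial.degree q \<le> Polynomial.degree f"
    by (rule limit_root_P_E[OF assms(2)])
  then show False using assms(1,3) unfolding P_E_min_def by force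
qed

end

text \<open>Membership in \<open>P_E\<close> brings its own extension, which may differ from one
  chosen in advance. For this reason no extension is fixed globally.\<close>

lemma P_E_limit_root:
  assumes "valuation v" "p \<in> P_E v s"
  obtains U where "closure_extension v U" "closure_extension.limit_root v U s p"
proof -
  obtain U \<alpha> where U: "extends_to_closure v U" "poly (map_poly to_ac p) \<alpha> = 0" "closure_pseudo_limit v U s \<alpha>"
    using assms by (auto simp: P_E_def)
  interpret closure_extension v U using assms U by unfold_locales auto
  show thesis using that[OF closure_extension_axioms] U by (auto simp: limit_root_def)
qed

text \<open>A polynomial whose values are not eventually constant must have a pseudo-limit among its
  roots, for any chosen extension, since otherwise it would be asymptotic to a constant.\<close>

lemma (in valued_field) P_E_nonempty:
  assumes "pseudo_convergent v s" "\<not> pc_transcendental v s"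
  shows "P_E v s \<noteq> {}"
proof -
  obtain U where U: "extends_to_closure v U" using exists_extends_to_closure by blast
  interpret closure_extension v U using U by unfold_locales auto
  obtain f where f: "\<And>c. \<not> (\<forall>\<^sub>F \<nu> in at_top. v (poly f (s \<nu>)) = c)"
    using assms unfolding pc_transcendental_def by blast
  have "f \<noteq> 0" using f[of "Infty"] by (cases "f = 0") simp_all
  moreover have "limit_root s f"
  proof (rule ccontr)
    assume "\<not> ?thesis"
    from no_limit_root_asymp[OF assms(1) \<open>f \<noteq> 0\<close> this]
    obtain N where "\<And>\<mu> \<nu>. N \<le> \<mu> \<Longrightarrow> \<mu> < \<nu> \<Longrightarrow> poly f (s \<nu>) \<approx> poly f (s \<mu>)"
      unfolding eventually_at_top_linorder by blast
    then have "\<forall>\<nu>>N. v (poly f (s \<nu>)) = v (poly f (s N))" using asymp_v[of "poly f (s _)" "poly f (s N)"] by simp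
    then have "\<forall>\<^sub>F \<nu> in at_top. v (poly f (s \<nu>)) = v (poly f (s N))"
      by (intro eventually_mono[OF eventually_gt_at_top[of N]]) blast
    then show False using f by blast
  qed
  ultimately show ?thesis using limit_root_P_E by blast
qed

section \<open>Residue fields\<close>

context valued_field
begin

lemma val_ring_str_simps [simp]:
  "carrier (val_ring_str v) = val_ring v" "x \<otimes>\<^bsub>val_ring_str v\<^esub> y = x * y" "x \<oplus>\<^bsub>val_ring_str v\<^esub> y = x + y"
  "\<one>\<^bsub>val_ring_str v\<^esub> = 1" "\<zero>\<^bsub>val_ring_str v\<^esub> = 0"
  by (auto simp: val_ring_str_def ring_of_type_algebra_def)

lemma val_ring_closed [simp]:
  "0 \<in> val_ring v" "1 \<in> val_ring v" "x \<in> val_ring v \<Longrightarrow> - x \<in> val_ring v"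
  "x \<in> val_ring v \<Longrightarrow> y \<in> val_ring v \<Longrightarrow> x + y \<in> val_ring v"
  "x \<in> val_ring v \<Longrightarrow> y \<in> val_ring v \<Longrightarrow> x - y \<in> val_ring v"
  "x \<in> val_ring v \<Longrightarrow> y \<in> val_ring v \<Longrightarrow> x * y \<in> val_ring v"
  by (auto simp: val_ring_def v_add_ge v_diff_ge add_nonneg_nonneg)

lemma max_ideal_subset: "max_ideal v \<subseteq> val_ring v"
  by (auto simp: max_ideal_def val_ring_def)

lemma cring_val_ring: "cring (val_ring_str v)"
proof (intro cringI abelian_groupI comm_monoidI)
  fix x assume "x \<in> carrier (val_ring_str v)"
  then show "\<exists>y\<in>carrier (val_ring_str v). y \<oplus>\<^bsub>val_ring_str v\<^esub> x = \<zero>\<^bsub>val_ring_str v\<^esub>"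
    by (intro bexI[of _ "- x"]) auto
qed (auto simp: algebra_simps)

lemma ideal_max_ideal: "ideal (max_ideal v) (val_ring_str v)"
proof (intro idealI)
  show "ring (val_ring_str v)" using cring_val_ring by (rule cring.axioms)
  interpret R: cring "val_ring_str v" by (rule cring_val_ring)
  show "subgroup (max_ideal v) (add_monoid (val_ring_str v))"
  proof (rule R.add.subgroupI)
    fix a assume a: "a \<in> max_ideal v"
    then have "\<ominus>\<^bsub>val_ring_str v\<^esub> a = - a"
      using max_ideal_subset by (intro R.minus_equality) auto
    then show "\<ominus>\<^bsub>val_ring_str v\<^esub> a \<in> max_ideal v" using a by (auto simp: max_ideal_def)
  qed (use max_ideal_subset in \<open>auto simp: max_ideal_def v_add_gt intro: exI[of _ 0]\<close>)
qed (auto simp: max_ideal_def val_ring_def add_pos_nonneg add_nonneg_pos)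

lemma maximalideal_max_ideal: "maximalideal (max_ideal v) (val_ring_str v)"
proof (rule maximalidealI[OF ideal_max_ideal])
  show "carrier (val_ring_str v) \<noteq> max_ideal v"
    using val_ring_closed(2) by (metis max_ideal_def mem_Collect_eq order_less_irrefl v_1 val_ring_str_simps(1))
  fix J assume J: "ideal J (val_ring_str v)" "max_ideal v \<subseteq> J" "J \<subseteq> carrier (val_ring_str v)"
  show "J = max_ideal v \<or> J = carrier (val_ring_str v)"
  proof (rule disjCI)
    assume "J \<noteq> carrier (val_ring_str v)"
    then have "1 \<notin> J" using ideal.one_imp_carrier[OF J(1)] by auto
    have "x \<in> max_ideal v" if x: "x \<in> J" for x
    proof (rule ccontr)
      assume "x \<notin> max_ideal v"
      then have v: "v x = 0" using J(3) x by (auto simp: max_ideal_def val_ring_def)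
      then have "x \<noteq> 0" by auto
      then have "inverse x \<in> val_ring v" using v v_inverse[of x] by (simp add: val_ring_def)
      then have "inverse x * x \<in> J" using ideal.I_l_closed[OF J(1) x] by auto
      then show False using \<open>1 \<notin> J\<close> \<open>x \<noteq> 0\<close> by simp
    qed
    then show "J = max_ideal v" using J(2) by blast
  qed
qed

lemma field_residue_field: "field (residue_field v)"
  unfolding residue_field_def by (rule maximalideal.quotient_is_field[OF maximalideal_max_ideal cring_val_ring])

lemma residue_ring_hom: "residue v \<in> ring_hom (val_ring_str v) (residue_field v)"
  unfolding residue_def residue_field_def using ideal.rcos_ring_hom[OF ideal_max_ideal] by (simp add: o_def)

lemma residue_carrier: "carrier (residue_field v) = residue v ` val_ring v"
  by (auto simp: residue_field_def FactRing_def A_RCOSETS_def' residue_def)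

lemma residue_closed [simp]: "x \<in> val_ring v \<Longrightarrow> residue v x \<in> carrier (residue_field v)"
  by (simp add: residue_carrier)

lemma residue_add: "x \<in> val_ring v \<Longrightarrow> y \<in> val_ring v \<Longrightarrow>
    residue v x \<oplus>\<^bsub>residue_field v\<^esub> residue v y = residue v (x + y)"
  and residue_mult: "x \<in> val_ring v \<Longrightarrow> y \<in> val_ring v \<Longrightarrow>
    residue v x \<otimes>\<^bsub>residue_field v\<^esub> residue v y = residue v (x * y)"
  and residue_one: "\<one>\<^bsub>residue_field v\<^esub> = residue v 1"
  using ring_hom_add[OF residue_ring_hom, of x y] ring_hom_mult[OF residue_ring_hom, of x y]
    ring_hom_one[OF residue_ring_hom] by auto

lemma residue_eq_iff:
  assumes "x \<in> val_ring v" "y \<in> val_ring v"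
  shows "residue v x = residue v y \<longleftrightarrow> 0 < v (x - y)"
proof
  interpret ideal "max_ideal v" "val_ring_str v" by (rule ideal_max_ideal)
  have mem: "z \<in> residue v x \<longleftrightarrow> 0 < v (z - x)" for z x
  proof -
    have "z \<in> residue v x \<longleftrightarrow> (\<exists>m\<in>max_ideal v. z = m + x)"
      by (auto simp: residue_def a_r_coset_def')
    also have "\<dots> \<longleftrightarrow> z - x \<in> max_ideal v" by force
    finally show ?thesis by (simp add: max_ideal_def)
  qed
  show "0 < v (x - y)" if "residue v x = residue v y"
    using mem[of x x] mem[of x y] that by simp
  show "residue v x = residue v y" if "0 < v (x - y)"
    using a_repr_independence'[of x y] mem[of x y] assms that by (auto simp: residue_def)
qed

lemma residue_zero: "\<zero>\<^bsub>residue_field v\<^esub> = residue v 0"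
proof -
  interpret field "residue_field v" by (rule field_residue_field)
  have "residue v 0 \<oplus>\<^bsub>residue_field v\<^esub> residue v 0 = residue v 0" by (subst residue_add) auto
  then show ?thesis by (metis add.l_cancel_one' residue_closed val_ring_closed(1))
qed

lemma residue_eq_zero_iff: "x \<in> val_ring v \<Longrightarrow> residue v x = \<zero>\<^bsub>residue_field v\<^esub> \<longleftrightarrow> 0 < v x"
  by (simp add: residue_zero residue_eq_iff)

lemma residue_uminus:
  assumes "x \<in> val_ring v"
  shows "\<ominus>\<^bsub>residue_field v\<^esub> residue v x = residue v (- x)"
proof -
  interpret field "residue_field v" by (rule field_residue_field)
  have "residue v (- x) \<oplus>\<^bsub>residue_field v\<^esub> residue v x = \<zero>\<^bsub>residue_field v\<^esub>"
    using assms by (subst residue_add) (auto simp: residue_zero)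
  then show ?thesis using assms by (intro minus_equality) auto
qed

lemma residue_inverse:
  assumes "v x = 0"
  shows "inv\<^bsub>residue_field v\<^esub> residue v x = residue v (inverse x)"
proof -
  interpret field "residue_field v" by (rule field_residue_field)
  have "x \<noteq> 0" using assms by auto
  then have "v (inverse x) = 0" using v_inverse[of x] assms by simp
  then have "x \<in> val_ring v" "inverse x \<in> val_ring v" using assms by (auto simp: val_ring_def)
  then show ?thesis using \<open>x \<noteq> 0\<close>
    by (intro comm_inv_char) (auto simp: residue_mult residue_one)
qed

end

section \<open>Valuations on the field of rational functions\<close>

text \<open>The same embedding as \<open>rat_const\<close>, in the form to which the homomorphism
  rules of \<open>to_fract\<close> apply.\<close>

definition const_fract :: "'a::field \<Rightarrow> 'a poly fract" where
  "const_fract c = to_fract [:c:]"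

lemma const_fract_ops:
  "const_fract (a + b) = const_fract a + const_fract b" "const_fract (a - b) = const_fract a - const_fract b"
  "const_fract (a * b) = const_fract a * const_fract b"
  by (simp_all add: const_fract_def flip: to_fract_add to_fract_diff to_fract_mult)

lemma const_fract_1 [simp]: "const_fract 1 = 1"
  by (simp add: const_fract_def one_pCons[symmetric])

lemma const_fract_0 [simp]: "const_fract 0 = 0" "const_fract a = 0 \<longleftrightarrow> a = 0"
  by (simp_all add: const_fract_def)

lemma rat_const_eq: "rat_const c = const_fract c"
  by (simp add: const_fract_def to_fract_def)

locale rational_extension = valued_field v
  for v :: "'a::field \<Rightarrow> 'g::linordered_ab_group_add vext" +
  fixes w :: "'a poly fract \<Rightarrow> 'g vext"
  assumes extends_rat: "extends_to_rat v w"
begin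

sublocale W: valued_field w
  using extends_rat by unfold_locales (auto simp: extends_to_rat_def)

lemma w_const [simp]: "w (to_fract [:c:]) = v c"
  using extends_rat by (auto simp: extends_to_rat_def to_fract_def)

lemma w_const_fract [simp]: "w (const_fract a) = v a"
  by (simp add: const_fract_def)

lemma const_fract_val_ring [simp]: "const_fract a \<in> val_ring w \<longleftrightarrow> a \<in> val_ring v"
  by (simp add: val_ring_def)

text \<open>That the map on residues is well defined and injective follows from \<open>w\<close>
  extending \<open>v\<close>. The hypothesis provides surjectivity: a unit asymptotic to a constant
  has the residue of that constant.\<close>

lemma same_residue_fieldI:
  assumes "\<And>\<phi>. w \<phi> = 0 \<Longrightarrow> \<exists>c. W.asymp \<phi> (const_fract c)"
  shows "same_residue_field v w"
proof -
  define rep where "rep R = (SOME a. a \<in> val_ring v \<and> residue v a = R)" for R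
  define h where "h R = residue w (const_fract (rep R))" for R
  have rep: "rep (residue v a) \<in> val_ring v \<and> residue v (rep (residue v a)) = residue v a"
    if "a \<in> val_ring v" for a
    unfolding rep_def by (rule someI[of _ a]) (use that in auto)
  have eq: "residue w (const_fract a) = residue w (const_fract b) \<longleftrightarrow> residue v a = residue v b"
    if "a \<in> val_ring v" "b \<in> val_ring v" for a b
    using that by (simp add: residue_eq_iff W.residue_eq_iff flip: const_fract_ops(2))
  have h: "h (residue v a) = residue w (const_fract a)" if "a \<in> val_ring v" for a
    unfolding h_def using eq rep[OF that] that by blast
  have "h \<in> ring_hom (residue_field v) (residue_field w)"
    by (intro ring_hom_memI)
      (auto simp: residue_carrier h residue_mult residue_add residue_one W.residue_mult W.residue_add
        W.residue_one const_fract_ops)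
  moreover have "bij_betw h (carrier (residue_field v)) (carrier (residue_field w))"
    unfolding bij_betw_def
  proof
    show "inj_on h (carrier (residue_field v))"
      by (auto simp: inj_on_def residue_carrier h eq)
    have "\<exists>a\<in>val_ring v. residue w \<phi> = residue w (const_fract a)" if "\<phi> \<in> val_ring w" for \<phi>
    proof (cases "w \<phi> = 0")
      case True
      then obtain c where c: "W.asymp \<phi> (const_fract c)" using assms by blast
      then have "v c = 0" using W.asymp_v[OF c] True by simp
      then show ?thesis using c that
        by (intro bexI[of _ c]) (auto simp: W.residue_eq_iff val_ring_def W.asymp_def)
    next
      case False
      then have "0 < w \<phi>" using that by (simp add: val_ring_def)
      then show ?thesis using that
        by (intro bexI[of _ 0]) (auto simp: W.residue_eq_iff)
    qed
    then show "h ` carrier (residue_field v) = carrier (residue_field w)"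
      by (force simp: residue_carrier W.residue_carrier h image_iff)
  qed
  ultimately show ?thesis
    using h unfolding same_residue_field_def ring_iso_def rat_const_eq by blast
qed

end

context valued_field
begin

lemma value_group_nonzero: "\<gamma> \<in> value_group v \<longleftrightarrow> (\<exists>c. c \<noteq> 0 \<and> v c = Val \<gamma>)"
proof
  assume "\<gamma> \<in> value_group v"
  then obtain c where "v c = Val \<gamma>" by (auto simp: value_group_def)
  moreover from this have "c \<noteq> 0" by auto
  ultimately show "\<exists>c. c \<noteq> 0 \<and> v c = Val \<gamma>" by blast
qed (auto simp: value_group_def)

lemma value_group_diff: "a \<in> value_group v \<Longrightarrow> b \<in> value_group v \<Longrightarrow> a - b \<in> value_group v"
proof -
  assume "a \<in> value_group v" "b \<in> value_group v"
  then obtain x y where "v x = Val a" "v y = Val b" "y \<noteq> 0" by (auto simp: value_group_nonzero)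
  then have "v (x / y) = Val (a - b)" by (simp add: v_divide_eq)
  then show ?thesis by (auto simp: value_group_def)
qed

lemma value_group_0: "0 \<in> value_group v"
  by (auto simp: value_group_def zero_vext_def[symmetric] intro: exI[of _ 1])

end

context rational_extension
begin

lemma w_Fract: "g \<noteq> 0 \<Longrightarrow> w (Fract f g) = w (to_fract f) - w (to_fract g)"
  by (simp add: Fract_conv_to_fract W.v_divide_eq)

text \<open>Fractions inherit asymptotic constants from numerator and denominator, so this one
  condition on polynomials settles the value group and the residue field together.\<close>

lemma asymp_const_values:
  assumes "\<And>f. f \<noteq> 0 \<Longrightarrow> \<exists>c. W.asymp (to_fract f) (const_fract c)"
  shows "immediate v w"
proof -
  have c: "\<exists>c. W.asymp \<phi> (const_fract c)" if "\<phi> \<noteq> 0" for \<phi>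
  proof -
    obtain f g where fg: "\<phi> = Fract f g" "g \<noteq> 0" by (cases \<phi>) auto
    then have "f \<noteq> 0" using that by (auto simp: eq_fract Zero_fract_def)
    obtain c where c: "W.asymp (to_fract f) (const_fract c)" using assms \<open>f \<noteq> 0\<close> by blast
    obtain d where d: "W.asymp (to_fract g) (const_fract d)" using assms fg(2) by blast
    have "d \<noteq> 0" using W.asymp_nz[OF d] by simp
    then have "const_fract (c / d) = const_fract c / const_fract d"
      using const_fract_ops(3)[of "c / d" d] by (simp add: nonzero_eq_divide_eq)
    with W.asymp_divide[OF c d] have "W.asymp \<phi> (const_fract (c / d))"
      unfolding fg(1) Fract_conv_to_fract by simp
    then show ?thesis by blast
  qed
  have "value_group w = value_group v"
  proof (intro Set.set_eqI iffI)
    fix \<gamma> assume "\<gamma> \<in> value_group w"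
    then obtain \<phi> where \<phi>: "w \<phi> = Val \<gamma>" by (auto simp: value_group_def)
    then have "\<phi> \<noteq> 0" by auto
    then obtain c where "W.asymp \<phi> (const_fract c)" using c by blast
    then have "v c = Val \<gamma>" using W.asymp_v \<phi> by fastforce
    then show "\<gamma> \<in> value_group v" by (auto simp: value_group_def)
  next
    fix \<gamma> assume "\<gamma> \<in> value_group v"
    then obtain c where "v c = Val \<gamma>" by (auto simp: value_group_def)
    then have "w (const_fract c) = Val \<gamma>" by simp
    then show "\<gamma> \<in> value_group w" unfolding value_group_def by blast
  qed
  moreover have "same_residue_field v w"
  proof (rule same_residue_fieldI)
    fix \<phi> assume "w \<phi> = 0"
    then have "\<phi> \<noteq> 0" by auto
    then show "\<exists>c. W.asymp \<phi> (const_fract c)" by (rule c)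
  qed
  ultimately show ?thesis by (simp add: immediate_def)
qed

end

text \<open>\<open>p\<close> behaves like a key polynomial: all polynomials of smaller degree are asymptotic to constants,
  and no nonzero multiple of \<open>w p\<close> is a value of \<open>v\<close>. In a \<open>p\<close>-adic expansion
  the values of the terms are then pairwise distinct.\<close>

locale key_polynomial = rational_extension v w
  for v :: "'a::field \<Rightarrow> 'g::linordered_ab_group_add vext" and w +
  fixes p :: "'a poly" and \<Delta> :: 'g
  assumes p_deg: "Polynomial.degree p > 0"
    and w_p: "w (to_fract p) = Val \<Delta>"
    and small_asymp: "\<And>f. f \<noteq> 0 \<Longrightarrow> Polynomial.degree f < Polynomial.degree p \<Longrightarrow>
      \<exists>c. W.asymp (to_fract f) (const_fract c)"
    and p_torsion_free: "\<And>n c. n > 0 \<Longrightarrow> w (to_fract p ^ n) \<noteq> v c"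
begin

lemma int_mult_\<Delta>: "int_mult n \<Delta> \<in> value_group v \<longleftrightarrow> n = 0"
proof
  assume a: "int_mult n \<Delta> \<in> value_group v"
  show "n = 0"
  proof (rule ccontr)
    assume "n \<noteq> 0"
    obtain c where c: "v c = Val (int_mult n \<Delta>)" "c \<noteq> 0" using a by (auto simp: value_group_nonzero)
    show False
    proof (cases "n > 0")
      case True
      then show False using p_torsion_free[of "nat n" c] c W.v_power[OF w_p, of "nat n"] by simp
    next
      case False
      have "v (inverse c) = Val (int_mult (- n) \<Delta>)"
        using v_inverse[OF c(2)] c(1) by (cases "v (inverse c)") (auto simp: int_mult_uminus zero_vext_def eq_neg_iff_add_eq_0)
      then show False using False \<open>n \<noteq> 0\<close> p_torsion_free[of "nat (- n)" "inverse c"] W.v_power[OF w_p, of "nat (- n)"] by simp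
    qed
  qed
next
  assume "n = 0"
  then show "int_mult n \<Delta> \<in> value_group v" by (auto simp: value_group_def zero_vext_def[symmetric] intro: exI[of _ 1])
qed

text \<open>The exponent of \<open>p\<close> in \<open>p * h\<close> is at least one, so the value
  involves a positive multiple of \<Delta>. This keeps \<open>p * h\<close> apart from the remainder
  of a division by \<open>p\<close>.\<close>

lemma w_p_mult_neq:
  assumes "W.asymp (to_fract h) (to_fract p ^ n * const_fract c)" "d \<noteq> 0"
  shows "w (to_fract (p * h)) \<noteq> v d"
proof -
  have "const_fract c \<noteq> 0" using W.asymp_nz[OF assms(1)] by auto
  then have c: "c \<noteq> 0" by auto
  have "w (to_fract (p * h)) + v (inverse c) = w (to_fract p ^ Suc n * const_fract c) + v (inverse c)"
    using W.asymp_v[OF assms(1)] by (simp add: add.assoc)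
  also have "\<dots> = w (to_fract p ^ Suc n) + (v (inverse c) + v c)" by (simp add: ac_simps)
  finally have "w (to_fract (p * h)) + v (inverse c) = w (to_fract p ^ Suc n)"
    unfolding v_inverse[OF c] by simp
  then show ?thesis using p_torsion_free[of "Suc n" "d * inverse c"] by auto
qed

text \<open>Induction by division, f = p h + r. By induction p h is asymptotic to some c p^(n + 1),
  and a nonzero r is asymptotic to a constant; their values differ, so the one of smaller value
  dominates f.\<close>

lemma poly_asymp: "f \<noteq> 0 \<Longrightarrow> \<exists>n c. c \<noteq> 0 \<and> W.asymp (to_fract f) (to_fract p ^ n * const_fract c)"
proof (induction "Polynomial.degree f" arbitrary: f rule: less_induct)
  case less
  have const: "\<exists>n c. c \<noteq> 0 \<and> W.asymp (to_fract f) (to_fract p ^ n * const_fract c)"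
    if f: "W.asymp (to_fract f) (const_fract c)" for f c
  proof -
    have "const_fract c \<noteq> 0" using W.asymp_nz[OF f] by auto
    then show ?thesis using f by (intro exI[of _ 0] exI[of _ c]) auto
  qed
  show ?case
  proof (cases "Polynomial.degree f < Polynomial.degree p")
    case True
    then show ?thesis using small_asymp[OF less.prems] const by blast
  next
    case False
    define h r where "h = f div p" "r = f mod p"
    have p0: "p \<noteq> 0" using p_deg by auto
    have f: "f = p * h + r" by (simp add: h_r_def)
    have r: "r = 0 \<or> Polynomial.degree r < Polynomial.degree p"
      unfolding h_r_def using degree_mod_less[OF p0] by auto
    have h: "h \<noteq> 0" using r f False p_deg by auto
    have "Polynomial.degree h < Polynomial.degree f"
      unfolding h_r_def using p_deg False by (intro degree_div_less) auto
    then obtain n c where nc: "c \<noteq> 0" "W.asymp (to_fract h) (to_fract p ^ n * const_fract c)"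
      using less.hyps h by blast
    have ph: "W.asymp (to_fract (p * h)) (to_fract p ^ Suc n * const_fract c)"
      using W.asymp_mult[OF W.asymp_refl nc(2), of "to_fract p"] p0 by (simp add: mult.assoc)
    show ?thesis
    proof (cases "r = 0")
      case True
      then have "W.asymp (to_fract f) (to_fract p ^ Suc n * const_fract c)" using ph f by simp
      then show ?thesis using nc(1) by blast
    next
      case False
      then obtain d where d: "W.asymp (to_fract r) (const_fract d)" using r small_asymp by blast
      have "w (to_fract r) = v d" using W.asymp_v[OF d] by simp
      moreover have "d \<noteq> 0" using W.asymp_nz[OF d] by auto
      ultimately have "w (to_fract (p * h)) \<noteq> w (to_fract r)" using w_p_mult_neq[OF nc(2)] by metis
      then consider "w (to_fract (p * h)) < w (to_fract r)" | "w (to_fract r) < w (to_fract (p * h))"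
        by (meson linorder_neqE)
      then show ?thesis
      proof cases
        case 1
        have "W.asymp (to_fract f) (to_fract (p * h))" unfolding f to_fract_add by (rule W.asymp_add_left(1)[OF 1])
        from W.asymp_trans[OF this ph] show ?thesis using nc(1) by blast
      next
        case 2
        have "W.asymp (to_fract f) (to_fract r)" unfolding f to_fract_add by (rule W.asymp_add_left(2)[OF 2])
        from W.asymp_trans[OF this d] show ?thesis by (rule const)
      qed
    qed
  qed
qed

lemma fract_asymp:
  assumes "\<phi> \<noteq> 0"
  obtains m n c where "c \<noteq> 0" "W.asymp \<phi> (to_fract p ^ m / to_fract p ^ n * const_fract c)"
    "w (to_fract p ^ m / to_fract p ^ n * const_fract c) = Val (int_mult (int m - int n) \<Delta>) + v c"
proof -
  obtain f g where fg: "\<phi> = Fract f g" "g \<noteq> 0" by (cases \<phi>) auto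
  then have "f \<noteq> 0" using assms by (auto simp: eq_fract Zero_fract_def)
  then obtain m n c d where f: "c \<noteq> 0" "W.asymp (to_fract f) (to_fract p ^ m * const_fract c)"
    and g: "d \<noteq> 0" "W.asymp (to_fract g) (to_fract p ^ n * const_fract d)"
    using poly_asymp fg(2) by meson
  have cd: "const_fract (c / d) = const_fract c / const_fract d"
    using g(1) const_fract_ops(3)[of "c / d" d] by (auto simp: nonzero_eq_divide_eq)
  have p0: "to_fract p \<noteq> 0" using p_deg by auto
  have "W.asymp \<phi> (to_fract p ^ m / to_fract p ^ n * const_fract (c / d))"
    using W.asymp_divide[OF f(2) g(2)] unfolding fg(1) Fract_conv_to_fract cd by simp
  moreover have "w (to_fract p ^ m / to_fract p ^ n * const_fract (c / d)) = Val (int_mult (int m - int n) \<Delta>) + v (c / d)"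
    unfolding W.v_mult using p0 by (simp add: W.v_divide_eq W.v_power[OF w_p] int_mult_minus)
  ultimately show thesis using that[of "c / d"] f g by simp
qed

lemma value_group_w: "value_group w = (\<lambda>(n, \<gamma>). int_mult n \<Delta> + \<gamma>) ` (UNIV \<times> value_group v)"
proof (intro Set.set_eqI iffI)
  fix \<delta> assume "\<delta> \<in> value_group w"
  then obtain \<phi> where \<phi>: "w \<phi> = Val \<delta>" by (auto simp: value_group_def)
  then have "\<phi> \<noteq> 0" by auto
  then obtain m n c where c: "c \<noteq> 0" "W.asymp \<phi> (to_fract p ^ m / to_fract p ^ n * const_fract c)"
    "w (to_fract p ^ m / to_fract p ^ n * const_fract c) = Val (int_mult (int m - int n) \<Delta>) + v c"
    by (rule fract_asymp)
  obtain \<gamma> where \<gamma>: "v c = Val \<gamma>" using c(1) by (cases "v c") auto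
  then have "\<delta> = int_mult (int m - int n) \<Delta> + \<gamma>" "\<gamma> \<in> value_group v"
    using c W.asymp_v[OF c(2)] \<phi> by (auto simp: value_group_def)
  then show "\<delta> \<in> (\<lambda>(n, \<gamma>). int_mult n \<Delta> + \<gamma>) ` (UNIV \<times> value_group v)" by force
next
  fix \<delta> assume "\<delta> \<in> (\<lambda>(n, \<gamma>). int_mult n \<Delta> + \<gamma>) ` (UNIV \<times> value_group v)"
  then obtain n c \<gamma> where \<delta>: "\<delta> = int_mult n \<Delta> + \<gamma>" "v c = Val \<gamma>" by (auto simp: value_group_def)
  obtain i j where n: "n = int i - int j" by (rule int_diff_cases)
  have "to_fract p \<noteq> 0" using p_deg by auto
  then have "w (to_fract p ^ i / to_fract p ^ j * const_fract c) = Val \<delta>"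
    unfolding W.v_mult using \<delta> by (simp add: W.v_divide_eq W.v_power[OF w_p] int_mult_minus n)
  then show "\<delta> \<in> value_group w" by (auto simp: value_group_def)
qed

text \<open>Injectivity expresses that the sum is direct: two representations of one element would
  put a nonzero multiple of \<Delta> into the value group of \<open>v\<close>.\<close>

lemma bij_value_group: "bij_betw (\<lambda>(n, \<gamma>). int_mult n \<Delta> + \<gamma>) (UNIV \<times> value_group v) (value_group w)"
  unfolding bij_betw_def
proof
  show "inj_on (\<lambda>(n, \<gamma>). int_mult n \<Delta> + \<gamma>) (UNIV \<times> value_group v)"
  proof (rule inj_onI, clarify)
    fix m n a b assume a: "a \<in> value_group v" "b \<in> value_group v" "int_mult m \<Delta> + a = int_mult n \<Delta> + b"
    then have "int_mult (m - n) \<Delta> = b - a" by (simp add: int_mult_minus algebra_simps)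
    then have "m = n" using value_group_diff[OF a(2,1)] int_mult_\<Delta>[of "m - n"] by simp
    then show "m = n \<and> a = b" using a(3) by simp
  qed
qed (simp add: value_group_w)

text \<open>For a unit the power of \<open>p\<close> must cancel, since its value would be a
  multiple of \<Delta> lying in the value group of \<open>v\<close>; only a constant
  remains.\<close>

lemma same_residue: "same_residue_field v w"
proof (rule same_residue_fieldI)
  fix \<phi> assume \<phi>: "w \<phi> = 0"
  then have "\<phi> \<noteq> 0" by auto
  then obtain m n c where c: "c \<noteq> 0" "W.asymp \<phi> (to_fract p ^ m / to_fract p ^ n * const_fract c)"
    "w (to_fract p ^ m / to_fract p ^ n * const_fract c) = Val (int_mult (int m - int n) \<Delta>) + v c"
    by (rule fract_asymp)
  obtain \<gamma> where \<gamma>: "v (inverse c) = Val \<gamma>" using c(1) by (cases "v (inverse c)") auto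
  have "Val (int_mult (int m - int n) \<Delta>) + v c = 0" using c W.asymp_v[OF c(2)] \<phi> by simp
  then have "int_mult (int m - int n) \<Delta> = \<gamma>"
    using v_inverse[OF c(1)] \<gamma> by (cases "v c") (auto simp: zero_vext_def add_eq_0_iff)
  then have "m = n" using int_mult_\<Delta>[of "int m - int n"] \<gamma> by (auto simp: value_group_def)
  moreover have "to_fract p \<noteq> 0" using p_deg by auto
  ultimately show "\<exists>c. W.asymp \<phi> (const_fract c)" using c(2) by auto
qed

end

lemma (in rational_extension) value_group_generated:
  assumes "value_group w = (\<lambda>(n, \<gamma>). int_mult n \<Delta> + \<gamma>) ` (UNIV \<times> value_group v)"
  shows "value_group w = group_closure (insert \<Delta> (value_group v))"
proof (intro Set.set_eqI iffI)
  fix \<delta> assume "\<delta> \<in> value_group w"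
  then show "\<delta> \<in> group_closure (insert \<Delta> (value_group v))"
    unfolding assms by (auto intro!: group_closure_add int_mult_in_group_closure intro: group_closure.base)
next
  have D: "\<Delta> \<in> value_group w" unfolding assms
    by (rule image_eqI[of _ _ "(1, 0)"]) (use value_group_0 in auto)
  have sub: "\<gamma> \<in> value_group w" if "\<gamma> \<in> value_group v" for \<gamma> unfolding assms
    by (rule image_eqI[of _ _ "(0, \<gamma>)"]) (use that in auto)
  fix \<delta> assume "\<delta> \<in> group_closure (insert \<Delta> (value_group v))"
  then show "\<delta> \<in> value_group w"
    by induction (use D sub W.value_group_0 W.value_group_diff in auto)
qed

section \<open>Monomial valuations\<close>

context rational_extension
begin

text \<open>The description in \<open>monomial_val\<close> ranges over all representations of a
  fraction. Independence of the representation comes for free from \<open>w\<close>, which is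
  already a function on fractions.\<close>

lemma monomial_val_unique:
  assumes poly: "\<And>f. w (to_fract f) = monomial_val_poly v \<beta> \<delta> f"
  shows "w = monomial_val v \<beta> \<delta>"
proof
  fix \<phi> :: "'a poly fract"
  obtain f g where fg: "\<phi> = Fract f g" "g \<noteq> 0" by (cases \<phi>) auto
  show "w \<phi> = monomial_val v \<beta> \<delta> \<phi>"
    unfolding monomial_val_def
  proof (rule sym, rule the_equality)
    show "\<exists>f g. g \<noteq> 0 \<and> \<phi> = Fract f g \<and> w \<phi> = monomial_val_poly v \<beta> \<delta> f - monomial_val_poly v \<beta> \<delta> g"
      using fg by (auto simp: w_Fract poly)
  qed (auto simp: w_Fract poly)
qed

text \<open>Ultrametricity gives one inequality. For the other, write f = f(\<beta>) + (X - \<beta>)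
  h. By \<open>no_cancel\<close> the value of f is at most that of f(\<beta>), hence at most that of
  (X - \<beta>) h, and induction on h bounds w(f) by every term of the expansion.\<close>

lemma monomial_val_polyI:
  assumes \<beta>: "w (to_fract [:- \<beta>, 1:]) = Val \<delta>"
    and no_cancel: "\<And>f. w (to_fract f) \<le> v (poly f \<beta>)"
  shows "w (to_fract f) = monomial_val_poly v \<beta> \<delta> f"
proof -
  define L where "L = [:- \<beta>, 1::'a:]"
  define m where "m g = Min ((\<lambda>i. v (Polynomial.coeff g i) + Val (int_mult (int i) \<delta>)) ` {..Polynomial.degree g})" for g
  have m_le: "m g \<le> v (Polynomial.coeff g i) + Val (int_mult (int i) \<delta>)" for g i
  proof (cases "i \<le> Polynomial.degree g")
    case True then show ?thesis unfolding m_def by (intro Min_le) auto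
  qed (simp add: coeff_eq_0)
  have m_ge: "x \<le> m g" if "\<And>i. x \<le> v (Polynomial.coeff g i) + Val (int_mult (int i) \<delta>)" for x g
    unfolding m_def by (rule Min.boundedI) (use that in auto)
  \<comment> \<open>An arbitrary lower bound x is used instead of the minimum, because passing to
    the tail of the coefficients shifts the bound by \<delta>.\<close>
  have lower: "x \<le> w (to_fract (g \<circ>\<^sub>p L))" if "\<And>i. x \<le> v (Polynomial.coeff g i) + Val (int_mult (int i) \<delta>)" for x g
    using that
  proof (induction g arbitrary: x)
    case (pCons a g)
    have a: "x \<le> v a" using pCons.prems[of 0] by (simp add: zero_vext_def[symmetric])
    have "x - Val \<delta> \<le> v (Polynomial.coeff g i) + Val (int_mult (int i) \<delta>)" for i
      using pCons.prems[of "Suc i"]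
      by (cases x; cases "v (Polynomial.coeff g i)") (auto simp: int_mult_add algebra_simps)
    from pCons.IH[OF this] have "x \<le> Val \<delta> + w (to_fract (g \<circ>\<^sub>p L))"
      by (cases x; cases "w (to_fract (g \<circ>\<^sub>p L))") (auto simp: algebra_simps)
    then have "x \<le> w (to_fract L * to_fract (g \<circ>\<^sub>p L))" unfolding W.v_mult using \<beta> by (simp only: L_def)
    then have "x \<le> w (to_fract [:a:] + to_fract L * to_fract (g \<circ>\<^sub>p L))" using a by (intro W.v_add_ge) simp_all
    then show ?case unfolding pcompose_pCons to_fract_add to_fract_mult .
  qed simp
  have upper: "w (to_fract (g \<circ>\<^sub>p L)) \<le> v (Polynomial.coeff g i) + Val (int_mult (int i) \<delta>)" for g i
  proof (induction g arbitrary: i)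
    case (pCons a g)
    let ?f = "pCons a g \<circ>\<^sub>p L"
    have a: "w (to_fract ?f) \<le> v a" using no_cancel[of ?f] by (simp add: poly_pcompose L_def)
    show ?case
    proof (cases i)
      case 0
      then show ?thesis using a by (simp add: zero_vext_def[symmetric])
    next
      case (Suc j)
      have "w (to_fract ?f) \<le> w (to_fract ?f - to_fract [:a:])" using a by (intro W.v_diff_ge) auto
      also have "to_fract ?f - to_fract [:a:] = to_fract L * to_fract (g \<circ>\<^sub>p L)"
        by (simp add: pcompose_pCons)
      also have "w \<dots> = Val \<delta> + w (to_fract (g \<circ>\<^sub>p L))" using \<beta> by (simp add: L_def)
      also have "\<dots> \<le> Val \<delta> + (v (Polynomial.coeff g j) + Val (int_mult (int j) \<delta>))"
        using pCons.IH by (rule add_left_mono)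
      also have "\<dots> = v (Polynomial.coeff (pCons a g) i) + Val (int_mult (int i) \<delta>)"
        using Suc by (cases "v (Polynomial.coeff g j)") (auto simp: int_mult_add algebra_simps)
      finally show ?thesis .
    qed
  qed simp
  have eq: "w (to_fract (g \<circ>\<^sub>p L)) = m g" for g
    by (intro antisym m_ge lower upper m_le)
  have "f \<circ>\<^sub>p [:\<beta>, 1:] \<circ>\<^sub>p L = f" by (simp add: L_def flip: pcompose_assoc) (simp add: pcompose_pCons)
  then have "w (to_fract f) = m (f \<circ>\<^sub>p [:\<beta>, 1:])" using eq by metis
  then show ?thesis by (simp add: m_def monomial_val_poly_def degree_pcompose)
qed

end

text \<open>In f = p h + f(\<beta>) the two summands have different values, as the value of p h is
  not one of \<open>v\<close> when h is nonzero; so w(f) is their minimum.\<close>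

lemma (in key_polynomial) linear_no_cancel:
  assumes p: "p = [:- \<beta>, 1:]"
  shows "w (to_fract f) \<le> v (poly f \<beta>)"
proof (cases "poly f \<beta> = 0")
  case False
  define h where "h = synthetic_div f \<beta>"
  have f: "f = p * h + [:poly f \<beta>:]"
    using synthetic_div_correct'[of \<beta> f] by (simp add: p h_def)
  have "w (to_fract (p * h)) \<noteq> v (poly f \<beta>)"
  proof (cases "h = 0")
    case True
    then show ?thesis using False by (metis mult_zero_right to_fract_0 W.v_0 v_Infty)
  next
    case h: False
    then show ?thesis using poly_asymp[OF h] w_p_mult_neq False by blast
  qed
  then have "w (to_fract (p * h)) < w (to_fract [:poly f \<beta>:]) \<or> w (to_fract [:poly f \<beta>:]) < w (to_fract (p * h))"
    by auto
  then show ?thesis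
    by (subst f) (auto simp: W.v_add_eq simp del: to_fract_mult)
qed simp

section \<open>Gauss valuations\<close>

text \<open>\<open>le_w_eval\<close> is the Gauss formula, that the value of a polynomial in
  \<open>Y\<close> is the least value of its coefficients, expressed through lower bounds.
  \<open>poly_eval\<close> says that K[X] is contained in K[Y].\<close>

locale gauss_extension = rational_extension v w
  for v :: "'a::field \<Rightarrow> 'g::linordered_ab_group_add vext" and w +
  fixes Y :: "'a poly fract"
  assumes le_w_eval: "\<And>g \<gamma>. \<gamma> \<le> w (poly (map_poly const_fract g) Y) \<longleftrightarrow> (\<forall>i. \<gamma> \<le> v (Polynomial.coeff g i))"
    and poly_eval: "\<And>f. \<exists>g. to_fract f = poly (map_poly const_fract g) Y"
begin

definition ev :: "'a poly \<Rightarrow> 'a poly fract" where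
  "ev g = poly (map_poly const_fract g) Y"

lemma ev_simps [simp]: "ev 0 = 0" "ev (pCons a g) = const_fract a + Y * ev g"
  by (simp_all add: ev_def map_poly_pCons)

lemma ev_add: "ev (f + g) = ev f + ev g"
proof -
  have "map_poly const_fract (f + g) = map_poly const_fract f + map_poly const_fract g"
    by (rule poly_eqI) (simp add: coeff_map_poly const_fract_ops)
  then show ?thesis by (simp add: ev_def)
qed

lemma ev_smult: "ev (Polynomial.smult c g) = const_fract c * ev g"
  by (simp add: ev_def map_poly_smult const_fract_ops)

lemma ev_monom: "ev (Polynomial.monom a n) = const_fract a * Y ^ n"
  by (simp add: ev_def map_poly_monom poly_monom)

lemma ev_val_ring: "ev g \<in> val_ring w \<longleftrightarrow> (\<forall>i. Polynomial.coeff g i \<in> val_ring v)"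
  by (simp add: val_ring_def ev_def le_w_eval)

lemma Y_val_ring: "Y \<in> val_ring w"
  using ev_val_ring[of "[:0, 1:]"] by (simp add: coeff_pCons split: nat.split)

lemma w_ev_coeff: "\<exists>i. w (ev g) = v (Polynomial.coeff g i)"
proof -
  let ?A = "(\<lambda>i. v (Polynomial.coeff g i)) ` {..Polynomial.degree g}"
  have "Min ?A \<in> ?A" by (rule Min_in) auto
  then obtain i where i: "Min ?A = v (Polynomial.coeff g i)" by (rule imageE)
  have "Min ?A \<le> v (Polynomial.coeff g j)" for j
  proof (cases "j \<le> Polynomial.degree g")
    case True then show ?thesis by (intro Min_le) auto
  qed (simp add: coeff_eq_0)
  then have "v (Polynomial.coeff g i) \<le> w (ev g)" using le_w_eval[of "Min ?A" g] by (simp add: i ev_def)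
  moreover have "w (ev g) \<le> v (Polynomial.coeff g i)" using le_w_eval[of "w (ev g)" g] by (simp add: ev_def)
  ultimately show ?thesis by (intro exI[of _ i] antisym)
qed

lemma value_group_eq: "value_group w = value_group v"
proof (intro Set.set_eqI iffI)
  fix \<gamma> assume "\<gamma> \<in> value_group w"
  then obtain \<phi> where \<phi>: "w \<phi> = Val \<gamma>" by (auto simp: value_group_def)
  obtain f g where fg: "\<phi> = Fract f g" "g \<noteq> 0" by (cases \<phi>) auto
  obtain a b where a: "w (to_fract f) = v a" and b: "w (to_fract g) = v b" using poly_eval w_ev_coeff by (metis ev_def)
  have "b \<noteq> 0" using b fg(2) by (metis W.v_Infty to_fract_eq_0_iff v_0)
  then have "v (a / b) = Val \<gamma>" using \<phi> w_Fract[OF fg(2), of f] fg(1) a b by (simp add: v_divide_eq)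
  then show "\<gamma> \<in> value_group v" by (auto simp: value_group_def)
next
  fix \<gamma> assume "\<gamma> \<in> value_group v"
  then obtain c where "v c = Val \<gamma>" by (auto simp: value_group_def)
  then have "w (const_fract c) = Val \<gamma>" by simp
  then show "\<gamma> \<in> value_group w" unfolding value_group_def by blast
qed

abbreviation k where "k \<equiv> base_residue_field v w"
abbreviation F where "F \<equiv> residue_field w"

lemma k_eq: "k = (\<lambda>a. residue w (const_fract a)) ` val_ring v"
  by (simp add: base_residue_field_def rat_const_eq)

lemma subring_k: "subring k F"
proof -
  interpret F: field F by (rule W.field_residue_field)
  show ?thesis
  proof (rule F.subringI)
    show "k \<subseteq> carrier F" by (auto simp: k_eq)
    show "\<one>\<^bsub>F\<^esub> \<in> k" by (auto simp: k_eq W.residue_one intro!: image_eqI[of _ _ 1])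
  next
    fix h assume "h \<in> k"
    then obtain a where "a \<in> val_ring v" "h = residue w (const_fract a)" by (auto simp: k_eq)
    moreover have "const_fract (- a) = - const_fract a" using const_fract_ops(2)[of 0 a] by simp
    ultimately show "\<ominus>\<^bsub>F\<^esub> h \<in> k"
      by (auto simp: k_eq W.residue_uminus intro!: image_eqI[of _ _ "- a"])
  next
    fix h1 h2 assume "h1 \<in> k" "h2 \<in> k"
    then obtain a b where "a \<in> val_ring v" "h1 = residue w (const_fract a)" "b \<in> val_ring v" "h2 = residue w (const_fract b)"
      by (auto simp: k_eq)
    then show "h1 \<oplus>\<^bsub>F\<^esub> h2 \<in> k" "h1 \<otimes>\<^bsub>F\<^esub> h2 \<in> k"
      by (auto simp: k_eq W.residue_add W.residue_mult simp flip: const_fract_ops)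
  qed
qed

lemma residue_power: 
  assumes "x \<in> val_ring w"
  shows "x ^ n \<in> val_ring w \<and> residue w x [^]\<^bsub>F\<^esub> n = residue w (x ^ n)"
proof -
  interpret F: field F by (rule W.field_residue_field)
  show ?thesis by (induction n) (use assms in \<open>auto simp: W.residue_one W.residue_mult mult.commute\<close>)
qed

text \<open>Lists evaluated by \<open>ring.eval\<close> begin with the leading coefficient and those
  of \<open>Poly\<close> with the constant one, hence \<open>rev\<close>.\<close>

lemma eval_residue:
  assumes "set as \<subseteq> val_ring v"
  shows "ring.eval F (map (\<lambda>a. residue w (const_fract a)) as) (residue w Y) = residue w (ev (Poly (rev as)))"
  using assms
proof (induction as)
  case Nil
  interpret F: field F by (rule W.field_residue_field)
  show ?case by (simp add: W.residue_zero)
next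
  case (Cons a as)
  interpret F: field F by (rule W.field_residue_field)
  have "Polynomial.coeff (Poly (rev as)) i \<in> val_ring v" for i
    using Cons.prems nth_mem[of i "rev as"] by (cases "i < length as") (auto simp: nth_default_def)
  then have V: "ev (Poly (rev as)) \<in> val_ring w" by (simp add: ev_val_ring)
  have "Poly (rev (a # as)) = Poly (rev as) + Polynomial.monom a (length as)"
    by (simp add: Poly_append monom_altdef)
  then have "ev (Poly (rev (a # as))) = const_fract a * Y ^ length as + ev (Poly (rev as))"
    by (simp only: ev_add ev_monom add.commute)
  then show ?case
    using Cons residue_power[OF Y_val_ring, of "length as"] V
    by (simp add: W.residue_add W.residue_mult)
qed

text \<open>An algebraic relation lifts to a polynomial in \<open>Y\<close> of positive value. By
  the Gauss formula all its coefficients then have positive value, so the leading coefficient of the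
  relation is zero, which the normal form of polynomials forbids.\<close>

lemma transcendental_Y: "ring.transcendental F k (residue w Y)"
proof -
  interpret F: field F by (rule W.field_residue_field)
  have "p = []" if p: "p \<in> carrier (k[X]\<^bsub>F\<^esub>)" "F.eval p (residue w Y) = \<zero>\<^bsub>F\<^esub>" for p
  proof (rule ccontr)
    assume "p \<noteq> []"
    have pol: "polynomial\<^bsub>F\<^esub> k p" using p(1) by (simp add: univ_poly_carrier)
    then have "set p \<subseteq> k" by (rule F.polynomial_incl)
    then have "p \<in> lists ((\<lambda>a. residue w (const_fract a)) ` val_ring v)" by (auto simp: k_eq)
    then obtain as where as: "set as \<subseteq> val_ring v" "p = map (\<lambda>a. residue w (const_fract a)) as"
      unfolding lists_image by auto
    obtain a bs where bs: "as = a # bs" using as(2) \<open>p \<noteq> []\<close> by (cases as) auto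
    have "Polynomial.coeff (Poly (rev as)) i \<in> val_ring v" for i
      using as(1) nth_mem[of i "rev as"] by (cases "i < length as") (auto simp: nth_default_def)
    then have "ev (Poly (rev as)) \<in> val_ring w" by (simp add: ev_val_ring)
    then have "0 < w (ev (Poly (rev as)))" using p(2) eval_residue[OF as(1)] by (simp add: as(2) W.residue_eq_zero_iff)
    also have "w (ev (Poly (rev as))) \<le> v (Polynomial.coeff (Poly (rev as)) (length bs))"
      using le_w_eval[of "w (ev (Poly (rev as)))" "Poly (rev as)"] unfolding ev_def by blast
    also have "Polynomial.coeff (Poly (rev as)) (length bs) = a" by (simp add: bs nth_default_def nth_append)
    finally have "residue w (const_fract a) = \<zero>\<^bsub>F\<^esub>" using as(1) by (simp add: bs W.residue_eq_zero_iff)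
    then show False using pol by (simp add: polynomial_def as(2) bs)
  qed
  moreover have "F.eval [] (residue w Y) = \<zero>\<^bsub>F\<^esub>" by simp
  ultimately have "a_kernel (k[X]\<^bsub>F\<^esub>) F (\<lambda>p. F.eval p (residue w Y)) = {[]}"
    unfolding a_kernel_def' by (auto simp: univ_poly_def)
  then show ?thesis
    using F.trivial_ker_imp_transcendental[OF subring_k, of "residue w Y"] Y_val_ring by (simp add: over_def)
qed

text \<open>A unit is a quotient of two polynomials in \<open>Y\<close> of equal value. After
  rescaling, both are units with coefficients in V, and their residues are polynomials in the
  residue of \<open>Y\<close>.\<close>

lemma purely_transcendental_Y: "residue_field_purely_transcendental_by v w (residue w Y)"
  unfolding residue_field_purely_transcendental_by_def
proof (intro conjI transcendental_Y subset_antisym subsetI)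
  interpret F: field F by (rule W.field_residue_field)
  let ?H = "insert (residue w Y) k"
  show "residue w Y \<in> carrier F" using Y_val_ring by simp
  have "?H \<subseteq> carrier F" using Y_val_ring by (auto simp: k_eq)
  then show "x \<in> carrier F" if "x \<in> generate_field F ?H" for x using that by (rule F.generate_field_in_carrier)
  have gen: "residue w (ev g) \<in> generate_field F ?H" if "\<And>i. Polynomial.coeff g i \<in> val_ring v" for g
    using that
  proof (induction g)
    case 0
    then show ?case using F.zero_in_generate[of ?H] by (simp add: W.residue_zero)
  next
    case (pCons a g)
    have g: "Polynomial.coeff g i \<in> val_ring v" for i using pCons.prems[of "Suc i"] by simp
    have a: "a \<in> val_ring v" using pCons.prems[of 0] by simp
    have "ev g \<in> val_ring w" using g by (simp add: ev_val_ring)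
    then have "residue w (ev (pCons a g)) = residue w (const_fract a) \<oplus>\<^bsub>F\<^esub> residue w Y \<otimes>\<^bsub>F\<^esub> residue w (ev g)"
      using a Y_val_ring by (simp add: W.residue_add W.residue_mult)
    then show ?case using pCons.IH[OF g] a
      by (auto simp: k_eq intro!: generate_field.eng_add generate_field.eng_mult intro: generate_field.incl)
  qed
  fix x assume "x \<in> carrier F"
  then obtain \<phi> where \<phi>: "\<phi> \<in> val_ring w" "x = residue w \<phi>" by (auto simp: W.residue_carrier)
  show "x \<in> generate_field F ?H"
  proof (cases "w \<phi> = 0")
    case False
    then have "x = \<zero>\<^bsub>F\<^esub>" using \<phi> by (simp add: W.residue_eq_zero_iff val_ring_def)
    then show ?thesis using F.zero_in_generate by simp
  next
    case True
    obtain f g where fg: "\<phi> = Fract f g" "g \<noteq> 0" by (cases \<phi>) auto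
    obtain f' where f': "to_fract f = ev f'" using poly_eval by (metis ev_def)
    obtain g' where g': "to_fract g = ev g'" using poly_eval by (metis ev_def)
    have \<phi>_eq: "\<phi> = ev f' / ev g'" using fg by (simp add: Fract_conv_to_fract f' g')
    have nz: "ev g' \<noteq> 0" using fg(2) g' by (metis to_fract_eq_0_iff)
    have eq: "w (ev f') = w (ev g')" using True W.v_divide_iff(3)[OF nz] by (simp add: \<phi>_eq)
    obtain c where c: "w (ev g') = v c" using w_ev_coeff by blast
    then have c0: "c \<noteq> 0" using nz by (metis W.v_Infty v_0)
    \<comment> \<open>The common value of both polynomials is that of a coefficient c, so dividing
      by c makes both of value zero.\<close>
    define f1 g1 where "f1 = Polynomial.smult (inverse c) f'" "g1 = Polynomial.smult (inverse c) g'"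
    have w1: "w (ev f1) = 0" "w (ev g1) = 0"
      using eq c v_inverse[OF c0] by (simp_all add: f1_g1_def ev_smult)
    have nz1: "ev g1 \<noteq> 0" using w1 by auto
    have "const_fract (inverse c) \<noteq> 0" using c0 by simp
    then have "\<phi> = ev f1 * inverse (ev g1)" by (simp add: \<phi>_eq f1_g1_def ev_smult divide_inverse)
    moreover have V: "ev f1 \<in> val_ring w" "ev g1 \<in> val_ring w" using w1 by (auto simp: val_ring_def)
    moreover have "inverse (ev g1) \<in> val_ring w" using W.v_inverse[OF nz1] w1 by (simp add: val_ring_def)
    ultimately have x: "x = residue w (ev f1) \<otimes>\<^bsub>F\<^esub> inv\<^bsub>F\<^esub> residue w (ev g1)"
      by (simp add: \<phi>(2) W.residue_inverse w1 W.residue_mult)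
    have "residue w (ev g1) \<noteq> \<zero>\<^bsub>F\<^esub>" using V w1 by (simp add: W.residue_eq_zero_iff)
    then show ?thesis unfolding x using V
      by (intro generate_field.eng_mult generate_field.m_inv gen) (auto simp: ev_val_ring)
  qed
qed

end

section \<open>The valuation of a pseudo-monotone sequence\<close>

context valued_field
begin

section \<open>Gauges, pseudo-limits and tails of the three types of sequences\<close>

lemma stationary_not_convergent: "pseudo_stationary v s \<Longrightarrow> \<not> pseudo_convergent v s"
  and stationary_not_divergent: "pseudo_stationary v s \<Longrightarrow> \<not> pseudo_divergent v s"
  and divergent_not_convergent: "pseudo_divergent v s \<Longrightarrow> \<not> pseudo_convergent v s"
  for s :: "'i::{wellorder,no_top} \<Rightarrow> 'f"
proof -
  obtain \<nu> \<rho> \<sigma> :: 'i where i: "\<nu> < \<rho>" "\<rho> < \<sigma>" using gt_ex by meson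
  { assume "pseudo_stationary v s"
    then have "v (s \<rho> - s \<nu>) = v (s \<sigma> - s \<rho>)"
      using i unfolding pseudo_stationary_def by (metis order_less_irrefl)
    then show "\<not> pseudo_convergent v s" "\<not> pseudo_divergent v s"
      using i unfolding pseudo_convergent_def pseudo_divergent_def by (metis order_less_irrefl)+ }
  assume "pseudo_divergent v s"
  then show "\<not> pseudo_convergent v s"
    using i unfolding pseudo_convergent_def pseudo_divergent_def by (meson order_less_asym)
qed

lemma stationary_value_eq:
  fixes s :: "'i::{wellorder,no_top} \<Rightarrow> 'f"
  assumes "pseudo_stationary v s" "\<nu> \<noteq> \<mu>"
  shows "stationary_value v s = v (s \<nu> - s \<mu>)"
  unfolding stationary_value_def
  by (rule the_equality) (use assms in \<open>unfold pseudo_stationary_def, blast+\<close>)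

lemma stationary_value_Val:
  fixes s :: "'i::{wellorder,no_top} \<Rightarrow> 'f"
  assumes "pseudo_stationary v s"
  obtains \<delta> where "stationary_value v s = Val \<delta>"
proof -
  obtain \<nu> \<mu> :: 'i where \<nu>: "\<nu> \<noteq> \<mu>" using gt_ex less_imp_neq by metis
  have "v (s \<nu> - s \<mu>) \<noteq> Infty" using assms \<nu> unfolding pseudo_stationary_def by blast
  moreover have "stationary_value v s = v (s \<nu> - s \<mu>)" by (rule stationary_value_eq[OF assms \<nu>])
  ultimately show thesis using that by (cases "v (s \<nu> - s \<mu>)") auto
qed

lemma gauge_stationary: "pseudo_stationary v s \<Longrightarrow> gauge v s \<nu> = stationary_value v s"
  by (simp add: gauge_def stationary_not_convergent stationary_not_divergent)

lemma pseudo_divergent_const: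
  fixes s :: "'i::{wellorder,no_top} \<Rightarrow> 'f"
  assumes "pseudo_divergent v s" "\<rho> < \<nu>" "\<rho>' < \<nu>"
  shows "v (s \<rho>' - s \<nu>) = v (s \<rho> - s \<nu>)"
proof -
  have *: "v (s \<rho>' - s \<nu>) = v (s \<rho> - s \<nu>)" if "\<rho> < \<nu>" "\<rho>' < \<rho>" for \<rho> \<rho>'
  proof -
    have "v (s \<nu> - s \<rho>) < v (s \<rho> - s \<rho>')" using assms that by (auto simp: pseudo_divergent_def)
    from v_add_eq(1)[OF this] show ?thesis by (simp add: v_minus_commute)
  qed
  show ?thesis using *[of \<rho> \<rho>'] *[of \<rho>' \<rho>] assms by (metis linorder_neqE)
qed

lemma gauge_divergent:
  fixes s :: "'i::{wellorder,no_top} \<Rightarrow> 'f"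
  assumes "pseudo_divergent v s" "\<rho> < \<nu>"
  shows "gauge v s \<nu> = v (s \<rho> - s \<nu>)"
proof -
  have "(SOME \<rho>. \<rho> < \<nu>) < \<nu>" using assms by (metis someI)
  then show ?thesis using assms pseudo_divergent_const by (simp add: gauge_def divergent_not_convergent)
qed

text \<open>Pseudo-limits in K exist here, so the minimal degree in \<open>P_E\<close> will be
  one.\<close>

lemma divergent_pseudo_limit:
  fixes s :: "'i::{wellorder,no_top} \<Rightarrow> 'f"
  assumes "pseudo_divergent v s"
  shows "s \<rho> \<in> pseudo_limits v s"
  unfolding pseudo_limits_def mem_Collect_eq
  by (rule eventually_mono[OF eventually_gt_at_top[of \<rho>]]) (simp add: gauge_divergent[OF assms])

lemma stationary_pseudo_limit:
  fixes s :: "'i::{wellorder,no_top} \<Rightarrow> 'f"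
  assumes "pseudo_stationary v s"
  shows "s \<rho> \<in> pseudo_limits v s"
  unfolding pseudo_limits_def mem_Collect_eq
  by (rule eventually_mono[OF eventually_gt_at_top[of \<rho>]])
    (simp add: gauge_stationary[OF assms] stationary_value_eq[OF assms order.strict_implies_not_eq])

text \<open>In a divergent sequence the first two terms may coincide, so finiteness of v(s \<nu> - s
  \<mu>) needs an index below \<mu>. A value attained at most at the least index is avoided by the
  tail beyond it.\<close>

lemma pseudo_monotone_eventually_neq:
  fixes s :: "'i::{wellorder,no_top} \<Rightarrow> 'f"
  assumes "pseudo_monotone v s"
  shows "\<forall>\<^sub>F \<nu> in at_top. s \<nu> \<noteq> a"
proof (cases "\<exists>\<mu>. s \<mu> = a \<and> (\<exists>\<kappa>. \<kappa> < \<mu>)")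
  case True
  then obtain \<mu> \<kappa> where \<mu>: "s \<mu> = a" "\<kappa> < \<mu>" by blast
  have "s \<nu> \<noteq> a" if \<nu>: "\<mu> < \<nu>" for \<nu>
  proof
    assume "s \<nu> = a"
    then have "v (s \<nu> - s \<mu>) = Infty" using \<mu> by simp
    moreover have "v (s \<nu> - s \<mu>) \<noteq> Infty" 
      using assms unfolding pseudo_monotone_def
    proof (elim disjE)
      assume "pseudo_convergent v s" then show ?thesis using pseudo_convergent_finite \<nu> by blast
    next
      assume "pseudo_divergent v s"
      then have "v (s \<nu> - s \<mu>) < v (s \<mu> - s \<kappa>)" using \<mu> \<nu> by (auto simp: pseudo_divergent_def)
      then show ?thesis by auto
    next
      assume "pseudo_stationary v s" then show ?thesis using \<nu> by (auto simp: pseudo_stationary_def)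
    qed
    ultimately show False by simp
  qed
  then show ?thesis by (intro eventually_mono[OF eventually_gt_at_top[of \<mu>]])
next
  case False
  have "\<forall>\<^sub>F \<nu> in at_top. (LEAST \<nu>::'i. True) < \<nu>" by (rule eventually_gt_at_top)
  then show ?thesis by eventually_elim (use False in blast)
qed

lemma eventually_poly_nonzero:
  fixes s :: "'i::{wellorder,no_top} \<Rightarrow> 'f"
  assumes "pseudo_monotone v s" "g \<noteq> 0"
  shows "\<forall>\<^sub>F \<nu> in at_top. poly g (s \<nu>) \<noteq> 0"
proof -
  have "\<forall>\<^sub>F \<nu> in at_top. \<forall>a\<in>{x. poly g x = 0}. s \<nu> \<noteq> a"
    using assms by (intro eventually_ball_finite poly_roots_finite ballI pseudo_monotone_eventually_neq)
  then show ?thesis by eventually_elim auto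
qed

text \<open>Over the residue field this says that a nonzero polynomial has at most as many roots as its
  degree.\<close>

lemma many_large_values:
  assumes "\<And>x y. x \<in> S \<Longrightarrow> y \<in> S \<Longrightarrow> x \<noteq> y \<Longrightarrow> v (x - y) = Val \<delta>" "\<And>x. x \<in> S \<Longrightarrow> v (x - \<beta>) = Val \<delta>"
    and "finite S" "Polynomial.degree f < card S" "\<And>x. x \<in> S \<Longrightarrow> \<gamma> < v (poly f x)"
  shows "\<gamma> < v (poly f \<beta>)"
  using assms
proof (induction "Polynomial.degree f" arbitrary: f S \<gamma> rule: less_induct)
  case less
  obtain x where x: "x \<in> S" using less.prems(4) by fastforce
  define h where "h = synthetic_div f x"
  have f: "poly f y = (y - x) * poly h y + poly f x" for y
  proof -
    have "poly ([:- x, 1:] * h + [:poly f x:]) y = poly f y" unfolding h_def synthetic_div_correct' ..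
    then show ?thesis by (simp add: algebra_simps)
  qed
  show ?case
  proof (cases "Polynomial.degree f = 0")
    case True
    then obtain a where "f = [:a:]" by (rule degree_eq_zeroE)
    then show ?thesis using less.prems(5)[OF x] by simp
  next
    case False
    \<comment> \<open>Dividing f - f(x) by the linear factor at x shifts the bound by \<delta>,
      since every other point of \<open>S\<close> and also \<beta> are at distance \<delta> from x;
      the degree and the number of points both drop by one.\<close>
    have "\<gamma> - Val \<delta> < v (poly h \<beta>)"
    proof (rule less.hyps[where S = "S - {x}"])
      show "Polynomial.degree h < Polynomial.degree f" using False by (simp add: h_def degree_synthetic_div)
      show "Polynomial.degree h < card (S - {x})"
        using False less.prems(3,4) x by (simp add: h_def degree_synthetic_div)
      fix y assume y: "y \<in> S - {x}"
      have "\<gamma> < v (poly f y - poly f x)" using less.prems(5) x y by (intro v_diff_gt) auto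
      then have "\<gamma> < Val \<delta> + v (poly h y)" using f[of y] less.prems(1) x y by simp
      then show "\<gamma> - Val \<delta> < v (poly h y)"
        by (cases \<gamma>; cases "v (poly h y)") (auto simp: algebra_simps)
    qed (use less.prems in auto)
    then have "\<gamma> < v ((\<beta> - x) * poly h \<beta>)"
      using less.prems(2)[OF x] unfolding v_mult v_minus_commute[of \<beta>]
      by (cases \<gamma>; cases "v (poly h \<beta>)") (auto simp: algebra_simps)
    then show ?thesis using v_add_gt less.prems(5)[OF x] f[of \<beta>] by metis
  qed
qed

text \<open>On the tail where s \<nu> is at distance \<delta> from \<beta>, more than deg f
  exceptional indices would give v(f(\<beta>)) < v(f(\<beta>)) by \<open>many_large_values\<close>.
  A finite set of indices is bounded, so a later tail has no exceptions.\<close>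

lemma stationary_eventually_le:
  fixes s :: "'i::{wellorder,no_top} \<Rightarrow> 'f"
  assumes s: "pseudo_stationary v s" and \<beta>: "\<beta> \<in> pseudo_limits v s"
  shows "\<forall>\<^sub>F \<nu> in at_top. v (poly f (s \<nu>)) \<le> v (poly f \<beta>)"
proof -
  obtain \<delta> where \<delta>: "stationary_value v s = Val \<delta>" by (rule stationary_value_Val[OF s])
  obtain N where N: "\<And>\<nu>. N \<le> \<nu> \<Longrightarrow> v (s \<nu> - \<beta>) = Val \<delta>"
    using \<beta> by (auto simp: pseudo_limits_def eventually_at_top_linorder gauge_stationary[OF s] \<delta> v_minus_commute)
  let ?B = "{\<nu>\<in>{N..}. v (poly f \<beta>) < v (poly f (s \<nu>))}"
  have inj: "inj s"
    using s by (auto simp: inj_def pseudo_stationary_def)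
  have "finite ?B"
  proof (rule ccontr)
    assume "infinite ?B"
    then obtain B where B: "B \<subseteq> ?B" "finite B" "card B = Suc (Polynomial.degree f)"
      using infinite_arbitrarily_large by blast
    have "v (poly f \<beta>) < v (poly f \<beta>)"
    proof (rule many_large_values[where S = "s ` B" and \<delta> = \<delta>])
      show "Polynomial.degree f < card (s ` B)" using B(3) inj by (simp add: card_image inj_on_subset)
      show "finite (s ` B)" using B(2) by simp
      show "v (x - y) = Val \<delta>" if "x \<in> s ` B" "y \<in> s ` B" "x \<noteq> y" for x y
        using that stationary_value_eq[OF s] \<delta> by (metis imageE)
    qed (use B(1) N in auto)
    then show False by simp
  qed
  then have "\<forall>\<nu>\<in>?B. \<nu> \<le> Max (insert N ?B)" by (intro ballI Max_ge) auto
  then obtain M where M: "\<And>\<nu>. \<nu> \<in> ?B \<Longrightarrow> \<nu> \<le> M" by blast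
  show ?thesis
    using eventually_gt_at_top[of "max N M"]
  proof eventually_elim
    case (elim \<nu>)
    then have "\<nu> \<notin> ?B" using M[of \<nu>] by auto
    then show ?case using elim by auto
  qed
qed

end

section \<open>Comparing values of \<open>w\<close> along tails of the sequence\<close>

locale sequence_valuation = rational_extension v w
  for v :: "'a::field \<Rightarrow> 'g::linordered_ab_group_add vext" and w +
  fixes s :: "'i::{wellorder,no_top} \<Rightarrow> 'a"
  assumes pseudo_monotone: "pseudo_monotone v s"
    and val_ring_w: "val_ring w = V_E v s"
begin

text \<open>On a tail g has no zero, and any representation of f/g that can be evaluated there gives
  the same quotient, so the existential in \<open>V_E\<close> becomes a comparison of
  values.\<close>

lemma w_le_iff:
  assumes "g \<noteq> 0"
  shows "w (to_fract g) \<le> w (to_fract f) \<longleftrightarrow> (\<forall>\<^sub>F \<nu> in at_top. v (poly g (s \<nu>)) \<le> v (poly f (s \<nu>)))"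
proof -
  have "w (to_fract g) \<le> w (to_fract f) \<longleftrightarrow> Fract f g \<in> V_E v s"
    using assms W.v_divide_iff(1)[of "to_fract g" "to_fract f"]
    by (simp add: Fract_conv_to_fract val_ring_def flip: val_ring_w)
  also have "\<dots> \<longleftrightarrow> (\<forall>\<^sub>F \<nu> in at_top. v (poly g (s \<nu>)) \<le> v (poly f (s \<nu>)))"
    unfolding V_E_def mem_Collect_eq
  proof (rule eventually_cong[OF eventually_poly_nonzero[OF pseudo_monotone assms]])
    fix \<nu> assume nz: "poly g (s \<nu>) \<noteq> 0"
    have "poly f' (s \<nu>) / poly g' (s \<nu>) = poly f (s \<nu>) / poly g (s \<nu>)"
      if eq: "Fract f g = Fract f' g'" and g': "poly g' (s \<nu>) \<noteq> 0" for f' g'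
    proof -
      have "g' \<noteq> 0" using g' by auto
      then have "f * g' = f' * g" using eq assms by (simp add: eq_fract)
      then have "poly f (s \<nu>) * poly g' (s \<nu>) = poly f' (s \<nu>) * poly g (s \<nu>)" by (metis poly_mult)
      then show ?thesis using nz g' by (simp add: field_simps)
    qed
    then have "(\<exists>f' g'. Fract f g = Fract f' g' \<and> poly g' (s \<nu>) \<noteq> 0 \<and>
        poly f' (s \<nu>) / poly g' (s \<nu>) \<in> val_ring v) \<longleftrightarrow> poly f (s \<nu>) / poly g (s \<nu>) \<in> val_ring v"
      using nz by metis
    then show "(\<exists>f' g'. Fract f g = Fract f' g' \<and> poly g' (s \<nu>) \<noteq> 0 \<and>
        poly f' (s \<nu>) / poly g' (s \<nu>) \<in> val_ring v) \<longleftrightarrow> v (poly g (s \<nu>)) \<le> v (poly f (s \<nu>))"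
      using nz by (simp add: val_ring_def v_divide_iff)
  qed
  finally show ?thesis .
qed

lemma w_const_iff:
  assumes "c \<noteq> 0" "f \<noteq> 0"
  shows "w (to_fract f) = v c \<longleftrightarrow> (\<forall>\<^sub>F \<nu> in at_top. v (poly f (s \<nu>)) = v c)"
proof -
  have "w (to_fract f) \<le> v c \<longleftrightarrow> (\<forall>\<^sub>F \<nu> in at_top. v (poly f (s \<nu>)) \<le> v c)"
    "v c \<le> w (to_fract f) \<longleftrightarrow> (\<forall>\<^sub>F \<nu> in at_top. v c \<le> v (poly f (s \<nu>)))"
    using w_le_iff[OF assms(2), of "[:c:]"] w_le_iff[of "[:c:]" f] assms(1) by simp_all
  then show ?thesis by (simp add: order_eq_iff eventually_conj_iff)
qed

text \<open>A strict inequality of \<open>w\<close> is reached by negation: the reverse weak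
  inequality would hold on a tail and contradict the hypothesis there. The case f = g is split off
  because \<open>w_le_iff\<close> needs f - g nonzero.\<close>

lemma asymp_lift:
  assumes "\<forall>\<^sub>F \<nu> in at_top. poly f (s \<nu>) \<approx> poly g (s \<nu>)"
  shows "W.asymp (to_fract f) (to_fract g)"
proof -
  have "\<forall>\<^sub>F \<nu> in at_top. poly g (s \<nu>) \<noteq> 0" using assms by eventually_elim (rule asymp_nz)
  then have g: "g \<noteq> 0" using trivial_limit_at_top_linorder by auto
  show ?thesis
  proof (cases "f = g")
    case True
    with g show ?thesis by (simp add: W.asymp_refl)
  next
    case False
    have "\<not> w (to_fract (f - g)) \<le> w (to_fract g)"
    proof
      assume "w (to_fract (f - g)) \<le> w (to_fract g)"
      then have "\<forall>\<^sub>F \<nu> in at_top. v (poly (f - g) (s \<nu>)) \<le> v (poly g (s \<nu>))" using False by (subst w_le_iff[symmetric]) simp_all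
      then have "\<forall>\<^sub>F \<nu> :: 'i in at_top. False" using assms by eventually_elim (auto simp: asymp_def)
      then show False using trivial_limit_at_top_linorder by simp
    qed
    then show ?thesis by (simp add: W.asymp_def)
  qed
qed

text \<open>Equality with v(c) would make the values of f^n constant on a tail, and with them those
  of f, as v(x^n) determines v(x) for n > 0.\<close>

lemma p_torsion_freeI:
  assumes "f \<noteq> 0" "n > 0" and mono: "\<forall>\<^sub>F \<mu> in at_top. \<forall>\<nu>>\<mu>. v (poly f (s \<mu>)) \<noteq> v (poly f (s \<nu>))"
  shows "w (to_fract f ^ n) \<noteq> v c"
proof
  assume eq: "w (to_fract f ^ n) = v c"
  have "w (to_fract f ^ n) \<noteq> Infty" using assms(1) by simp
  then have c: "c \<noteq> 0" unfolding eq by simp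
  have pow: "to_fract (f ^ n) = to_fract f ^ n" by (induction n) auto
  then have "\<forall>\<^sub>F \<nu> in at_top. v (poly (f ^ n) (s \<nu>)) = v c"
    using w_const_iff[OF c, of "f ^ n"] assms(1) eq by (simp add: pow)
  then have "\<forall>\<^sub>F \<mu> in at_top. (\<forall>\<nu>\<ge>\<mu>. v (poly (f ^ n) (s \<nu>)) = v c) \<and> (\<forall>\<nu>>\<mu>. v (poly f (s \<mu>)) \<noteq> v (poly f (s \<nu>)))"
    using mono by (intro eventually_conj eventually_all_ge_at_top)
  then obtain \<mu> where \<mu>: "\<And>\<nu>. \<mu> \<le> \<nu> \<Longrightarrow> v (poly f (s \<nu>) ^ n) = v c" "\<And>\<nu>. \<mu> < \<nu> \<Longrightarrow> v (poly f (s \<mu>)) \<noteq> v (poly f (s \<nu>))"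
    using eventually_happens'[OF trivial_limit_at_top_linorder] by fastforce
  obtain \<nu> where "\<mu> < \<nu>" using gt_ex by blast
  then show False using \<mu> v_power_eq_imp[OF assms(2), of "poly f (s \<mu>)" "poly f (s \<nu>)"] by (metis order_refl less_imp_le)
qed

lemma P_E_degree_pos: "p \<in> P_E v s \<Longrightarrow> Polynomial.degree p > 0"
  by (auto simp: P_E_def Factorial_Ring.irreducible_def is_unit_iff_degree)

lemma P_E_min_degree: "p \<in> P_E_min v s \<Longrightarrow> q \<in> P_E_min v s \<Longrightarrow> Polynomial.degree p = Polynomial.degree q"
  by (auto simp: P_E_min_def intro: order_antisym)

text \<open>For elements of K, being a pseudo-limit does not depend on the extension; that an
  extension exists at all gives the direction from right to left.\<close>

lemma linear_in_P_E: "[:- \<beta>, 1:] \<in> P_E v s \<longleftrightarrow> \<beta> \<in> pseudo_limits v s"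
proof -
  have root: "poly (map_poly to_ac [:- \<beta>, 1:]) \<alpha> = 0 \<longleftrightarrow> \<alpha> = to_ac \<beta>" for \<alpha>
    by (auto simp: map_poly_pCons add_eq_0_iff algebra_simps)
  have lim: "closure_pseudo_limit v U s (to_ac \<beta>) \<longleftrightarrow> \<beta> \<in> pseudo_limits v s" if "extends_to_closure v U" for U
  proof -
    interpret closure_extension v U using that by unfold_locales
    show ?thesis by (rule closure_pseudo_limit_to_ac)
  qed
  show ?thesis
    using exists_extends_to_closure lim unfolding P_E_def mem_Collect_eq root
    by (auto simp: irreducible_linear_field_poly)
qed

lemma P_E_min_linear:
  assumes "\<beta> \<in> pseudo_limits v s"
  shows "p \<in> P_E_min v s \<longleftrightarrow> (\<exists>\<alpha>\<in>pseudo_limits v s. p = [:- \<alpha>, 1:])"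
proof
  assume p: "p \<in> P_E_min v s"
  then have "Polynomial.degree p \<le> Polynomial.degree [:- \<beta>, 1:]"
    using linear_in_P_E[of \<beta>] assms unfolding P_E_min_def by blast
  moreover have "Polynomial.degree p > 0" using p P_E_degree_pos by (simp add: P_E_min_def)
  ultimately have "Polynomial.degree p = 1" by simp
  then obtain a b where "p = [:a, b:]" "b \<noteq> 0" by (rule degree1_coeffs)
  moreover have "Polynomial.lead_coeff p = 1" using p by (simp add: P_E_min_def P_E_def)
  ultimately have "p = [:- (- a), 1:]" by simp
  moreover have "- a \<in> pseudo_limits v s"
    using linear_in_P_E[of "- a"] p calculation by (simp add: P_E_min_def)
  ultimately show "\<exists>\<alpha>\<in>pseudo_limits v s. p = [:- \<alpha>, 1:]" by blast
next
  assume "\<exists>\<alpha>\<in>pseudo_limits v s. p = [:- \<alpha>, 1:]"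
  then obtain \<alpha> where \<alpha>: "[:- \<alpha>, 1:] \<in> P_E v s" "p = [:- \<alpha>, 1:]" using linear_in_P_E by blast
  moreover have "Polynomial.degree [:- \<alpha>, 1:] \<le> Polynomial.degree q" if "q \<in> P_E v s" for q
    using P_E_degree_pos[OF that] by simp
  ultimately show "p \<in> P_E_min v s" unfolding P_E_min_def by blast
qed

lemma asymp_lift_const:
  assumes "\<forall>\<^sub>F \<mu> in at_top. \<forall>\<nu>>\<mu>. poly f (s \<nu>) \<approx> poly f (s \<mu>)"
  shows "\<exists>c. W.asymp (to_fract f) (const_fract c)"
proof -
  obtain \<mu> where "\<And>\<nu>. \<mu> < \<nu> \<Longrightarrow> poly f (s \<nu>) \<approx> poly [:poly f (s \<mu>):] (s \<nu>)"
    using eventually_happens'[OF trivial_limit_at_top_linorder assms] by auto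
  then have "\<forall>\<^sub>F \<nu> in at_top. poly f (s \<nu>) \<approx> poly [:poly f (s \<mu>):] (s \<nu>)"
    by (intro eventually_mono[OF eventually_gt_at_top[of \<mu>]])
  from asymp_lift[OF this] show ?thesis unfolding const_fract_def by blast
qed

text \<open>A pseudo-limit among the roots of f would make v(f(s \<nu>)) strictly increasing on a
  tail, not eventually constant. So every nonzero polynomial is asymptotic to a constant; for X -
  \<beta> this also excludes pseudo-limits in K.\<close>

lemma immediate_transcendental:
  assumes "pc_transcendental v s"
  shows "immediate v w" "pseudo_limits v s = {}"
proof -
  obtain U where U: "extends_to_closure v U" using exists_extends_to_closure by blast
  interpret closure_extension v U using U by unfold_locales
  have pc: "pseudo_convergent v s" using assms by (simp add: pc_transcendental_def)
  have no_root: "\<not> limit_root s f" if "f \<noteq> 0" for f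
  proof
    assume "limit_root s f"
    note inc = limit_root_increasing[OF pc that this]
    obtain c where "\<forall>\<^sub>F \<nu> in at_top. v (poly f (s \<nu>)) = c"
      using assms by (auto simp: pc_transcendental_def)
    then have "\<forall>\<^sub>F \<mu> in at_top. (\<forall>\<nu>\<ge>\<mu>. v (poly f (s \<nu>)) = c) \<and> (\<forall>\<nu>>\<mu>. v (poly f (s \<mu>)) < v (poly f (s \<nu>)))"
      using inc by (intro eventually_conj eventually_all_ge_at_top)
    then obtain \<mu> where \<mu>: "\<And>\<nu>. \<mu> \<le> \<nu> \<Longrightarrow> v (poly f (s \<nu>)) = c"
      "\<And>\<nu>. \<mu> < \<nu> \<Longrightarrow> v (poly f (s \<mu>)) < v (poly f (s \<nu>))"
      using eventually_happens'[OF trivial_limit_at_top_linorder] by blast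
    obtain \<nu> where "\<mu> < \<nu>" using gt_ex by blast
    then show False using \<mu>(1)[of \<mu>] \<mu>(1)[of \<nu>] \<mu>(2)[of \<nu>] by simp
  qed
  show "immediate v w"
    by (intro asymp_const_values asymp_lift_const no_limit_root_asymp[OF pc] no_root)
  show "pseudo_limits v s = {}"
  proof (rule ccontr)
    assume "pseudo_limits v s \<noteq> {}"
    then obtain \<beta> where "closure_pseudo_limit v U s (to_ac \<beta>)" using closure_pseudo_limit_to_ac by blast
    then have "limit_root s [:- \<beta>, 1:]" by (auto simp: limit_root_def map_poly_pCons)
    then show False using no_root by simp
  qed
qed

section \<open>Divergent sequences and convergent ones that are not of transcendental type\<close>

lemma key_polynomialI:
  assumes "\<not> pc_transcendental v s" "\<not> pseudo_stationary v s" "p \<in> P_E_min v s" "w (to_fract p) = Val \<Delta>"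
  shows "key_polynomial v w p \<Delta>"
proof -
  have p: "p \<in> P_E v s" using assms(3) by (simp add: P_E_min_def)
  have deg: "Polynomial.degree p > 0" by (rule P_E_degree_pos[OF p])
  then have p0: "p \<noteq> 0" by auto
  consider "pseudo_convergent v s" | "pseudo_divergent v s"
    using assms(2) pseudo_monotone by (auto simp: pseudo_monotone_def)
  then have "(\<forall>f. f \<noteq> 0 \<longrightarrow> Polynomial.degree f < Polynomial.degree p \<longrightarrow> (\<exists>c. W.asymp (to_fract f) (const_fract c))) \<and>
    (\<forall>\<^sub>F \<mu> in at_top. \<forall>\<nu>>\<mu>. v (poly p (s \<mu>)) \<noteq> v (poly p (s \<nu>)))"
  proof cases
    case 1
    \<comment> \<open>This extension is the one witnessing that p is in \<open>P_E\<close>, so p has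
      a pseudo-limit root with respect to it; minimality excludes such roots for polynomials of
      smaller degree.\<close>
    obtain U where U: "closure_extension v U" "closure_extension.limit_root v U s p"
      by (rule P_E_limit_root[OF valuation p])
    interpret closure_extension v U by (rule U)
    have "\<forall>\<^sub>F \<mu> in at_top. \<forall>\<nu>>\<mu>. v (poly p (s \<mu>)) \<noteq> v (poly p (s \<nu>))"
      using limit_root_increasing[OF 1 p0 U(2)] by eventually_elim (metis order_less_irrefl)
    then show ?thesis
      using P_E_min_no_limit_root[OF assms(3)] no_limit_root_asymp[OF 1] by (auto intro: asymp_lift_const)
  next
    case 2
    obtain \<beta> where \<beta>: "\<beta> \<in> pseudo_limits v s" using divergent_pseudo_limit[OF 2] by blast
    then obtain \<alpha> where \<alpha>: "\<alpha> \<in> pseudo_limits v s" "p = [:- \<alpha>, 1:]"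
      using P_E_min_linear assms(3) by blast
    have "\<forall>\<^sub>F \<nu> in at_top. v (poly p (s \<nu>)) = gauge v s \<nu>"
      using \<alpha>(1) unfolding pseudo_limits_def mem_Collect_eq by eventually_elim (simp add: \<alpha>(2) v_minus_commute)
    \<comment> \<open>The gauge of a divergent sequence is strictly decreasing past the least index,
      where it is unspecified.\<close>
    moreover have "\<forall>\<^sub>F \<mu> in at_top. \<forall>\<nu>>\<mu>. gauge v s \<mu> \<noteq> gauge v s \<nu>"
    proof (rule eventually_mono[OF eventually_gt_at_top])
      fix \<mu> :: 'i assume \<mu>: "(LEAST \<nu>. True) < \<mu>"
      show "\<forall>\<nu>>\<mu>. gauge v s \<mu> \<noteq> gauge v s \<nu>"
      proof (intro allI impI)
        fix \<nu> assume "\<mu> < \<nu>"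
        with \<mu> 2 have "v (s \<nu> - s \<mu>) < v (s \<mu> - s (LEAST \<nu>. True))" unfolding pseudo_divergent_def by blast
        then show "gauge v s \<mu> \<noteq> gauge v s \<nu>"
          using gauge_divergent[OF 2 \<mu>] gauge_divergent[OF 2 \<open>\<mu> < \<nu>\<close>] by (simp add: v_minus_commute)
      qed
    qed
    ultimately have "\<forall>\<^sub>F \<mu> in at_top. (\<forall>\<nu>\<ge>\<mu>. v (poly p (s \<nu>)) = gauge v s \<nu>) \<and>
        (\<forall>\<nu>>\<mu>. gauge v s \<mu> \<noteq> gauge v s \<nu>)"
      by (intro eventually_conj eventually_all_ge_at_top)
    then have "\<forall>\<^sub>F \<mu> in at_top. \<forall>\<nu>>\<mu>. v (poly p (s \<mu>)) \<noteq> v (poly p (s \<nu>))"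
      by eventually_elim (metis order_refl less_imp_le)
    moreover have "\<exists>c. W.asymp (to_fract f) (const_fract c)" if f: "f \<noteq> 0" "Polynomial.degree f < Polynomial.degree p" for f
    proof -
      obtain c where "f = [:c:]" using f(2) degree_eq_zeroE[of f] by (auto simp: \<alpha>(2))
      then show ?thesis using f(1) W.asymp_refl[of "to_fract f"] unfolding const_fract_def by auto
    qed
    ultimately show ?thesis by blast
  qed
  then show ?thesis
    using deg assms(4) p_torsion_freeI[OF p0] by unfold_locales auto
qed

text \<open>If w(p) < w(q), then p - q has value w(p). Both are monic of the same degree, so p - q
  has smaller degree and is asymptotic to a constant; but w(p) is not a value of
  \<open>v\<close>.\<close>

lemma P_E_min_value:
  assumes "\<not> pc_transcendental v s" "\<not> pseudo_stationary v s" "p \<in> P_E_min v s" "q \<in> P_E_min v s"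
  shows "w (to_fract p) = w (to_fract q)"
proof -
  have neq: "w (to_fract f) \<noteq> v c" if f: "f \<in> P_E_min v s" for f c
  proof -
    have "f \<noteq> 0" using f P_E_degree_pos[of f] by (auto simp: P_E_min_def)
    then obtain \<Delta> where "w (to_fract f) = Val \<Delta>" by (cases "w (to_fract f)") auto
    then interpret key_polynomial v w f \<Delta> by (rule key_polynomialI[OF assms(1,2) f])
    show ?thesis using p_torsion_free[of 1 c] by simp
  qed
  have "w (to_fract p) = w (to_fract q)" if less: "w (to_fract p) < w (to_fract q)"
    and p: "p \<in> P_E_min v s" and q: "q \<in> P_E_min v s" for p q
  proof -
    have "p - q \<noteq> 0" using less by auto
    moreover have "Polynomial.degree (p - q) < Polynomial.degree p"
    proof -
      have lc: "Polynomial.lead_coeff p = 1" "Polynomial.lead_coeff q = 1"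
        using p q by (auto simp: P_E_min_def P_E_def)
      have deg: "Polynomial.degree q = Polynomial.degree p" using P_E_min_degree p q by blast
      have "Polynomial.degree (p - q) \<noteq> Polynomial.degree p"
        using lc deg \<open>p - q \<noteq> 0\<close> by (metis coeff_diff diff_self leading_coeff_0_iff)
      moreover have "Polynomial.degree (p - q) \<le> Polynomial.degree p" by (rule degree_diff_le) (simp_all add: deg)
      ultimately show ?thesis by simp
    qed
    moreover obtain \<Delta> where "w (to_fract p) = Val \<Delta>" using less by (cases "w (to_fract p)") auto
    ultimately obtain c where "W.asymp (to_fract (p - q)) (const_fract c)"
      using key_polynomial.small_asymp[OF key_polynomialI[OF assms(1,2) p]] by blast
    then have "w (to_fract (p - q)) = v c" using W.asymp_v by fastforce
    moreover have "w (to_fract (p - q)) = w (to_fract p)" using W.v_add_eq(3)[OF less] by simp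
    ultimately show ?thesis using neq[OF p] by metis
  qed
  then show ?thesis using assms(3,4) by (metis linorder_neqE)
qed

section \<open>Stationary sequences and the monomial form of \<open>w\<close>\<close>

lemma linear_value:
  assumes s: "pseudo_stationary v s" and \<beta>: "\<beta> \<in> pseudo_limits v s"
  shows "w (to_fract [:- \<beta>, 1:]) = stationary_value v s"
proof -
  obtain \<nu> \<mu> :: 'i where \<nu>: "\<nu> \<noteq> \<mu>" using gt_ex less_imp_neq by metis
  have val: "stationary_value v s = v (s \<nu> - s \<mu>)" by (rule stationary_value_eq[OF s \<nu>])
  have "v (s \<nu> - s \<mu>) \<noteq> Infty" unfolding val[symmetric] by (rule stationary_value_Val[OF s]) simp
  then have nz: "s \<nu> - s \<mu> \<noteq> 0" by auto
  have "\<forall>\<^sub>F \<kappa> in at_top. v (poly [:- \<beta>, 1:] (s \<kappa>)) = v (s \<nu> - s \<mu>)"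
    using \<beta> by (simp add: pseudo_limits_def gauge_stationary[OF s] val v_minus_commute[of \<beta>])
  then show ?thesis using w_const_iff[OF nz, of "[:- \<beta>, 1:]"] val by simp
qed

lemma stationary_monomial_val_poly:
  assumes s: "pseudo_stationary v s" and \<beta>: "\<beta> \<in> pseudo_limits v s" and \<delta>: "stationary_value v s = Val \<delta>"
  shows "w (to_fract f) = monomial_val_poly v \<beta> \<delta> f"
proof (rule monomial_val_polyI)
  show "w (to_fract [:- \<beta>, 1:]) = Val \<delta>" using linear_value[OF s \<beta>] \<delta> by simp
  fix f show "w (to_fract f) \<le> v (poly f \<beta>)"
  proof (cases "f = 0")
    case False
    then show ?thesis
      using w_le_iff[OF False, of "[:poly f \<beta>:]"] stationary_eventually_le[OF s \<beta>, of f] by simp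
  qed simp
qed

text \<open>Evaluating at Y = (X - \<beta>)/c is composition with a linear polynomial over K, with
  inverse substitution X = \<beta> + c Y. In terms of Y the monomial valuation at \<beta> loses its
  weights.\<close>

lemma gauss_extensionI:
  assumes s: "pseudo_stationary v s" and \<beta>: "\<beta> \<in> pseudo_limits v s" and c: "v c = stationary_value v s"
  shows "gauss_extension v w (Fract [:- \<beta>, 1:] [:c:])"
proof
  obtain \<delta> where \<delta>: "v c = Val \<delta>" using stationary_value_Val[OF s] c by metis
  then have c0: "c \<noteq> 0" by auto
  let ?Y = "Fract [:- \<beta>, 1:] [:c:]"
  have cc: "const_fract c * const_fract (inverse c) = 1"
    using c0 const_fract_ops(3)[of c "inverse c"] by simp
  have "?Y = const_fract (inverse c) * to_fract [:- \<beta>, 1:]"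
    unfolding Fract_conv_to_fract const_fract_def[of c, symmetric] inverse_unique[OF cc, symmetric]
    by (simp add: divide_inverse mult.commute)
  then have Y: "?Y = to_fract [:- \<beta> / c, inverse c:]"
    unfolding const_fract_def to_fract_mult[symmetric] by (simp add: divide_inverse mult.commute)
  have ev: "poly (map_poly const_fract g) ?Y = to_fract (g \<circ>\<^sub>p [:- \<beta> / c, inverse c:])" for g
    unfolding Y
  proof (induction g)
    case (pCons a g)
    then show ?case
      unfolding pcompose_pCons to_fract_add to_fract_mult by (simp add: map_poly_pCons const_fract_def)
  qed simp
  show "\<exists>g. to_fract f = poly (map_poly const_fract g) ?Y" for f
  proof
    show "to_fract f = poly (map_poly const_fract (f \<circ>\<^sub>p [:\<beta>, c:])) ?Y"
      unfolding ev pcompose_assoc[symmetric] using c0 by (simp add: pcompose_pCons)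
  qed
  fix g \<gamma>
  let ?g = "g \<circ>\<^sub>p [:0, inverse c:]"
  \<comment> \<open>The factor c^(-i), which the substitution introduces into the i-th coefficient,
    cancels the weight i\<delta>.\<close>
  have pow: "v (inverse c ^ i) + Val (int_mult (int i) \<delta>) = 0" for i
  proof -
    have "v (c ^ i) = Val (int_mult (int i) \<delta>)" by (rule v_power[OF \<delta>])
    moreover have "v (inverse (c ^ i)) + v (c ^ i) = 0" using c0 by (intro v_inverse) simp
    ultimately show ?thesis by (simp add: power_inverse)
  qed
  have "g \<circ>\<^sub>p [:- \<beta> / c, inverse c:] \<circ>\<^sub>p [:\<beta>, 1:] = ?g"
    unfolding pcompose_assoc[symmetric] using c0 by (simp add: pcompose_pCons divide_inverse)
  then have "w (poly (map_poly const_fract g) ?Y) =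
      Min ((\<lambda>i. v (Polynomial.coeff ?g i) + Val (int_mult (int i) \<delta>)) ` {..Polynomial.degree g})"
    using c0 \<delta> c unfolding ev
    by (subst stationary_monomial_val_poly[OF s \<beta>, of \<delta>]) (simp_all add: monomial_val_poly_def degree_pcompose)
  also have "(\<lambda>i. v (Polynomial.coeff ?g i) + Val (int_mult (int i) \<delta>)) = (\<lambda>i. v (Polynomial.coeff g i))"
    unfolding coeff_pcompose_linear v_mult using pow by (auto simp: add.commute add.left_commute intro!: ext)
  finally have "\<gamma> \<le> w (poly (map_poly const_fract g) ?Y) \<longleftrightarrow> (\<forall>i\<le>Polynomial.degree g. \<gamma> \<le> v (Polynomial.coeff g i))"
    by auto
  also have "\<dots> \<longleftrightarrow> (\<forall>i. \<gamma> \<le> v (Polynomial.coeff g i))"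
  proof (intro iffI allI)
    fix i assume "\<forall>i\<le>Polynomial.degree g. \<gamma> \<le> v (Polynomial.coeff g i)"
    then show "\<gamma> \<le> v (Polynomial.coeff g i)" by (cases "i \<le> Polynomial.degree g") (auto simp: coeff_eq_0)
  qed simp
  finally show "\<gamma> \<le> w (poly (map_poly const_fract g) ?Y) \<longleftrightarrow> (\<forall>i. \<gamma> \<le> v (Polynomial.coeff g i))" .
qed

text \<open>Outside the stationary case, a pseudo-limit \<beta> in K excludes the transcendental
  type and makes X - \<beta> itself a key polynomial, so that cancellation is ruled out by
  \<open>linear_no_cancel\<close>.\<close>

lemma w_eq_monomial_val:
  assumes \<beta>: "\<beta> \<in> pseudo_limits v s" and \<Delta>: "w (to_fract [:- \<beta>, 1:]) = Val \<Delta>"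
  shows "w = monomial_val v \<beta> \<Delta>"
proof (rule monomial_val_unique)
  fix f
  show "w (to_fract f) = monomial_val_poly v \<beta> \<Delta> f"
  proof (cases "pseudo_stationary v s")
    case True
    then show ?thesis using stationary_monomial_val_poly[OF True \<beta>] linear_value[OF True \<beta>] \<Delta> by metis
  next
    case False
    have "\<not> pc_transcendental v s" using immediate_transcendental(2) \<beta> by blast
    moreover have "[:- \<beta>, 1:] \<in> P_E_min v s" using P_E_min_linear[OF \<beta>] \<beta> by blast
    ultimately interpret key_polynomial v w "[:- \<beta>, 1:]" \<Delta>
      using False \<Delta> by (intro key_polynomialI)
    show ?thesis by (intro monomial_val_polyI \<Delta> linear_no_cancel refl)
  qed
qed

end

theorem proposition3p7:
  fixes v :: "'a::field \<Rightarrow> 'g::linordered_ab_group_add vext"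
    and s :: "'i::{wellorder,no_top} \<Rightarrow> 'a"
    and v\<^sub>E :: "'a poly fract \<Rightarrow> 'g vext"
    and \<Delta>\<^sub>E :: 'g
  assumes "valuation v"
    and "pseudo_monotone v s"
    and "is_valuation_of_seq v s v\<^sub>E"
    and "P_E v s \<noteq> {} \<longrightarrow> (\<exists>p \<in> P_E_min v s. v\<^sub>E (Fract p 1) = Val \<Delta>\<^sub>E)"
  shows
    "(pc_algebraic v s \<or> pseudo_divergent v s \<longrightarrow>
        bij_betw (\<lambda>(n, \<gamma>). int_mult n \<Delta>\<^sub>E + \<gamma>) (UNIV \<times> value_group v) (value_group v\<^sub>E) \<and>
        same_residue_field v v\<^sub>E)
     \<and>
     (pc_transcendental v s \<longrightarrow> immediate v v\<^sub>E)
     \<and>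
     (pseudo_stationary v s \<longrightarrow>
        value_group v\<^sub>E = value_group v \<and>
        (\<exists>t. residue_field_purely_transcendental_by v v\<^sub>E t) \<and>
        (\<forall>c. \<forall>\<alpha> \<in> pseudo_limits v s. v c = stationary_value v s \<longrightarrow>
           residue_field_purely_transcendental_by v v\<^sub>E (residue v\<^sub>E (Fract [:- \<alpha>, 1:] [:c:]))))
     \<and>
     (\<not> pc_transcendental v s \<longrightarrow>
        value_group v\<^sub>E = group_closure (insert \<Delta>\<^sub>E (value_group v)) \<and>
        (\<forall>p \<in> P_E_min v s. v\<^sub>E (Fract p 1) = Val \<Delta>\<^sub>E) \<and>
        (pseudo_stationary v s \<longrightarrow> Val \<Delta>\<^sub>E = stationary_value v s))
     \<and>
     (\<forall>\<beta> \<in> pseudo_limits v s. v\<^sub>E = monomial_val v \<beta> \<Delta>\<^sub>E)"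
proof -
  interpret valued_field v using assms(1) by unfold_locales
  interpret sequence_valuation v v\<^sub>E s
    using assms(2,3) by unfold_locales (auto simp: is_valuation_of_seq_def)
  have to_fract_eq: "Fract p 1 = to_fract p" for p :: "'a poly" by (simp add: to_fract_def)
  \<comment> \<open>Algebraic and transcendental type are defined independently, by strict increase
    and by eventual constancy of values; that they exclude each other is derived here.\<close>
  have not_trans: "\<not> pc_transcendental v s"
    if a: "pc_algebraic v s \<or> pseudo_divergent v s \<or> pseudo_stationary v s"
  proof
    assume t: "pc_transcendental v s"
    then have "pseudo_convergent v s" by (simp add: pc_transcendental_def)
    then have "pc_algebraic v s" using a divergent_not_convergent stationary_not_convergent by blast
    then obtain f N where "strict_mono_on {N..} (\<lambda>\<nu>. v (poly f (s \<nu>)))" by (auto simp: pc_algebraic_def)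
    then have inc: "v (poly f (s \<mu>)) < v (poly f (s \<nu>))" if "N \<le> \<mu>" "\<mu> < \<nu>" for \<mu> \<nu>
      using that by (auto simp: strict_mono_on_def)
    obtain c where "\<forall>\<^sub>F \<nu> in at_top. v (poly f (s \<nu>)) = c" using t by (auto simp: pc_transcendental_def)
    then obtain N' where c: "\<And>\<nu>. N' \<le> \<nu> \<Longrightarrow> v (poly f (s \<nu>)) = c" by (auto simp: eventually_at_top_linorder)
    obtain \<nu> where "max N N' < \<nu>" using gt_ex by blast
    then show False using inc[of "max N N'" \<nu>] c[of "max N N'"] c[of \<nu>] by auto
  qed
  have not_stat: "\<not> pseudo_stationary v s" if "pc_algebraic v s \<or> pseudo_divergent v s"
    using that stationary_not_convergent stationary_not_divergent by (auto simp: pc_algebraic_def)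
  have P_E: "P_E v s \<noteq> {}" if "\<not> pc_transcendental v s"
  proof (cases "pseudo_convergent v s")
    case True
    then show ?thesis using that by (rule P_E_nonempty)
  next
    case False
    have "s \<nu> \<in> pseudo_limits v s" for \<nu>
      using False assms(2) divergent_pseudo_limit stationary_pseudo_limit by (auto simp: pseudo_monotone_def)
    then show ?thesis using linear_in_P_E by blast
  qed
  have stat_value: "v\<^sub>E (to_fract p) = stationary_value v s" if "pseudo_stationary v s" "p \<in> P_E_min v s" for p
    using that P_E_min_linear[OF stationary_pseudo_limit] linear_value by metis
  \<comment> \<open>The hypothesis fixes \<open>\<Delta>\<^sub>E\<close> through a single polynomial
    of minimal degree; independence of the choice extends it to all of them.\<close>
  have min_value: "v\<^sub>E (Fract p 1) = Val \<Delta>\<^sub>E" if p: "\<not> pc_transcendental v s" "p \<in> P_E_min v s" for p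
  proof -
    obtain q where "q \<in> P_E_min v s" "v\<^sub>E (to_fract q) = Val \<Delta>\<^sub>E"
      using assms(4) P_E[OF p(1)] by (auto simp: to_fract_eq)
    then show ?thesis using p stat_value P_E_min_value by (metis to_fract_eq)
  qed
  have ex_min: "\<exists>p. p \<in> P_E_min v s" if "\<not> pc_transcendental v s"
    using assms(4) P_E[OF that] by blast
  have key: "\<exists>p. key_polynomial v v\<^sub>E p \<Delta>\<^sub>E" if "\<not> pc_transcendental v s" "\<not> pseudo_stationary v s"
    using ex_min[OF that(1)] key_polynomialI[OF that] min_value[OF that(1)] by (auto simp: to_fract_eq)
  have stat: "Val \<Delta>\<^sub>E = stationary_value v s" if "pseudo_stationary v s"
    using ex_min not_trans stat_value min_value that by (metis to_fract_eq)
  have gauss: "gauss_extension v v\<^sub>E (Fract [:- \<alpha>, 1:] [:c:])"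
    if "pseudo_stationary v s" "\<alpha> \<in> pseudo_limits v s" "v c = stationary_value v s" for \<alpha> c
    using that by (rule gauss_extensionI)
  \<comment> \<open>A difference of two terms serves as c, and any term of the sequence as the
    pseudo-limit. In particular \<open>\<Delta>\<^sub>E\<close> is a value of
    \<open>v\<close>.\<close>
  have ex_gauss: "\<exists>Y c. gauss_extension v v\<^sub>E Y \<and> v c = Val \<Delta>\<^sub>E" if s: "pseudo_stationary v s"
  proof -
    obtain \<nu> \<mu> :: 'i where "\<nu> \<noteq> \<mu>" using gt_ex less_imp_neq by metis
    then have "v (s \<nu> - s \<mu>) = stationary_value v s" using stationary_value_eq[OF s] by metis
    then show ?thesis using gauss s stat stationary_pseudo_limit by metis
  qed
  show ?thesis
  proof (intro conjI impI allI ballI)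
    assume a: "pc_algebraic v s \<or> pseudo_divergent v s"
    then obtain p where "key_polynomial v v\<^sub>E p \<Delta>\<^sub>E" using key not_trans not_stat by blast
    then show "bij_betw (\<lambda>(n, \<gamma>). int_mult n \<Delta>\<^sub>E + \<gamma>) (UNIV \<times> value_group v) (value_group v\<^sub>E)"
      "same_residue_field v v\<^sub>E"
      by (rule key_polynomial.bij_value_group, rule key_polynomial.same_residue)
  next
    assume "pc_transcendental v s"
    then show "immediate v v\<^sub>E" by (rule immediate_transcendental)
  next
    assume s: "pseudo_stationary v s"
    then obtain Y where Y: "gauss_extension v v\<^sub>E Y" using ex_gauss by blast
    then show "value_group v\<^sub>E = value_group v" by (rule gauss_extension.value_group_eq)
    show "\<exists>t. residue_field_purely_transcendental_by v v\<^sub>E t"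
      using gauss_extension.purely_transcendental_Y[OF Y] by blast
    fix c \<alpha> assume "\<alpha> \<in> pseudo_limits v s" "v c = stationary_value v s"
    then show "residue_field_purely_transcendental_by v v\<^sub>E (residue v\<^sub>E (Fract [:- \<alpha>, 1:] [:c:]))"
      using gauss_extension.purely_transcendental_Y gauss s by blast
  next
    assume nt: "\<not> pc_transcendental v s"
    show "value_group v\<^sub>E = group_closure (insert \<Delta>\<^sub>E (value_group v))"
    proof (cases "pseudo_stationary v s")
      case True
      then obtain Y c where "gauss_extension v v\<^sub>E Y" and c: "v c = Val \<Delta>\<^sub>E" using ex_gauss by blast
      then have eq: "value_group v\<^sub>E = value_group v" by (intro gauss_extension.value_group_eq)
      have "\<Delta>\<^sub>E \<in> value_group v" using c by (auto simp: value_group_def)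
      then have "insert \<Delta>\<^sub>E (value_group v) = value_group v" by auto
      moreover have "\<gamma> \<in> value_group v" if "\<gamma> \<in> group_closure (value_group v)" for \<gamma>
        using that by induction (auto intro: value_group_0 value_group_diff)
      ultimately show ?thesis by (auto simp: eq intro: group_closure.base)
    next
      case False
      then obtain p where "key_polynomial v v\<^sub>E p \<Delta>\<^sub>E" using key nt by blast
      from key_polynomial.value_group_w[OF this] show ?thesis by (rule value_group_generated)
    qed
    show "v\<^sub>E (Fract p 1) = Val \<Delta>\<^sub>E" if "p \<in> P_E_min v s" for p using nt that by (rule min_value)
    show "Val \<Delta>\<^sub>E = stationary_value v s" if "pseudo_stationary v s" using that by (rule stat)
  next
    fix \<beta> assume \<beta>: "\<beta> \<in> pseudo_limits v s"
    \<comment> \<open>Once the transcendental type is excluded, X - \<beta> is among the polynomials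
      of minimal degree, so its value is \<open>\<Delta>\<^sub>E\<close>.\<close>
    have "\<not> pc_transcendental v s" using immediate_transcendental(2) \<beta> by blast
    moreover have "[:- \<beta>, 1:] \<in> P_E_min v s" using P_E_min_linear[OF \<beta>] \<beta> by blast
    ultimately have "v\<^sub>E (to_fract [:- \<beta>, 1:]) = Val \<Delta>\<^sub>E" unfolding to_fract_eq[symmetric] by (rule min_value)
    then show "v\<^sub>E = monomial_val v \<beta> \<Delta>\<^sub>E" by (rule w_eq_monomial_val[OF \<beta>])
  qed
qed

end
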